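(* Let $G$ be a finite connected graph without loops and multiple edges, all of whose vertices have degree at least $3$, and let $G(P)$, $P=(p_1,\dots,p_n)$, be a framework in $\mathbb{R}P^2$ in general position with distinct points $p_1,\dots,p_n$. Fix a resolution graph $G_{\mathcal T}$ of $G$ and the corresponding configuration space $\Xi_G(P)$. Then $G(P)$ admits a non-parallelizable tensegrity if and only if $G(P)$ satisfies the system of geometric conditions on $\Xi_G(P)$ for all simple cycles of $G$ that do not contain all vertices of $G$; that is, if and only if there is a choice of the non-fixed lines of $\Xi_G(P)$, with associated quantization generic, for which the geometric condition of every such simple cycle results in ``true''.
   Context: **Forces.** A force in $\mathbb{R}P^2$ is an exterior 2-form in $\Lambda^2(\mathbb{R}^3)$ (all such forms are decomposable). For $p=(a_1,a_2,a_3)$ put $dp=a_1dx_1+a_2dx_2+a_3dx_3$. A nonzero force equals $dp\wedge dq$ with $p,q\in\mathbb{R}^3$ linearly independent; its line of force is the projective line through the points represented by $p$ and $q$. The zero force is allowed wherever a force with a prescribed line of force is required. **Frameworks and tensegrities.** A framework $G(P)$ assigns to the vertices $v_1,\dots,v_n$ of $G$ points $p_1,\dots,p_n\in\mathbb{R}P^2$, with straight edges $p_ip_j$ for the edges $v_iv_j$. Lines $m_1,\dots,m_k$ are in general position if their pairwise intersections form a discrete set of exactly $k(k-1)/2$ distinct points. A realization of a cycle is in general position if the lines through its edges are in general position. A simple cycle of $G$ is a subgraph homeomorphic to a circle. $G(P)$ is in general position if every simple cycle of $G$ with at most $n-1$ vertices is realized in general position. A force-load $F$ on $G(P)$ assigns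 to each edge forces $F_{i,j},F_{j,i}$ with line of force $p_ip_j$ and $F_{i,j}+F_{j,i}=0$ (and $F_{i,j}=0$ for non-edges); it is an equilibrium force-load if $\sum_{j\neq i}F_{i,j}=0$ for every $i$; then $(G(P),F)$ is a tensegrity. It is non-parallelizable if at each vertex, with $F_1,\dots,F_s$ the forces at the edges adjacent to that vertex: (1) for $a_i\in\{0,1\}$, $\sum a_iF_i=0$ implies $a_1=\dots=a_s$; (2) the $2^{s-1}-1$ lines of force of $F_1+\sum_{i=2}^s a_iF_i$, $(a_2,\dots,a_s)\in\{0,1\}^{s-1}\setminus\{(1,\dots,1)\}$, are pairwise distinct. **Resolution schemes.** Let $T$ be an unrooted full binary tree (every vertex has degree 1 or 3). An edge is a leaf if one of its vertices has degree 1; other edges are interior. A resolution scheme $(T,\mathcal L)_p$ at $p\in\mathbb{R}P^2$ is such a $T$ with a map $\mathcal L$ from the edges of $T$ to lines of $\mathbb{R}P^2$ with $p\in\mathcal L(e)$ for all $e$. An equilibrium force-load on it assigns to each edge $v_iv_j$ forces $F_{i,j}=-F_{j,i}$ with line of force $\mathcal L(v_iv_j)$, summing to zero ($\sum_jF_{i,j}=0$) at each vertex $v_i$ of degree 3. The scheme is weakly generic if $\mathcal L$ takes different values on any two adjacent edges (then a nonzero equilibrium force-load exists and is unique up to proportionality). It is strongly generic if it is weakly generic and the forces $F_1,\dots,F_s$ at the leaves of a nonzero equilibrium force-load ($F_r=F_{i,j}$ with $v_j$ the degree-1 vertex of the leaf) satisfy conditions (1) and (2) above. **Quantizations.** Let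 $\mathcal T=(T_1,\dots,T_n)$ be disjoint unrooted full binary trees, the leaves of $T_i$ being in bijection with the edges of $G$ at $v_i$. The resolution graph $G_{\mathcal T}$ is obtained by gluing, for each edge $v_iv_j$ of $G$, the corresponding leaves of $T_i$ and $T_j$ into one edge (called a leaf of $G_{\mathcal T}$). The other edges are called interior. A quantization $G_{\mathcal T}(\mathcal L,P)$ is $G_{\mathcal T}$ with a map $\mathcal L$ from its edges to lines in $\mathbb{R}P^2$ with $\mathcal L(e)=p_ip_j$ for the leaf $e$ corresponding to $p_ip_j$, and $p_i\in\mathcal L(e)$ for every interior edge $e$ of $T_i$. It is generic if each resolution scheme $(T_i,\mathcal L|_{T_i})_{p_i}$ is strongly generic. **Configuration space.** $\Xi_G(P)$ is the configuration space of the fixed points $p_1,\dots,p_n$ and, for each $i$, of $\deg p_i-3$ non-fixed lines $\ell_{i,1},\dots,\ell_{i,\deg p_i-3}$ through $p_i$. After enumerating the interior edges of each $T_i$ as $e_{i,1},\dots,e_{i,\deg p_i-3}$, the rule $\ell_{i,j}=\mathcal L(e_{i,j})$ is a bijection between quantizations $G_{\mathcal T}(\mathcal L,P)$ and elements of $\Xi_G(P)$. **Operations.** I: intersection point $m_1\cap m_2$ of two lines. II: the line $(q_1,q_2)=q_1q_2$ through two points. III: choice of a point on a given line outside a given discrete set. IV: choice of a line through a given point outside a given finite collection of lines. The 3-line relation $m_1\cap m_2\cap m_3=true$ means that the three lines have a common point. If in I or II the two inputs coincide, the result is the symbol ``true''; any operation or relation with an input ``true'' results in ``true''. **$\mathrm{H}\Phi$-surgery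 on a resolution scheme at an interior edge $v_1v_2$.** Let $v_3,v_4$ be the other neighbours of $v_1$ and $v_5,v_6$ the other neighbours of $v_2$. Replace $v_1,v_2$ and the edges $v_1v_2,v_1v_3,v_1v_4,v_2v_5,v_2v_6$ by new vertices $v_1',v_2'$ and edges $v_1'v_2',v_1'v_3,v_1'v_5,v_2'v_4,v_2'v_6$; the last four edges carry the lines $\mathcal L(v_1v_3),\mathcal L(v_2v_5),\mathcal L(v_1v_4),\mathcal L(v_2v_6)$ respectively, all other old edges keep their lines, and $v_1'v_2'$ carries the line $\ell$ constructed as follows (for a scheme at $p$): choose $p_\infty\neq p$ on $\mathcal L(v_1v_2)$ and a line $\ell_\infty\neq\mathcal L(v_1v_2)$ through $p_\infty$; choose $p'\neq p$ on $\mathcal L(v_1v_3)$, $p'\notin\ell_\infty$; put $\hat\ell=p'\,(\mathcal L(v_1v_2)\cap\ell_\infty)$, $p''=\hat\ell\cap\mathcal L(v_2v_5)$, $\ell'=p'\,(\mathcal L(v_1v_4)\cap\ell_\infty)$, $\ell''=p''\,(\mathcal L(v_2v_6)\cap\ell_\infty)$, $p'''=\ell'\cap\ell''$, and $\ell=pp'''$. Two strongly generic resolution schemes are equivalent if a sequence of $\mathrm{H}\Phi$-surgeries takes one to the other. **Framing lines.** For edges $p_ip_j,p_ip_k$ at $p_i$, choose (and fix) a sequence of $\mathrm{H}\Phi$-surgeries taking $(T_i,\mathcal L|_{T_i})_{p_i}$ to an equivalent scheme $(T_i',\mathcal L')_{p_i}$ in which the leaves corresponding to these two edges share a vertex $v$;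 let $e$ be the third edge at $v$, and set $\ell_{jik}=\mathcal L'(e)$. This expresses $\ell_{jik}$ by Operations I–IV in terms of $P$ and the lines of $\Xi_G(P)$. **Geometric condition of a cycle.** For a simple cycle $C=q_1\dots q_k$ of $G(P)$ not containing all points of $P$, equip each $q_r=p_i$, with neighbours $p_j,p_m$ in $C$, with the line $\ell_r=\ell_{jim}$. The projection operation $\omega_1$ on a framed cycle $\big((q_1,\dots,q_k),(\ell_1,\dots,\ell_k)\big)$, $k\ge 4$, replaces $q_1,q_2$ by $q_1'=q_kq_1\cap q_2q_3$ and $\ell_1,\ell_2$ by $\ell_1'=q_1'(\ell_1\cap\ell_2)$, keeping the other vertices and lines. Applying $\omega_1$ $k-3$ times one obtains a framed triangle with framing lines $\ell,\ell_{k-1},\ell_k$ (if $k=3$ no operation is applied). The geometric condition of $C$ on $\Xi_G(P)$ is $\ell\cap\ell_{k-1}\cap\ell_k=true$, with all lines expressed via Operations I–IV in terms of $P$ and the non-fixed lines. A system of geometric conditions is fulfilled at $P$ if there exists a single choice of all non-fixed lines for which every condition of the system results in ``true''. *)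

theory Defs
  imports "HOL-Analysis.Analysis" "HOL-Library.Function_Algebras"
begin

section \<open>The projective plane and the operations\<close>

typedef rp2_point = "{S :: (real^3) set. subspace S \<and> dim S = 1}"
  using choose_subspace_of_subspace[of 1 "UNIV :: (real^3) set"] by auto

typedef rp2_line = "{S :: (real^3) set. subspace S \<and> dim S = 2}"
  using choose_subspace_of_subspace[of 2 "UNIV :: (real^3) set"] by auto

definition lies_on :: "rp2_point \<Rightarrow> rp2_line \<Rightarrow> bool" where
  "lies_on p m \<longleftrightarrow> Rep_rp2_point p \<subseteq> Rep_rp2_line m"

text \<open>Only meaningful if \<open>X\<close> consists of exactly two points, respectively if the two lines differ.\<close>

definition line_through :: "rp2_point set \<Rightarrow> rp2_line" where
  "line_through X = Abs_rp2_line (span (\<Union>p\<in>X. Rep_rp2_point p))"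

definition intersection :: "rp2_line \<Rightarrow> rp2_line \<Rightarrow> rp2_point" where
  "intersection m1 m2 = Abs_rp2_point (Rep_rp2_line m1 \<inter> Rep_rp2_line m2)"

text \<open>Operations I and II. The symbol ``true'' is encoded by \<open>None\<close>: it is produced by coinciding
  inputs and propagated.\<close>

definition Meet :: "rp2_line option \<Rightarrow> rp2_line option \<Rightarrow> rp2_point option" where
  "Meet a b = (case (a, b) of
      (Some m1, Some m2) \<Rightarrow> if m1 = m2 then None else Some (intersection m1 m2)
    | _ \<Rightarrow> None)"

definition Join :: "rp2_point option \<Rightarrow> rp2_point option \<Rightarrow> rp2_line option" where
  "Join a b = (case (a, b) of
      (Some q1, Some q2) \<Rightarrow> if q1 = q2 then None else Some (line_through {q1, q2})
    | _ \<Rightarrow> None)"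

text \<open>Operations III and IV are modelled by arbitrary choice functions that obey the required
  constraint. All sets excluded in Operation III below are finite, so the
  constraint is imposed only for finite sets.\<close>

definition operation_III :: "(rp2_line \<Rightarrow> rp2_point set \<Rightarrow> rp2_point) \<Rightarrow> bool" where
  "operation_III c \<longleftrightarrow> (\<forall>m X. finite X \<longrightarrow> lies_on (c m X) m \<and> c m X \<notin> X)"

definition operation_IV :: "(rp2_point \<Rightarrow> rp2_line set \<Rightarrow> rp2_line) \<Rightarrow> bool" where
  "operation_IV c \<longleftrightarrow> (\<forall>p Y. finite Y \<longrightarrow> lies_on p (c p Y) \<and> c p Y \<notin> Y)"

definition three_line_relation ::
    "rp2_line option \<Rightarrow> rp2_line option \<Rightarrow> rp2_line option \<Rightarrow> bool" where
  "three_line_relation a b c = (case (a, b, c) of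
      (Some m1, Some m2, Some m3) \<Rightarrow> \<exists>x. lies_on x m1 \<and> lies_on x m2 \<and> lies_on x m3
    | _ \<Rightarrow> True)"

section \<open>Forces\<close>

text \<open>Exterior 2-forms on \<open>\<real>\<^sup>3\<close> are alternating bilinear functions. The predicate \<open>force_on\<close> admits
  only zero and decomposable forms, so the type need not be restricted further.\<close>

type_synonym form2 = "real^3 \<Rightarrow> real^3 \<Rightarrow> real"

text \<open>\<open>wedge p q\<close> is \<open>dp \<and> dq\<close>, where \<open>dp\<close> is the linear form \<open>u \<mapsto> p \<bullet> u\<close>.\<close>

definition wedge :: "real^3 \<Rightarrow> real^3 \<Rightarrow> form2" where
  "wedge p q = (\<lambda>u v. (p \<bullet> u) * (q \<bullet> v) - (p \<bullet> v) * (q \<bullet> u))"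

definition line_of_force :: "form2 \<Rightarrow> rp2_line \<Rightarrow> bool" where
  "line_of_force F m \<longleftrightarrow>
    (\<exists>p q. p \<noteq> q \<and> independent {p, q} \<and> F = wedge p q \<and> Rep_rp2_line m = span {p, q})"

definition force_on :: "rp2_line \<Rightarrow> form2 \<Rightarrow> bool" where
  "force_on m F \<longleftrightarrow> F = 0 \<or> line_of_force F m"

text \<open>Conditions (1) and (2) for a finite family of forces \<open>f\<close> indexed by \<open>N\<close>, with 0/1 coefficient
  vectors written as subsets of \<open>N\<close>. In (2) every index \<open>x\<close> may play the role of the first force;
  for families with sum zero this does not depend on \<open>x\<close>. The sums in (2) are nonzero by (1), so
  they do have lines of force.\<close>

definition nonparallel_forces :: "'a set \<Rightarrow> ('a \<Rightarrow> form2) \<Rightarrow> bool" where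
  "nonparallel_forces N f \<longleftrightarrow>
    (\<forall>A \<subseteq> N. sum f A = 0 \<longrightarrow> A = {} \<or> A = N) \<and>
    (\<forall>x \<in> N. \<forall>A B. A \<subset> N - {x} \<longrightarrow> B \<subset> N - {x} \<longrightarrow> A \<noteq> B \<longrightarrow>
      (\<forall>m m'. line_of_force (f x + sum f A) m \<longrightarrow> line_of_force (f x + sum f B) m' \<longrightarrow> m \<noteq> m'))"

section \<open>Graphs\<close>

text \<open>All graphs below have no isolated vertices, hence are determined by their edge sets: a graph is
  a set \<open>E\<close> of two-element sets, with vertex set \<open>\<Union>E\<close>.\<close>

definition simple_graph :: "'a set set \<Rightarrow> bool" where
  "simple_graph E \<longleftrightarrow> finite E \<and> (\<forall>e\<in>E. card e = 2)"

definition nbrs :: "'a set set \<Rightarrow> 'a \<Rightarrow> 'a set" where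
  "nbrs E v = {w. {v, w} \<in> E}"

definition vdegree :: "'a set set \<Rightarrow> 'a \<Rightarrow> nat" where
  "vdegree E v = card (nbrs E v)"

definition connected_graph :: "'a set set \<Rightarrow> bool" where
  "connected_graph E \<longleftrightarrow> (\<forall>u \<in> \<Union>E. \<forall>v \<in> \<Union>E. (u, v) \<in> {(x, y). {x, y} \<in> E}\<^sup>*)"

text \<open>A simple cycle is a subgraph (again given by its edges); \<open>labels q C\<close> says that \<open>q\<close> lists the
  vertices of \<open>C\<close> in cyclic order.\<close>

definition labels :: "'a list \<Rightarrow> 'a set set \<Rightarrow> bool" where
  "labels q C \<longleftrightarrow> 3 \<le> length q \<and> distinct q \<and>
     C = {{q ! r, q ! ((r + 1) mod length q)} | r. r < length q}"

definition simple_cycle :: "'a set set \<Rightarrow> 'a set set \<Rightarrow> bool" where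
  "simple_cycle E C \<longleftrightarrow> C \<subseteq> E \<and> (\<exists>q. labels q C)"

section \<open>Frameworks and tensegrities\<close>

definition lines_general_position :: "'a set \<Rightarrow> ('a \<Rightarrow> rp2_line) \<Rightarrow> bool" where
  "lines_general_position I m \<longleftrightarrow>
    (let X = {x. \<exists>a\<in>I. \<exists>b\<in>I. a \<noteq> b \<and> lies_on x (m a) \<and> lies_on x (m b)}
     in finite X \<and> card X = card I * (card I - 1) div 2)"

definition framework_general_position :: "'v set set \<Rightarrow> ('v \<Rightarrow> rp2_point) \<Rightarrow> bool" where
  "framework_general_position E P \<longleftrightarrow>
    (\<forall>C. simple_cycle E C \<and> card (\<Union>C) \<le> card (\<Union>E) - 1 \<longrightarrow>
      lines_general_position C (\<lambda>e. line_through (P ` e)))"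

definition force_load :: "'v set set \<Rightarrow> ('v \<Rightarrow> rp2_point) \<Rightarrow> ('v \<Rightarrow> 'v \<Rightarrow> form2) \<Rightarrow> bool" where
  "force_load E P F \<longleftrightarrow>
    (\<forall>i j. {i, j} \<in> E \<longrightarrow> force_on (line_through {P i, P j}) (F i j) \<and> F i j + F j i = 0) \<and>
    (\<forall>i j. {i, j} \<notin> E \<longrightarrow> F i j = 0)"

definition tensegrity :: "'v set set \<Rightarrow> ('v \<Rightarrow> rp2_point) \<Rightarrow> ('v \<Rightarrow> 'v \<Rightarrow> form2) \<Rightarrow> bool" where
  "tensegrity E P F \<longleftrightarrow>
    force_load E P F \<and> (\<forall>i \<in> \<Union>E. (\<Sum>j \<in> \<Union>E - {i}. F i j) = 0)"

definition non_parallelizable :: "'v set set \<Rightarrow> ('v \<Rightarrow> 'v \<Rightarrow> form2) \<Rightarrow> bool" where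
  "non_parallelizable E F \<longleftrightarrow> (\<forall>i \<in> \<Union>E. nonparallel_forces (nbrs E i) (F i))"

section \<open>Resolution schemes\<close>

definition full_binary_tree :: "'t set set \<Rightarrow> bool" where
  "full_binary_tree S \<longleftrightarrow> S \<noteq> {} \<and> simple_graph S \<and> connected_graph S \<and>
    (\<nexists>C. simple_cycle S C) \<and> (\<forall>v \<in> \<Union>S. vdegree S v = 1 \<or> vdegree S v = 3)"

definition end_vertices :: "'t set set \<Rightarrow> 't set" where
  "end_vertices S = {v \<in> \<Union>S. vdegree S v = 1}"

definition interior_edges :: "'t set set \<Rightarrow> 't set set" where
  "interior_edges S = {e \<in> S. \<forall>v \<in> e. vdegree S v \<noteq> 1}"

text \<open>The unique neighbour of a vertex of degree 1.\<close>

definition stem :: "'t set set \<Rightarrow> 't \<Rightarrow> 't" where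
  "stem S v = the_elem (nbrs S v)"

definition resolution_scheme ::
    "rp2_point \<Rightarrow> 't set set \<Rightarrow> ('t set \<Rightarrow> rp2_line) \<Rightarrow> bool" where
  "resolution_scheme p S M \<longleftrightarrow> full_binary_tree S \<and> (\<forall>e \<in> S. lies_on p (M e))"

definition scheme_equilibrium ::
    "'t set set \<Rightarrow> ('t set \<Rightarrow> rp2_line) \<Rightarrow> ('t \<Rightarrow> 't \<Rightarrow> form2) \<Rightarrow> bool" where
  "scheme_equilibrium S M H \<longleftrightarrow>
    (\<forall>u v. {u, v} \<in> S \<longrightarrow> force_on (M {u, v}) (H u v) \<and> H u v = - H v u) \<and>
    (\<forall>u \<in> \<Union>S. vdegree S u = 3 \<longrightarrow> (\<Sum>v \<in> nbrs S u. H u v) = 0)"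

definition weakly_generic ::
    "rp2_point \<Rightarrow> 't set set \<Rightarrow> ('t set \<Rightarrow> rp2_line) \<Rightarrow> bool" where
  "weakly_generic p S M \<longleftrightarrow> resolution_scheme p S M \<and>
    (\<forall>e \<in> S. \<forall>e' \<in> S. e \<noteq> e' \<and> e \<inter> e' \<noteq> {} \<longrightarrow> M e \<noteq> M e')"

definition strongly_generic ::
    "rp2_point \<Rightarrow> 't set set \<Rightarrow> ('t set \<Rightarrow> rp2_line) \<Rightarrow> bool" where
  "strongly_generic p S M \<longleftrightarrow> weakly_generic p S M \<and>
    (\<exists>H. scheme_equilibrium S M H \<and> (\<exists>u v. {u, v} \<in> S \<and> H u v \<noteq> 0) \<and>
      nonparallel_forces (end_vertices S) (\<lambda>w. H (stem S w) w))"

section \<open>Quantizations\<close>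

text \<open>\<open>lf i j\<close> is the end vertex of the leaf of \<open>T i\<close> that corresponds to the edge \<open>{i, j}\<close>.\<close>

definition resolution_trees ::
    "'v set set \<Rightarrow> ('v \<Rightarrow> 't set set) \<Rightarrow> ('v \<Rightarrow> 'v \<Rightarrow> 't) \<Rightarrow> bool" where
  "resolution_trees E T lf \<longleftrightarrow> (\<forall>i \<in> \<Union>E. full_binary_tree (T i) \<and>
     bij_betw (lf i) (nbrs E i) (end_vertices (T i)))"

text \<open>In the resolution graph the trees are made disjoint by tagging: vertex \<open>x\<close> of \<open>T i\<close> becomes
  \<open>(i, x)\<close>. Gluing the two leaves for \<open>{i, j}\<close> leaves one edge between their stems. The edges of
  the resolution graph are the \<open>leaf_edge\<close>s for \<open>{i, j} \<in> E\<close> and the sets \<open>Pair i ` e\<close> for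
  interior edges \<open>e\<close> of \<open>T i\<close>.\<close>

definition leaf_edge ::
    "('v \<Rightarrow> 't set set) \<Rightarrow> ('v \<Rightarrow> 'v \<Rightarrow> 't) \<Rightarrow> 'v \<Rightarrow> 'v \<Rightarrow> ('v \<times> 't) set" where
  "leaf_edge T lf i j = {(i, stem (T i) (lf i j)), (j, stem (T j) (lf j i))}"

definition quantization ::
    "'v set set \<Rightarrow> ('v \<Rightarrow> 't set set) \<Rightarrow> ('v \<Rightarrow> 'v \<Rightarrow> 't) \<Rightarrow> ('v \<Rightarrow> rp2_point) \<Rightarrow>
     (('v \<times> 't) set \<Rightarrow> rp2_line) \<Rightarrow> bool" where
  "quantization E T lf P L \<longleftrightarrow>
    (\<forall>i j. {i, j} \<in> E \<longrightarrow> L (leaf_edge T lf i j) = line_through {P i, P j}) \<and>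
    (\<forall>i \<in> \<Union>E. \<forall>e \<in> interior_edges (T i). lies_on (P i) (L (Pair i ` e)))"

text \<open>The edge of the resolution graph that an edge of \<open>T i\<close> becomes after gluing.\<close>

definition glued_edge ::
    "'v set set \<Rightarrow> ('v \<Rightarrow> 't set set) \<Rightarrow> ('v \<Rightarrow> 'v \<Rightarrow> 't) \<Rightarrow> 'v \<Rightarrow> 't set \<Rightarrow> ('v \<times> 't) set" where
  "glued_edge E T lf i e =
    (if \<exists>j \<in> nbrs E i. lf i j \<in> e
     then leaf_edge T lf i (THE j. j \<in> nbrs E i \<and> lf i j \<in> e)
     else Pair i ` e)"

definition generic_quantization ::
    "'v set set \<Rightarrow> ('v \<Rightarrow> 't set set) \<Rightarrow> ('v \<Rightarrow> 'v \<Rightarrow> 't) \<Rightarrow> ('v \<Rightarrow> rp2_point) \<Rightarrow>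
     (('v \<times> 't) set \<Rightarrow> rp2_line) \<Rightarrow> bool" where
  "generic_quantization E T lf P L \<longleftrightarrow> quantization E T lf P L \<and>
    (\<forall>i \<in> \<Union>E. strongly_generic (P i) (T i) (\<lambda>e. L (glued_edge E T lf i e)))"

text \<open>An element of the configuration space is given by its non-fixed lines.\<close>

definition config_space :: "'v set set \<Rightarrow> ('v \<Rightarrow> rp2_point) \<Rightarrow> ('v \<Rightarrow> nat \<Rightarrow> rp2_line) set" where
  "config_space E P = {l. \<forall>i \<in> \<Union>E. \<forall>j \<in> {1..vdegree E i - 3}. lies_on (P i) (l i j)}"

definition interior_enumeration ::
    "'v set set \<Rightarrow> ('v \<Rightarrow> 't set set) \<Rightarrow> ('v \<Rightarrow> nat \<Rightarrow> 't set) \<Rightarrow> bool" where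
  "interior_enumeration E T en \<longleftrightarrow>
    (\<forall>i \<in> \<Union>E. bij_betw (en i) {1..vdegree E i - 3} (interior_edges (T i)))"

definition associated_quantization ::
    "'v set set \<Rightarrow> ('v \<Rightarrow> 't set set) \<Rightarrow> ('v \<Rightarrow> 'v \<Rightarrow> 't) \<Rightarrow> ('v \<Rightarrow> rp2_point) \<Rightarrow>
     ('v \<Rightarrow> nat \<Rightarrow> 't set) \<Rightarrow> ('v \<Rightarrow> nat \<Rightarrow> rp2_line) \<Rightarrow> (('v \<times> 't) set \<Rightarrow> rp2_line) \<Rightarrow> bool" where
  "associated_quantization E T lf P en l L \<longleftrightarrow> quantization E T lf P L \<and>
    (\<forall>i \<in> \<Union>E. \<forall>j \<in> {1..vdegree E i - 3}. l i j = L (Pair i ` en i j))"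

section \<open>H\<open>\<Phi>\<close>-surgeries and framing lines\<close>

text \<open>\<open>HPhi v1 v2 v3 v4 v5 v6 c3 c4\<close> is the surgery at the interior edge \<open>v1v2\<close>, where \<open>v3, v4\<close> are
  the other neighbours of \<open>v1\<close> and \<open>v5, v6\<close> those of \<open>v2\<close>. Each surgery comes with its own choice
  functions for Operations III and IV.\<close>

datatype 't surgery =
  HPhi 't 't 't 't 't 't "rp2_line \<Rightarrow> rp2_point set \<Rightarrow> rp2_point" "rp2_point \<Rightarrow> rp2_line set \<Rightarrow> rp2_line"

fun surgery_applicable :: "'t set set \<Rightarrow> 't surgery \<Rightarrow> bool" where
  "surgery_applicable S (HPhi v1 v2 v3 v4 v5 v6 c3 c4) \<longleftrightarrow>
    distinct [v1, v2, v3, v4, v5, v6] \<and>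
    nbrs S v1 = {v2, v3, v4} \<and> nbrs S v2 = {v1, v5, v6} \<and>
    operation_III c3 \<and> operation_IV c4"

text \<open>The names \<open>v1, v2\<close> are reused for the new vertices \<open>v1', v2'\<close>. Thus the edges \<open>v1v2, v1v3, v2v6\<close>
  persist, while \<open>v1v4, v2v5\<close> are replaced by \<open>v2v4, v1v5\<close>. The end vertices of the tree, and with
  them the naming of its leaves, do not change.\<close>

fun surgery_tree :: "'t surgery \<Rightarrow> 't set set \<Rightarrow> 't set set" where
  "surgery_tree (HPhi v1 v2 v3 v4 v5 v6 c3 c4) S =
    (S - {{v1, v4}, {v2, v5}}) \<union> {{v2, v4}, {v1, v5}}"

definition surgery_line ::
    "(rp2_line \<Rightarrow> rp2_point set \<Rightarrow> rp2_point) \<Rightarrow> (rp2_point \<Rightarrow> rp2_line set \<Rightarrow> rp2_line) \<Rightarrow> rp2_point \<Rightarrow>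
     rp2_line option \<Rightarrow> rp2_line option \<Rightarrow> rp2_line option \<Rightarrow> rp2_line option \<Rightarrow> rp2_line option \<Rightarrow>
     rp2_line option" where
  "surgery_line c3 c4 p m12 m13 m14 m25 m26 = (case (m12, m13) of
      (Some a, Some b) \<Rightarrow>
        (let p_inf = c3 a {p};
             l_inf = c4 p_inf {a};
             p1 = c3 b ({p} \<union> {x. lies_on x b \<and> lies_on x l_inf});
             l_hat = Join (Some p1) (Meet m12 (Some l_inf));
             p2 = Meet l_hat m25;
             l1 = Join (Some p1) (Meet m14 (Some l_inf));
             l2 = Join p2 (Meet m26 (Some l_inf));
             p3 = Meet l1 l2
         in Join (Some p) p3)
    | _ \<Rightarrow> None)"

fun surgery_lines ::
    "rp2_point \<Rightarrow> 't surgery \<Rightarrow> ('t set \<Rightarrow> rp2_line option) \<Rightarrow> ('t set \<Rightarrow> rp2_line option)" where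
  "surgery_lines p (HPhi v1 v2 v3 v4 v5 v6 c3 c4) M =
    M({v1, v2} := surgery_line c3 c4 p (M {v1, v2}) (M {v1, v3}) (M {v1, v4}) (M {v2, v5}) (M {v2, v6}),
      {v1, v5} := M {v2, v5},
      {v2, v4} := M {v1, v4})"

fun surgeries_applicable :: "'t set set \<Rightarrow> 't surgery list \<Rightarrow> bool" where
  "surgeries_applicable S [] \<longleftrightarrow> True"
| "surgeries_applicable S (s # ss) \<longleftrightarrow>
    surgery_applicable S s \<and> surgeries_applicable (surgery_tree s S) ss"

text \<open>\<open>sg i j k\<close> is the chosen sequence of surgeries that brings the leaves of \<open>T i\<close> for \<open>{i, j}\<close> and
  \<open>{i, k}\<close> to a common vertex. It is independent of the non-fixed lines.\<close>

definition framing_surgeries ::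
    "'v set set \<Rightarrow> ('v \<Rightarrow> 't set set) \<Rightarrow> ('v \<Rightarrow> 'v \<Rightarrow> 't) \<Rightarrow>
     ('v \<Rightarrow> 'v \<Rightarrow> 'v \<Rightarrow> 't surgery list) \<Rightarrow> bool" where
  "framing_surgeries E T lf sg \<longleftrightarrow>
    (\<forall>i j k. {i, j} \<in> E \<longrightarrow> {i, k} \<in> E \<longrightarrow> j \<noteq> k \<longrightarrow>
      surgeries_applicable (T i) (sg i j k) \<and>
      (let S = fold surgery_tree (sg i j k) (T i) in stem S (lf i j) = stem S (lf i k)))"

definition framing_line ::
    "'v set set \<Rightarrow> ('v \<Rightarrow> 't set set) \<Rightarrow> ('v \<Rightarrow> 'v \<Rightarrow> 't) \<Rightarrow> ('v \<Rightarrow> rp2_point) \<Rightarrow>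
     ('v \<Rightarrow> 'v \<Rightarrow> 'v \<Rightarrow> 't surgery list) \<Rightarrow> (('v \<times> 't) set \<Rightarrow> rp2_line) \<Rightarrow> 'v \<Rightarrow> 'v \<Rightarrow> 'v \<Rightarrow>
     rp2_line option" where
  "framing_line E T lf P sg L j i k =
    (let S = fold surgery_tree (sg i j k) (T i);
         M = fold (surgery_lines (P i)) (sg i j k) (\<lambda>e. Some (L (glued_edge E T lf i e)));
         v = stem S (lf i j);
         w = the_elem (nbrs S v - {lf i j, lf i k})
     in M {v, w})"

section \<open>Geometric conditions of cycles\<close>

type_synonym framed_cycle = "(rp2_point option \<times> rp2_line option) list"

fun omega1 :: "framed_cycle \<Rightarrow> framed_cycle" where
  "omega1 ((q1, l1) # (q2, l2) # rest) =
    (let q = Meet (Join (fst (last rest)) q1) (Join q2 (fst (hd rest)))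
     in (q, Join q (Meet l1 l2)) # rest)"
| "omega1 c = c"

definition framed_cycle_condition :: "framed_cycle \<Rightarrow> bool" where
  "framed_cycle_condition c =
    (let t = (omega1 ^^ (length c - 3)) c
     in three_line_relation (snd (t ! 0)) (snd (t ! 1)) (snd (t ! 2)))"

text \<open>The vertex \<open>q ! r\<close> of a cycle is framed with respect to its predecessor and its successor.\<close>

definition geometric_condition ::
    "'v set set \<Rightarrow> ('v \<Rightarrow> 't set set) \<Rightarrow> ('v \<Rightarrow> 'v \<Rightarrow> 't) \<Rightarrow> ('v \<Rightarrow> rp2_point) \<Rightarrow>
     ('v \<Rightarrow> 'v \<Rightarrow> 'v \<Rightarrow> 't surgery list) \<Rightarrow> (('v \<times> 't) set \<Rightarrow> rp2_line) \<Rightarrow> 'v list \<Rightarrow> bool" where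
  "geometric_condition E T lf P sg L q =
    (let k = length q in framed_cycle_condition
      (map (\<lambda>r. (Some (P (q ! r)),
                 framing_line E T lf P sg L (q ! ((r + k - 1) mod k)) (q ! r) (q ! ((r + 1) mod k))))
           [0..<k]))"

end

theory Submission
  imports Defs
begin

text \<open>A force is represented by a normal vector of its line of force, so that equilibrium becomes
  linear algebra in \<open>\<real>\<^sup>3\<close>. On a strongly generic resolution scheme the force on an edge is the sum of the
  forces at the leaves beyond that edge, and an H\<open>\<Phi>\<close>-surgery realizes the same leaf forces on the new
  tree; hence \<open>\<ell>\<^sub>j\<^sub>i\<^sub>k\<close> is the line of the sum of the forces at the leaves \<open>ij\<close> and \<open>ik\<close>. The operation
  \<open>\<omega>\<^sub>1\<close> preserves whether a framed cycle carries forces along its edges that are balanced by forces on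
  the framing lines, and for a triangle this means that the framing lines are concurrent. Therefore the
  condition of a cycle says that the equilibria at its vertices, each unique up to a scalar, can be
  scaled so as to agree on its edges. Since degrees are at least 3, a Hamiltonian cycle has a chord and its
  condition follows from those of two shorter cycles; so the conditions hold for all
  non-Hamiltonian cycles if and only if the local equilibria can be scaled to agree on all
  edges, that is, form a tensegrity.\<close>

text \<open>The main obstacle is the symbol "true": a condition that holds because a construction
  degenerates says nothing about forces. Nondegeneracy has two sources. Inside a resolution tree it
  is the nonparallelism of sums of leaf forces; this property refers to the leaf forces only, so it
  survives every surgery although the tree and its interior lines change. Along a cycle it is
  general position of the edge lines, available only for cycles that miss a vertex; hence
  Hamiltonian cycles need the detour through a chord. Once degeneracy is excluded, every framing
  line and every projected framing line has an explicit normal vector. On a cycle the scalars are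
  first chosen along a path that omits one edge. A single scalar equation then remains, and this is
  what the iterated projection tests. Its reformulation by scalars refers only to the subgraph and
  the local equilibria, so labelling, surgeries and auxiliary points cannot affect the
  outcome.\<close>

unbundle cross3_syntax

section \<open>Vectors for points, lines and forces\<close>

lemma cross_swap_eq_0: "x \<times> y = 0 \<longleftrightarrow> y \<times> x = 0" for x :: "real^3"
  by (metis cross_skew neg_equal_0_iff_equal)

lemma cross_eq_0_scaleR:
  fixes x y :: "real^3"
  assumes "x \<times> y = 0" "x \<noteq> 0"
  obtains c where "y = c *\<^sub>R x"
proof -
  have "x \<times> (x \<times> y) = (x \<bullet> y) *\<^sub>R x - (x \<bullet> x) *\<^sub>R y" by (rule Lagrange)
  then have "(x \<bullet> x) *\<^sub>R y = (x \<bullet> y) *\<^sub>R x" using assms by simp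
  then have "y = ((x \<bullet> y) / (x \<bullet> x)) *\<^sub>R x"
    using assms(2) by (metis (no_types, lifting) divide_inverse_commute inner_eq_zero_iff
        real_vector_eq_affinity scaleR_scaleR vector_fraction_eq_iff)
  then show thesis by (rule that)
qed

lemma orthogonal_to_two:
  fixes x y n :: "real^3"
  assumes "x \<times> y \<noteq> 0" "n \<bullet> x = 0" "n \<bullet> y = 0"
  obtains c where "n = c *\<^sub>R (x \<times> y)"
proof -
  have "(x \<times> y) \<times> n = - (n \<times> (x \<times> y))" by (rule cross_skew)
  also have "\<dots> = 0" using assms by (simp add: Lagrange)
  finally show thesis using assms(1) that by (metis cross_eq_0_scaleR)
qed

text \<open>The lines through the intersection of two distinct lines form a pencil, so their normals
  are combinations of the two given ones. The coefficients come from expanding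
  \<open>z \<times> (n \<times> z)\<close> with \<open>z = x \<times> y\<close> in two ways by
  Lagrange's identity.\<close>

lemma decompose_orthogonal:
  fixes x y n :: "real^3"
  assumes "x \<times> y \<noteq> 0" "n \<bullet> (x \<times> y) = 0"
  obtains c d where "n = c *\<^sub>R x + d *\<^sub>R y"
proof -
  let ?z = "x \<times> y"
  have z: "?z \<bullet> ?z \<noteq> 0" using assms by simp
  have "?z \<times> (n \<times> ?z) = (?z \<bullet> ?z) *\<^sub>R n" using Lagrange[of ?z n ?z] assms by (simp add: inner_commute)
  moreover have "n \<times> ?z = (n \<bullet> y) *\<^sub>R x - (n \<bullet> x) *\<^sub>R y" by (simp add: Lagrange)
  ultimately have "(?z \<bullet> ?z) *\<^sub>R n = (n \<bullet> y) *\<^sub>R (?z \<times> x) - (n \<bullet> x) *\<^sub>R (?z \<times> y)"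
    by (simp add: Cross3.right_diff_distrib cross_mult_right)
  moreover have "?z \<times> x = - (x \<times> ?z)" "?z \<times> y = - (y \<times> ?z)" by (rule cross_skew)+
  ultimately have "(?z \<bullet> ?z) *\<^sub>R n =
      ((n \<bullet> y) * (x \<bullet> x) - (n \<bullet> x) * (y \<bullet> x)) *\<^sub>R y
      + (- (n \<bullet> y) * (x \<bullet> y) + (n \<bullet> x) * (y \<bullet> y)) *\<^sub>R x"
    by (simp add: Lagrange algebra_simps)
  then have "n = (1 / (?z \<bullet> ?z)) *\<^sub>R
      (((n \<bullet> y) * (x \<bullet> x) - (n \<bullet> x) * (y \<bullet> x)) *\<^sub>R y
      + (- (n \<bullet> y) * (x \<bullet> y) + (n \<bullet> x) * (y \<bullet> y)) *\<^sub>R x)"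
    using z by (metis (no_types, lifting) divide_inverse_commute inverse_eq_divide
        scaleR_left.diff scaleR_one scaleR_scaleR left_inverse)
  then have "\<exists>c d. n = c *\<^sub>R x + d *\<^sub>R y" 
    by (metis (no_types, lifting) scaleR_right_distrib scaleR_scaleR add.commute)
  with that show thesis by blast
qed

section \<open>Homogeneous coordinates of points and lines\<close>

definition pt :: "real^3 \<Rightarrow> rp2_point" where
  "pt x = Abs_rp2_point (span {x})"

text \<open>Dual coordinates turn incidence, equality, intersection and join into statements about
  inner and cross products. For the zero vector the set passed to the abstraction function has the
  wrong dimension, as it has for \<open>pt\<close>; hence the nonvanishing assumptions
  below.\<close>

definition nline :: "real^3 \<Rightarrow> rp2_line" where
  "nline n = Abs_rp2_line {x. n \<bullet> x = 0}"

lemma Rep_pt: "x \<noteq> 0 \<Longrightarrow> Rep_rp2_point (pt x) = span {x}"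
  unfolding pt_def by (rule Abs_rp2_point_inverse) (auto simp: dim_insert)

lemma Rep_nline: "n \<noteq> 0 \<Longrightarrow> Rep_rp2_line (nline n) = {x. n \<bullet> x = 0}"
  unfolding nline_def by (rule Abs_rp2_line_inverse) (auto simp: subspace_hyperplane dim_hyperplane)

lemma pt_cases:
  obtains x where "x \<noteq> 0" "p = pt x"
proof -
  from Rep_rp2_point[of p] have p: "subspace (Rep_rp2_point p)" "dim (Rep_rp2_point p) = 1" by auto
  obtain B where B: "B \<subseteq> Rep_rp2_point p" "independent B" "Rep_rp2_point p \<subseteq> span B" "card B = 1"
    using p(2) basis_exists[of "Rep_rp2_point p"] by metis
  then obtain x where x: "B = {x}" by (auto simp: card_1_singleton_iff)
  then have "span {x} = Rep_rp2_point p" using B p(1) span_minimal by blast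
  moreover have "x \<noteq> 0" using B(2) x dependent_zero by blast
  ultimately show thesis using that[of x] by (simp add: pt_def Rep_rp2_point_inverse)
qed

lemma orthogonal_complement_two:
  fixes x y :: "real^3"
  assumes "x \<times> y \<noteq> 0"
  shows "span {x, y} = {v. (x \<times> y) \<bullet> v = 0}"
proof
  show "span {x, y} \<subseteq> {v. (x \<times> y) \<bullet> v = 0}"
    by (rule span_minimal) (auto simp: subspace_hyperplane dot_cross_self)
  show "{v. (x \<times> y) \<bullet> v = 0} \<subseteq> span {x, y}"
  proof
    fix v assume "v \<in> {v. (x \<times> y) \<bullet> v = 0}"
    then have "v \<bullet> (x \<times> y) = 0" by (simp add: inner_commute)
    then obtain c d where "v = c *\<^sub>R x + d *\<^sub>R y" by (rule decompose_orthogonal[OF assms])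
    then show "v \<in> span {x, y}" by (simp add: span_add span_scale span_base)
  qed
qed

lemma independent_two_iff_cross:
  fixes x y :: "real^3"
  shows "x \<noteq> y \<and> independent {x, y} \<longleftrightarrow> x \<times> y \<noteq> 0"
proof
  assume a: "x \<noteq> y \<and> independent {x, y}"
  show "x \<times> y \<noteq> 0"
  proof
    assume z: "x \<times> y = 0"
    have "x \<noteq> 0" using a dependent_zero by blast
    then obtain c where "y = c *\<^sub>R x" using z cross_eq_0_scaleR by blast
    then have "y \<in> span {x}" by (simp add: span_base span_scale)
    moreover have "{x, y} - {y} = {x}" using a by auto
    ultimately have "dependent {x, y}" by (metis dependent_def insertCI)
    then show False using a by blast
  qed
next
  assume a: "x \<times> y \<noteq> 0"
  then have "x \<noteq> y" by auto
  moreover have "y \<noteq> 0" using a by auto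
  moreover have "x \<notin> span {y}"
  proof
    assume "x \<in> span {y}"
    then obtain c where "x = c *\<^sub>R y" by (auto simp: span_singleton)
    then show False using a by (simp add: cross_mult_left)
  qed
  ultimately show "x \<noteq> y \<and> independent {x, y}" 
    by (metis independent_insert dependent_single singletonD)
qed

lemma nline_cases:
  obtains n where "n \<noteq> 0" "m = nline n"
proof -
  from Rep_rp2_line[of m] have m: "subspace (Rep_rp2_line m)" "dim (Rep_rp2_line m) = 2" by auto
  obtain B where B: "B \<subseteq> Rep_rp2_line m" "independent B" "Rep_rp2_line m \<subseteq> span B" "card B = 2"
    using m(2) basis_exists[of "Rep_rp2_line m"] by metis
  then obtain x y where xy: "B = {x, y}" "x \<noteq> y" by (auto simp: card_2_iff)
  then have s: "span {x, y} = Rep_rp2_line m" using B m(1) span_minimal by blast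
  have c: "x \<times> y \<noteq> 0" using B xy independent_two_iff_cross by blast
  show thesis
  proof (rule that[OF c])
    show "m = nline (x \<times> y)"
      unfolding nline_def orthogonal_complement_two[OF c, symmetric] s by (simp add: Rep_rp2_line_inverse)
  qed
qed

lemma lies_on_iff: "x \<noteq> 0 \<Longrightarrow> n \<noteq> 0 \<Longrightarrow> lies_on (pt x) (nline n) \<longleftrightarrow> n \<bullet> x = 0"
  unfolding lies_on_def Rep_pt Rep_nline
  using span_minimal[of "{x}" "{v. n \<bullet> v = 0}"] span_base[of x "{x}"]
  by (auto simp: subspace_hyperplane)

lemma pt_eq_iff:
  assumes "x \<noteq> 0" "y \<noteq> 0"
  shows "pt x = pt y \<longleftrightarrow> x \<times> y = 0"
proof
  assume "pt x = pt y"
  then have "span {x} = span {y}" using assms by (metis Rep_pt)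
  then obtain c where "y = c *\<^sub>R x" by (metis (no_types, lifting) span_base insertI1 span_singleton rangeE)
  then show "x \<times> y = 0" by (simp add: cross_mult_right)
next
  assume "x \<times> y = 0"
  then obtain c where c: "y = c *\<^sub>R x" using assms(1) cross_eq_0_scaleR by blast
  then have "c \<noteq> 0" using assms by auto
  then have "span {y} = span {x}" using c by (simp add: span_image_scale[of "{x}" "\<lambda>_. c", simplified])
  then show "pt x = pt y" by (simp add: pt_def)
qed

lemma nline_scaleR: "c \<noteq> 0 \<Longrightarrow> nline (c *\<^sub>R n) = nline n"
  by (simp add: nline_def)

lemma nline_minus: "nline (- n) = nline n"
  by (simp add: nline_def)

lemma nline_eq_iff:
  assumes "n \<noteq> 0" "m \<noteq> 0"
  shows "nline n = nline m \<longleftrightarrow> n \<times> m = 0"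
proof
  assume "nline n = nline m"
  then have "{x. n \<bullet> x = 0} = {x. m \<bullet> x = 0}" using assms by (metis Rep_nline)
  \<comment> \<open>\<open>m \<times> (n \<times> m)\<close> lies in the plane of \<open>m\<close>,
    and its inner product with \<open>n\<close> is the squared norm of
    \<open>n \<times> m\<close>.\<close>
  moreover have "m \<bullet> (m \<times> (n \<times> m)) = 0" by (rule dot_cross_self)
  ultimately have "n \<bullet> (m \<times> (n \<times> m)) = 0" by blast
  moreover have "n \<bullet> (m \<times> (n \<times> m)) = (n \<times> m) \<bullet> (n \<times> m)"
    by (metis cross_triple inner_commute)
  ultimately show "n \<times> m = 0" by simp
next
  assume "n \<times> m = 0"
  then obtain c where c: "m = c *\<^sub>R n" using assms(1) cross_eq_0_scaleR by blast
  then have "c \<noteq> 0" using assms by auto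
  then show "nline n = nline m" using c by (simp add: nline_scaleR)
qed

lemma pt_eqI:
  assumes "x \<noteq> 0" "n \<bullet> x = 0" "m \<bullet> x = 0" "n \<times> m \<noteq> 0"
  shows "pt x = pt (n \<times> m)"
proof -
  have "x \<bullet> n = 0" "x \<bullet> m = 0" using assms by (simp_all add: inner_commute)
  then obtain c where "x = c *\<^sub>R (n \<times> m)" by (rule orthogonal_to_two[OF assms(4)])
  then show ?thesis using assms by (subst pt_eq_iff) (auto simp: cross_mult_left)
qed

lemma nline_eqI:
  assumes "n \<noteq> 0" "n \<bullet> x = 0" "n \<bullet> y = 0" "x \<times> y \<noteq> 0"
  shows "nline n = nline (x \<times> y)"
proof -
  obtain c where "n = c *\<^sub>R (x \<times> y)" using orthogonal_to_two[OF assms(4) assms(2,3)] .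
  then show ?thesis using assms by (subst nline_eq_iff) (auto simp: cross_mult_left)
qed

lemma intersection_nline:
  assumes "n \<times> m \<noteq> 0"
  shows "intersection (nline n) (nline m) = pt (n \<times> m)"
proof -
  have nz: "n \<noteq> 0" "m \<noteq> 0" using assms by auto
  have "{x. n \<bullet> x = 0} \<inter> {x. m \<bullet> x = 0} = span {n \<times> m}"
  proof
    show "{x. n \<bullet> x = 0} \<inter> {x. m \<bullet> x = 0} \<subseteq> span {n \<times> m}"
    proof
      fix x assume "x \<in> {x. n \<bullet> x = 0} \<inter> {x. m \<bullet> x = 0}"
      then have "x \<bullet> n = 0" "x \<bullet> m = 0" by (auto simp: inner_commute)
      then obtain c where "x = c *\<^sub>R (n \<times> m)" by (rule orthogonal_to_two[OF assms])
      then show "x \<in> span {n \<times> m}" by (simp add: span_base span_scale)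
    qed
  qed (auto simp: span_singleton dot_cross_self)
  then show ?thesis unfolding intersection_def Rep_nline[OF nz(1)] Rep_nline[OF nz(2)] pt_def by simp
qed

lemma Un_span_span: "span (span A \<union> span B) = span (A \<union> B)"
proof
  show "span (span A \<union> span B) \<subseteq> span (A \<union> B)"
    by (meson Un_least span_minimal span_mono subspace_span sup_ge1 sup_ge2)
  show "span (A \<union> B) \<subseteq> span (span A \<union> span B)"
    by (meson Un_mono span_mono span_superset)
qed

lemma line_through_pt:
  assumes "x \<times> y \<noteq> 0"
  shows "line_through {pt x, pt y} = nline (x \<times> y)"
proof -
  have nz: "x \<noteq> 0" "y \<noteq> 0" using assms by auto
  have "span (\<Union>p\<in>{pt x, pt y}. Rep_rp2_point p) = span (span {x} \<union> span {y})"
    using nz by (simp add: Rep_pt)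
  also have "\<dots> = span {x, y}" unfolding Un_span_span by (simp add: insert_commute)
  finally show ?thesis
    unfolding line_through_def nline_def orthogonal_complement_two[OF assms] by simp
qed

lemma Meet_nline:
  assumes "n \<times> m \<noteq> 0"
  shows "Meet (Some (nline n)) (Some (nline m)) = Some (pt (n \<times> m))"
proof -
  have "n \<noteq> 0" "m \<noteq> 0" using assms by auto
  then show ?thesis using assms by (simp add: Meet_def nline_eq_iff intersection_nline)
qed

lemma Join_pt:
  assumes "x \<times> y \<noteq> 0"
  shows "Join (Some (pt x)) (Some (pt y)) = Some (nline (x \<times> y))"
proof -
  have "x \<noteq> 0" "y \<noteq> 0" using assms by auto
  then show ?thesis using assms by (simp add: Join_def pt_eq_iff line_through_pt)
qed

lemma Join_eqI:
  assumes "x \<times> y \<noteq> 0" "n \<noteq> 0" "n \<bullet> x = 0" "n \<bullet> y = 0"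
  shows "Join (Some (pt x)) (Some (pt y)) = Some (nline n)"
  using assms by (simp add: Join_pt nline_eqI)

text \<open>The only common point of the first two lines is \<open>a \<times> b\<close>, so
  concurrency is the vanishing of a determinant.\<close>

lemma three_line_relation_nline:
  assumes "a \<noteq> 0" "b \<noteq> 0" "c \<noteq> 0" "a \<times> b \<noteq> 0"
  shows "three_line_relation (Some (nline a)) (Some (nline b)) (Some (nline c)) \<longleftrightarrow> c \<bullet> (a \<times> b) = 0"
proof
  assume "three_line_relation (Some (nline a)) (Some (nline b)) (Some (nline c))"
  then obtain x where x: "lies_on x (nline a)" "lies_on x (nline b)" "lies_on x (nline c)"
    by (auto simp: three_line_relation_def)
  obtain v where v: "v \<noteq> 0" "x = pt v" by (rule pt_cases)
  then have "a \<bullet> v = 0" "b \<bullet> v = 0" "c \<bullet> v = 0" using x assms by (auto simp: lies_on_iff)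
  moreover from this have "v \<bullet> a = 0" "v \<bullet> b = 0" by (simp_all add: inner_commute)
  then obtain d where "v = d *\<^sub>R (a \<times> b)" by (rule orthogonal_to_two[OF assms(4)])
  ultimately show "c \<bullet> (a \<times> b) = 0" using v by auto
next
  assume "c \<bullet> (a \<times> b) = 0"
  then have "lies_on (pt (a \<times> b)) (nline a)" "lies_on (pt (a \<times> b)) (nline b)" "lies_on (pt (a \<times> b)) (nline c)"
    using assms by (auto simp: lies_on_iff dot_cross_self)
  then show "three_line_relation (Some (nline a)) (Some (nline b)) (Some (nline c))"
    by (auto simp: three_line_relation_def)
qed

text \<open>This rules out coinciding lines in a family whose set of intersection points is finite.
  The vectors \<open>v\<close> and \<open>w\<close> span the plane of the line, and the points
  \<open>v + t w\<close> are pairwise different.\<close>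

lemma infinite_points_on_line: "infinite {x. lies_on x m}"
proof -
  obtain n where n: "n \<noteq> 0" "m = nline n" by (rule nline_cases)
  obtain u where u: "n \<times> u \<noteq> 0" using n(1) cross_basis_nonzero by blast
  define v where "v = n \<times> u"
  define w where "w = n \<times> v"
  have vw: "n \<bullet> v = 0" "n \<bullet> w = 0" "v \<noteq> 0" using u by (auto simp: v_def w_def dot_cross_self)
  have "v \<times> w = (v \<bullet> v) *\<^sub>R n" using vw(1) by (simp add: w_def Lagrange inner_commute)
  then have c: "v \<times> w \<noteq> 0" using vw n by simp
  define f where "f t = pt (v + t *\<^sub>R w)" for t :: real
  have nz: "v + t *\<^sub>R w \<noteq> 0" for t
  proof
    assume "v + t *\<^sub>R w = 0"
    then have "(v + t *\<^sub>R w) \<times> w = 0" by simp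
    then show False using c by (simp add: cross_add_left cross_mult_left)
  qed
  have "inj f"
  proof (rule injI)
    fix s t assume "f s = f t"
    then have "(v + s *\<^sub>R w) \<times> (v + t *\<^sub>R w) = 0" using nz by (simp add: f_def pt_eq_iff)
    moreover have "w \<times> v = - (v \<times> w)" by (rule cross_skew)
    ultimately have "(t - s) *\<^sub>R (v \<times> w) = 0"
      by (simp add: cross_add_left cross_add_right cross_mult_left cross_mult_right algebra_simps)
    then show "s = t" using c by simp
  qed
  then have "infinite (range f)" using finite_imageD infinite_UNIV_char_0 by blast
  moreover have "range f \<subseteq> {x. lies_on x m}"
    using n vw nz by (auto simp: f_def lies_on_iff inner_add_right)
  ultimately show ?thesis using finite_subset by blast
qed

text \<open>The vector \<open>n\<close> represents the 2-form \<open>u, v \<mapsto> n \<bullet> (u \<times> v)\<close>; thus \<open>dp \<and> dq\<close> is represented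
  by \<open>p \<times> q\<close>, and a force by a normal vector of its line of force.\<close>

definition form :: "real^3 \<Rightarrow> form2" where
  "form n = (\<lambda>u v. n \<bullet> (u \<times> v))"

lemma wedge_eq_form: "wedge p q = form (p \<times> q)"
  by (simp add: wedge_def form_def dot_cross fun_eq_iff)

lemma form_add: "form (a + b) = form a + form b"
  by (simp add: form_def fun_eq_iff inner_add_left)

lemma form_0 [simp]: "form 0 = 0"
  by (simp add: form_def fun_eq_iff)

lemma form_minus: "form (- a) = - form a"
  by (simp add: form_def fun_eq_iff)

lemma form_sum: "form (sum g A) = (\<Sum>x\<in>A. form (g x))"
  by (induction A rule: infinite_finite_induct) (auto simp: form_add)

lemma form_eq_iff [simp]: "form a = form b \<longleftrightarrow> a = b"
proof
  assume "form a = form b"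
  then have e: "a \<bullet> (u \<times> v) = b \<bullet> (u \<times> v)" for u v by (auto simp: form_def fun_eq_iff)
  define d where "d = a - b"
  have d: "d \<bullet> (u \<times> v) = 0" for u v using e by (simp add: d_def inner_diff_left)
  \<comment> \<open>Evaluating the form at \<open>v\<close> and \<open>d \<times> v\<close> yields a
    squared norm.\<close>
  have "(d \<times> v) \<bullet> (d \<times> v) = 0" for v
    using d[of v "d \<times> v"] by (metis cross_triple inner_commute)
  then have "d \<times> v = 0" for v by simp
  then have "d = 0" using cross_basis_nonzero by blast
  then show "a = b" by (simp add: d_def)
qed simp

lemma form_eq_0_iff [simp]: "form a = 0 \<longleftrightarrow> a = 0"
  using form_eq_iff[of a 0] by (simp del: form_eq_iff)

lemma line_of_force_form: "line_of_force (form n) m \<longleftrightarrow> n \<noteq> 0 \<and> m = nline n"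
proof
  assume "line_of_force (form n) m"
  then obtain p q where pq: "p \<noteq> q" "independent {p, q}" "form n = wedge p q" "Rep_rp2_line m = span {p, q}"
    by (auto simp: line_of_force_def)
  then have c: "p \<times> q \<noteq> 0" using independent_two_iff_cross by blast
  have n: "n = p \<times> q" using pq by (simp add: wedge_eq_form)
  have "Rep_rp2_line m = {v. n \<bullet> v = 0}" using pq(4) orthogonal_complement_two[OF c] n by simp
  then have "m = nline n" by (metis Rep_rp2_line_inverse nline_def)
  then show "n \<noteq> 0 \<and> m = nline n" using n c by simp
next
  assume n: "n \<noteq> 0 \<and> m = nline n"
  obtain u where u: "n \<times> u \<noteq> 0" using n cross_basis_nonzero by blast
  define v where "v = n \<times> u"
  \<comment> \<open>The factor makes \<open>v \<times> w\<close> equal to \<open>n\<close> and not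
    merely proportional to it, since \<open>v \<times> (n \<times> v) = (v \<bullet> v) n\<close>
    for \<open>v\<close> orthogonal to \<open>n\<close>.\<close>
  define w where "w = (1 / (v \<bullet> v)) *\<^sub>R (n \<times> v)"
  have v: "v \<bullet> v \<noteq> 0" "n \<bullet> v = 0" using u by (auto simp: v_def dot_cross_self)
  then have vw: "v \<times> w = n" by (simp add: w_def Lagrange inner_commute cross_mult_right)
  then have "v \<noteq> w \<and> independent {v, w}" using n independent_two_iff_cross by blast
  moreover have "Rep_rp2_line m = span {v, w}" using n vw orthogonal_complement_two[of v w] by (simp add: Rep_nline)
  moreover have "form n = wedge v w" using vw by (simp add: wedge_eq_form)
  ultimately show "line_of_force (form n) m" unfolding line_of_force_def by blast
qed

lemma force_on_form: "force_on m (form n) \<longleftrightarrow> n = 0 \<or> m = nline n"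
  by (auto simp: force_on_def line_of_force_form)

lemma force_on_cases:
  assumes "force_on m F"
  obtains n where "F = form n"
  using assms unfolding force_on_def line_of_force_def by (metis form_0 wedge_eq_form)

section \<open>The surgery line\<close>

lemma cross_scaled_add_self: "(a *\<^sub>R u + b *\<^sub>R v) \<times> v = a *\<^sub>R (u \<times> v)" for u v :: "real^3"
  by (simp add: cross_add_left cross_mult_left)

lemma cross_eq_0_through_point:
  fixes n m p :: "real^3"
  assumes "n \<bullet> p = 0" "m \<bullet> p \<noteq> 0" "n \<noteq> 0"
  shows "n \<times> m \<noteq> 0"
proof
  assume "n \<times> m = 0"
  then obtain c where "m = c *\<^sub>R n" using assms(3) by (rule cross_eq_0_scaleR)
  then show False using assms by simp
qed

lemma parallel_if_orthogonal_to_two: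
  fixes n m x y :: "real^3"
  assumes "x \<times> y \<noteq> 0" "n \<bullet> x = 0" "n \<bullet> y = 0" "m \<bullet> x = 0" "m \<bullet> y = 0"
  shows "n \<times> m = 0"
proof -
  obtain c where "n = c *\<^sub>R (x \<times> y)" by (rule orthogonal_to_two[OF assms(1-3)])
  moreover obtain d where "m = d *\<^sub>R (x \<times> y)" by (rule orthogonal_to_two[OF assms(1,4,5)])
  ultimately show ?thesis by (simp add: cross_mult_left cross_mult_right)
qed

text \<open>The normals \<open>n + m l\<close> describe lines through the common point of
  \<open>n\<close> and \<open>l\<close>, that is, the parallels to \<open>n\<close> when
  \<open>l\<close> is the line at infinity. The join picks the one through \<open>y\<close>; as
  \<open>y\<close> is not at infinity, the join is defined.\<close>

lemma Join_at_infinity: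
  assumes "n \<times> l \<noteq> 0" "l \<bullet> y \<noteq> 0" "(n + m *\<^sub>R l) \<bullet> y = 0"
  shows "Join (Some (pt y)) (Meet (Some (nline n)) (Some (nline l))) = Some (nline (n + m *\<^sub>R l))"
proof -
  have "(y \<times> (n \<times> l)) \<times> l = (y \<bullet> l) *\<^sub>R (n \<times> l)"
    by (simp add: Lagrange Cross3.left_diff_distrib cross_mult_left)
  then have "(y \<times> (n \<times> l)) \<times> l \<noteq> 0" using assms by (simp add: inner_commute)
  then have "y \<times> (n \<times> l) \<noteq> 0" by auto
  moreover have "n + m *\<^sub>R l \<noteq> 0"
    using assms(1) cross_scaled_add_self[of 1 n m l] by auto
  ultimately have "Join (Some (pt y)) (Some (pt (n \<times> l))) = Some (nline (n + m *\<^sub>R l))"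
    using assms by (intro Join_eqI) (simp_all add: inner_add_left dot_cross_self)
  then show ?thesis using assms by (simp add: Meet_nline)
qed

text \<open>The auxiliary lines of the construction are parallel to their counterparts through \<open>p\<close> with respect to the
  line at infinity with normal \<open>l\<close>, hence have normals \<open>n12 + m l\<close>, \<open>n14 - m l\<close> and \<open>n26 + m l\<close>
  for one and the same scalar \<open>m\<close>. Adding the last two eliminates \<open>l\<close>.\<close>

lemma surgery_line_nline:
  assumes op: "operation_III c3" "operation_IV c4"
    and p: "p \<noteq> 0" "n12 \<bullet> p = 0" "n13 \<bullet> p = 0" "n14 \<bullet> p = 0" "n25 \<bullet> p = 0" "n26 \<bullet> p = 0"
    and eq: "n12 + n13 + n14 = 0" "n12 = n25 + n26"
    and nz: "n12 \<times> n13 \<noteq> 0" "n12 \<times> n25 \<noteq> 0" "n13 \<times> n25 \<noteq> 0"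
  shows "surgery_line c3 c4 (pt p) (Some (nline n12)) (Some (nline n13)) (Some (nline n14))
    (Some (nline n25)) (Some (nline n26)) = Some (nline (n14 + n26))"
proof -
  have n14: "n14 = - (n12 + n13)" by (rule minus_unique[OF eq(1), symmetric])
  have n26: "n26 = n12 - n25" using eq(2) by simp
  have "n12 \<times> n14 \<noteq> 0" using nz by (simp add: n14 cross_add_right Cross3.right_diff_distrib)
  moreover have "n12 \<times> n26 \<noteq> 0" using nz by (simp add: n26 Cross3.right_diff_distrib)
  ultimately have nn: "n12 \<noteq> 0" "n13 \<noteq> 0" "n14 \<noteq> 0" "n25 \<noteq> 0" "n26 \<noteq> 0" using nz by auto
  define p_inf where "p_inf = c3 (nline n12) {pt p}"
  have pi: "lies_on p_inf (nline n12)" "p_inf \<noteq> pt p" 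
    using op(1)[unfolded operation_III_def, rule_format, of "{pt p}" "nline n12"] by (auto simp: p_inf_def)
  obtain x where x: "x \<noteq> 0" "p_inf = pt x" by (rule pt_cases)
  have x1: "n12 \<bullet> x = 0" "p \<times> x \<noteq> 0"
    using pi x p nn by (auto simp: lies_on_iff pt_eq_iff cross_swap_eq_0[of x])
  define l_inf where "l_inf = c4 p_inf {nline n12}"
  have li: "lies_on p_inf l_inf" "l_inf \<noteq> nline n12" 
    using op(2)[unfolded operation_IV_def, rule_format, of "{nline n12}" p_inf] by (auto simp: l_inf_def)
  obtain l where l: "l \<noteq> 0" "l_inf = nline l" by (rule nline_cases)
  have l1: "l \<bullet> x = 0" "l \<times> n12 \<noteq> 0" using li l x nn by (auto simp: lies_on_iff nline_eq_iff)
  \<comment> \<open>Otherwise \<open>l_inf\<close> and the line \<open>n12\<close> would share the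
    distinct points \<open>p\<close> and \<open>p_inf\<close> and coincide.\<close>
  have lp: "l \<bullet> p \<noteq> 0"
    using parallel_if_orthogonal_to_two[OF x1(2), of l n12] l1 x1 p by auto
  have nl: "n12 \<times> l \<noteq> 0" "n13 \<times> l \<noteq> 0" "n14 \<times> l \<noteq> 0" "n26 \<times> l \<noteq> 0"
    using cross_eq_0_through_point[OF _ lp] p nn by auto
  define X where "X = {pt p} \<union> {x. lies_on x (nline n13) \<and> lies_on x l_inf}"
  \<comment> \<open>Operation III is constrained for finite sets only, so the excluded set has to be
    shown finite; it has at most two points.\<close>
  have "x = pt (n13 \<times> l)" if "lies_on x (nline n13)" "lies_on x (nline l)" for x
  proof -
    obtain v where v: "v \<noteq> 0" "x = pt v" by (rule pt_cases)
    then show ?thesis using that nn l nl by (auto simp: lies_on_iff intro: pt_eqI)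
  qed
  then have "X \<subseteq> {pt p, pt (n13 \<times> l)}" unfolding X_def l by blast
  then have "finite X" by (rule finite_subset) simp
  define p1 where "p1 = c3 (nline n13) X"
  have p1: "lies_on p1 (nline n13)" "p1 \<notin> X" 
    using op(1)[unfolded operation_III_def, rule_format, of X "nline n13"] \<open>finite X\<close> by (auto simp: p1_def)
  obtain y where y: "y \<noteq> 0" "p1 = pt y" by (rule pt_cases)
  have y1: "n13 \<bullet> y = 0" "p \<times> y \<noteq> 0" "l \<bullet> y \<noteq> 0"
    using p1 y p nn l by (auto simp: X_def lies_on_iff pt_eq_iff cross_swap_eq_0[of y])
  \<comment> \<open>\<open>m\<close> is determined by the requirement that \<open>n12 + m l\<close>
    pass through \<open>y\<close>. As \<open>n13 \<bullet> y = 0\<close> and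
    \<open>n12 + n13 + n14 = 0\<close>, the line \<open>n14 - m l\<close> then passes through
    \<open>y\<close> too.\<close>
  define m where "m = - (n12 \<bullet> y) / (l \<bullet> y)"
  have my: "m * (l \<bullet> y) = - (n12 \<bullet> y)" using y1 by (simp add: m_def)
  have m: "m \<noteq> 0"
  proof
    assume "m = 0"
    then have "n12 \<bullet> y = 0" using my by simp
    then have "n12 \<times> n13 = 0" using parallel_if_orthogonal_to_two[OF y1(2)] p y1 by blast
    then show False using nz by simp
  qed
  define h where "h = n12 + m *\<^sub>R l"
  have J1: "Join (Some p1) (Meet (Some (nline n12)) (Some l_inf)) = Some (nline h)"
    unfolding h_def y l by (rule Join_at_infinity) (use nl y1 my in \<open>auto simp: inner_add_left\<close>)
  have hp: "h \<bullet> p \<noteq> 0" using m lp p by (simp add: h_def inner_add_left)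
  have hn: "h \<times> n25 \<noteq> 0"
    using cross_eq_0_through_point[OF _ hp, of n25] p nn by (simp add: cross_swap_eq_0[of h])
  define z where "z = h \<times> n25"
  have M1: "Meet (Some (nline h)) (Some (nline n25)) = Some (pt z)" using hn by (simp add: Meet_nline z_def)
  have z: "h \<bullet> z = 0" "n25 \<bullet> z = 0" "z \<noteq> 0" using hn by (auto simp: z_def dot_cross_self)
  \<comment> \<open>If \<open>z\<close> were at infinity, it would lie on \<open>n12\<close> as well
    as on \<open>n25\<close>, hence coincide with \<open>p\<close>, which is not at
    infinity.\<close>
  have lz: "l \<bullet> z \<noteq> 0"
  proof
    assume lz: "l \<bullet> z = 0"
    then have "n12 \<bullet> z = 0" using z by (simp add: h_def inner_add_left)
    then have "z \<times> p = 0"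
      using parallel_if_orthogonal_to_two[OF nz(2), of z p] z p by (simp add: inner_commute)
    then obtain c where "p = c *\<^sub>R z" using z(3) by (rule cross_eq_0_scaleR)
    then show False using lz lp by simp
  qed
  define u1 where "u1 = n14 + (- m) *\<^sub>R l"
  define u2 where "u2 = n26 + m *\<^sub>R l"
  have J2: "Join (Some p1) (Meet (Some (nline n14)) (Some l_inf)) = Some (nline u1)"
    unfolding u1_def y l
    by (rule Join_at_infinity) (use nl y1 my in \<open>auto simp: inner_add_left inner_diff_left n14\<close>)
  have "(n26 + m *\<^sub>R l) \<bullet> z = h \<bullet> z - n25 \<bullet> z"
    by (simp add: n26 h_def inner_add_left inner_diff_left)
  then have J3: "Join (Some (pt z)) (Meet (Some (nline n26)) (Some l_inf)) = Some (nline u2)"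
    unfolding u2_def l by (intro Join_at_infinity) (use nl lz z in auto)
  have sum: "u1 + u2 = n14 + n26" by (simp add: u1_def u2_def)
  have up: "u1 \<bullet> p = - (m * (l \<bullet> p))" "u2 \<bullet> p = m * (l \<bullet> p)"
    using p by (simp_all add: u1_def u2_def inner_add_left inner_diff_left)
  define w where "w = u1 \<times> u2"
  \<comment> \<open>By Lagrange this is \<open>(p \<bullet> u2) u1 - (p \<bullet> u1) u2\<close>.
    The two inner products are opposite, so a multiple of \<open>u1 + u2\<close> results.\<close>
  have pw: "p \<times> w = (m * (l \<bullet> p)) *\<^sub>R (n14 + n26)"
    by (simp add: w_def Lagrange inner_commute[of p] up sum[symmetric] algebra_simps)
  have "(n14 + n26) \<times> n25 = - (n13 \<times> n25)"
    by (simp add: n14 n26 cross_add_left Cross3.left_diff_distrib)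
  then have "(n14 + n26) \<times> n25 \<noteq> 0" using nz by simp
  then have "n14 + n26 \<noteq> 0" by auto
  then have pw0: "p \<times> w \<noteq> 0" using m lp pw by auto
  then have "w \<noteq> 0" by auto
  then have M2: "Meet (Some (nline u1)) (Some (nline u2)) = Some (pt w)" by (simp add: Meet_nline w_def)
  have J4: "Join (Some (pt p)) (Some (pt w)) = Some (nline (n14 + n26))"
    using pw0 m lp by (simp add: Join_pt pw nline_scaleR)
  show ?thesis
    unfolding surgery_line_def option.case prod.case Let_def
    unfolding p_inf_def[symmetric] l_inf_def[symmetric] X_def[symmetric] p1_def[symmetric]
    unfolding J1 M1 J2 J3 M2 J4 by (rule refl)
qed

section \<open>Splits of the leaves of a tree\<close>

text \<open>\<open>A u v\<close> is the set of leaves on the side of \<open>v\<close> of the edge \<open>{u, v}\<close>.\<close>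

definition split_system :: "'t set set \<Rightarrow> 't set \<Rightarrow> ('t \<Rightarrow> 't \<Rightarrow> 't set) \<Rightarrow> bool" where
  "split_system S N A \<longleftrightarrow> finite N \<and>
    (\<forall>u v. {u, v} \<in> S \<longrightarrow> A u v \<noteq> {} \<and> A u v \<subseteq> N \<and> A v u = N - A u v) \<and>
    (\<forall>v\<in>N. \<exists>u. nbrs S v = {u} \<and> A u v = {v}) \<and>
    (\<forall>v. v \<notin> N \<longrightarrow> nbrs S v \<noteq> {} \<longrightarrow>
      card (nbrs S v) = 3 \<and> (\<Union>a\<in>nbrs S v. A v a) = N \<and>
      (\<forall>a\<in>nbrs S v. \<forall>b\<in>nbrs S v. a \<noteq> b \<longrightarrow> A v a \<inter> A v b = {}))"

lemma nbrs_sym: "w \<in> nbrs S v \<longleftrightarrow> v \<in> nbrs S w"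
  by (simp add: nbrs_def insert_commute)

lemma split_systemD:
  assumes "split_system S N A"
  shows "finite N"
    and "\<And>u v. {u, v} \<in> S \<Longrightarrow> A u v \<noteq> {}"
    and "\<And>u v. {u, v} \<in> S \<Longrightarrow> A u v \<subseteq> N"
    and "\<And>u v. {u, v} \<in> S \<Longrightarrow> A v u = N - A u v"
    and "\<And>v. v \<in> N \<Longrightarrow> \<exists>u. nbrs S v = {u} \<and> A u v = {v}"
    and "\<And>v w. v \<notin> N \<Longrightarrow> {v, w} \<in> S \<Longrightarrow> card (nbrs S v) = 3"
    and "\<And>v w. v \<notin> N \<Longrightarrow> {v, w} \<in> S \<Longrightarrow> (\<Union>a\<in>nbrs S v. A v a) = N"
    and "\<And>v a b. v \<notin> N \<Longrightarrow> {v, a} \<in> S \<Longrightarrow> {v, b} \<in> S \<Longrightarrow> a \<noteq> b \<Longrightarrow> A v a \<inter> A v b = {}"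
proof -
  note D = assms[unfolded split_system_def]
  note D1 = D[THEN conjunct1] and D2 = D[THEN conjunct2, THEN conjunct1, rule_format]
    and D3 = D[THEN conjunct2, THEN conjunct2, THEN conjunct1, rule_format]
    and D4 = D[THEN conjunct2, THEN conjunct2, THEN conjunct2, rule_format]
  show "finite N" by (rule D1)
  show "A u v \<noteq> {}" "A u v \<subseteq> N" "A v u = N - A u v" if "{u, v} \<in> S" for u v
    using D2[OF that] by auto
  show "\<exists>u. nbrs S v = {u} \<and> A u v = {v}" if "v \<in> N" for v using D3[OF that] .
  fix v w assume v: "v \<notin> N" "{v, w} \<in> S"
  have "w \<in> nbrs S v" using v by (simp add: nbrs_def)
  then have "nbrs S v \<noteq> {}" by blast
  then have D': "card (nbrs S v) = 3 \<and> (\<Union>a\<in>nbrs S v. A v a) = N \<and>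
      (\<forall>a\<in>nbrs S v. \<forall>b\<in>nbrs S v. a \<noteq> b \<longrightarrow> A v a \<inter> A v b = {})" using D4[OF v(1)] by simp
  then show "card (nbrs S v) = 3" "(\<Union>a\<in>nbrs S v. A v a) = N" by auto
  show "A v w \<inter> A v b = {}" if "{v, b} \<in> S" "w \<noteq> b" for b
    using D' v that by (simp add: nbrs_def)
qed

lemma split_systemI:
  assumes "finite N"
    and "\<And>u v. {u, v} \<in> S \<Longrightarrow> A u v \<noteq> {} \<and> A u v \<subseteq> N \<and> A v u = N - A u v"
    and "\<And>v. v \<in> N \<Longrightarrow> \<exists>u. nbrs S v = {u} \<and> A u v = {v}"
    and "\<And>v. v \<notin> N \<Longrightarrow> nbrs S v \<noteq> {} \<Longrightarrow> card (nbrs S v) = 3 \<and> (\<Union>a\<in>nbrs S v. A v a) = N \<and>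
      (\<forall>a\<in>nbrs S v. \<forall>b\<in>nbrs S v. a \<noteq> b \<longrightarrow> A v a \<inter> A v b = {})"
  shows "split_system S N A"
  unfolding split_system_def using assms by auto

lemma split_system_three:
  assumes "split_system S N A" "nbrs S v = {a, b, c}" "distinct [a, b, c]"
  shows "v \<notin> N" "A v a \<union> A v b \<union> A v c = N"
    "A v a \<inter> A v b = {}" "A v a \<inter> A v c = {}" "A v b \<inter> A v c = {}"
proof -
  have e: "{v, a} \<in> S" "{v, b} \<in> S" "{v, c} \<in> S" using assms(2) unfolding nbrs_def by blast+
  show v: "v \<notin> N"
  proof
    assume "v \<in> N"
    then obtain u where "nbrs S v = {u}" using split_systemD(5)[OF assms(1)] by blast
    then show False using assms by auto
  qed
  show "A v a \<union> A v b \<union> A v c = N" using split_systemD(7)[OF assms(1) v e(1)] assms(2) by auto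
  show "A v a \<inter> A v b = {}" "A v a \<inter> A v c = {}" "A v b \<inter> A v c = {}"
    using split_systemD(8)[OF assms(1) v] e assms(3) by auto
qed

lemma split_system_third:
  assumes "split_system S N A" "v \<notin> N" "{v, a} \<in> S" "{v, b} \<in> S" "a \<noteq> b"
  obtains c where "nbrs S v = {a, b, c}" "distinct [a, b, c]"
proof -
  have "card (nbrs S v) = 3" using split_systemD(6)[OF assms(1-3)] .
  then obtain x y z where xyz: "nbrs S v = {x, y, z}" "x \<noteq> y" "y \<noteq> z" "x \<noteq> z" by (auto simp: card_3_iff)
  moreover have "a \<in> nbrs S v" "b \<in> nbrs S v" using assms by (auto simp: nbrs_def)
  ultimately have ab: "a \<in> {x, y, z}" "b \<in> {x, y, z}" by auto
  have "\<exists>c. {x, y, z} = {a, b, c} \<and> distinct [a, b, c]"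
    using ab assms(5) xyz(2-4) by auto
  then show thesis using that xyz by auto
qed

text \<open>The subtrees beyond \<open>v3\<close>, \<open>v4\<close>, \<open>v5\<close>,
  \<open>v6\<close> keep their leaves, and only the grouping at the central edge changes: 3 is now
  paired with 5 and 4 with 6. Since \<open>v1\<close> and \<open>v2\<close> are reused as names, the
  splits of the new edges \<open>v1v5\<close> and \<open>v2v4\<close> are those of the old edges
  \<open>v2v5\<close> and \<open>v1v4\<close>.\<close>

definition surgery_splits :: "'t \<Rightarrow> 't \<Rightarrow> 't \<Rightarrow> 't \<Rightarrow> 't \<Rightarrow> 't \<Rightarrow> ('t \<Rightarrow> 't \<Rightarrow> 't set) \<Rightarrow> 't \<Rightarrow> 't \<Rightarrow> 't set" where
  "surgery_splits v1 v2 v3 v4 v5 v6 A = (\<lambda>u v.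
     if (u, v) = (v1, v2) then A v1 v4 \<union> A v2 v6
     else if (u, v) = (v2, v1) then A v1 v3 \<union> A v2 v5
     else if (u, v) = (v1, v5) then A v2 v5
     else if (u, v) = (v5, v1) then A v5 v2
     else if (u, v) = (v2, v4) then A v1 v4
     else if (u, v) = (v4, v2) then A v4 v1
     else A u v)"

text \<open>Used at \<open>v4\<close> and \<open>v5\<close>, where the surgery only renames one
  neighbour: the partition of the leaves is carried along the renaming.\<close>

lemma partition_relabel:
  assumes "inj_on f X" "\<And>a. a \<in> X \<Longrightarrow> B (f a) = A a" "card X = k" "(\<Union>a\<in>X. A a) = N"
    and "\<And>a b. a \<in> X \<Longrightarrow> b \<in> X \<Longrightarrow> a \<noteq> b \<Longrightarrow> A a \<inter> A b = {}"
  shows "card (f ` X) = k \<and> (\<Union>a\<in>f ` X. B a) = N \<and>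
    (\<forall>a\<in>f ` X. \<forall>b\<in>f ` X. a \<noteq> b \<longrightarrow> B a \<inter> B b = {})"
proof (intro conjI ballI impI)
  show "card (f ` X) = k" using assms by (simp add: card_image)
  show "(\<Union>a\<in>f ` X. B a) = N" using assms(2,4) by auto
  fix a b assume "a \<in> f ` X" "b \<in> f ` X" "a \<noteq> b"
  then obtain x y where "x \<in> X" "a = f x" "y \<in> X" "b = f y" "x \<noteq> y" by blast
  then show "B a \<inter> B b = {}" using assms(2,5) by simp
qed

text \<open>The old tree partitions the leaves into the four sets beyond \<open>v3\<close>,
  \<open>v4\<close>, \<open>v5\<close>, \<open>v6\<close>. The partitions at the two new vertices
  regroup these four sets; at \<open>v4\<close> and \<open>v5\<close> a neighbour is renamed, and no
  other vertex is affected.\<close>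

lemma split_system_surgery:
  assumes S: "split_system S N A" and app: "surgery_applicable S (HPhi v1 v2 v3 v4 v5 v6 c3 c4)"
  shows "split_system (surgery_tree (HPhi v1 v2 v3 v4 v5 v6 c3 c4) S) N (surgery_splits v1 v2 v3 v4 v5 v6 A)"
    (is "split_system ?S N ?A")
proof -
  have d: "distinct [v1, v2, v3, v4, v5, v6]" and n1: "nbrs S v1 = {v2, v3, v4}" and n2: "nbrs S v2 = {v1, v5, v6}"
    using app by auto
  have d': "v1 \<noteq> v2" "v1 \<noteq> v3" "v1 \<noteq> v4" "v1 \<noteq> v5" "v1 \<noteq> v6" "v2 \<noteq> v3" "v2 \<noteq> v4" "v2 \<noteq> v5" "v2 \<noteq> v6"
    "v3 \<noteq> v4" "v3 \<noteq> v5" "v3 \<noteq> v6" "v4 \<noteq> v5" "v4 \<noteq> v6" "v5 \<noteq> v6" using d by auto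
  note d'' = d' d'[symmetric]
  have e: "{v1, v2} \<in> S" "{v1, v3} \<in> S" "{v1, v4} \<in> S" "{v2, v5} \<in> S" "{v2, v6} \<in> S"
    using n1 n2 unfolding nbrs_def by blast+
  have p1: "v1 \<notin> N" "A v1 v2 \<union> A v1 v3 \<union> A v1 v4 = N"
    "A v1 v2 \<inter> A v1 v3 = {}" "A v1 v2 \<inter> A v1 v4 = {}" "A v1 v3 \<inter> A v1 v4 = {}"
    using split_system_three[OF S n1] d by auto
  have p2: "v2 \<notin> N" "A v2 v1 \<union> A v2 v5 \<union> A v2 v6 = N"
    "A v2 v1 \<inter> A v2 v5 = {}" "A v2 v1 \<inter> A v2 v6 = {}" "A v2 v5 \<inter> A v2 v6 = {}"
    using split_system_three[OF S n2] d by auto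
  have c: "A v2 v1 = N - A v1 v2" using split_systemD(4)[OF S e(1)] .
  have sub: "A v1 v2 \<subseteq> N" using split_systemD(3)[OF S e(1)] .
  have s12: "A v1 v2 = A v2 v5 \<union> A v2 v6" using p2(2-4) unfolding c using sub by blast
  have s21: "A v2 v1 = A v1 v3 \<union> A v1 v4" using p1(2-4) unfolding c by blast
  have part: "A v1 v3 \<union> A v1 v4 \<union> A v2 v5 \<union> A v2 v6 = N" using p1(2) unfolding s12 by blast
  have disj: "A v1 v3 \<inter> A v1 v4 = {}" "A v2 v5 \<inter> A v2 v6 = {}" using p1(5) p2(5) by auto
  have disj': "A v1 v3 \<inter> A v2 v5 = {}" "A v1 v3 \<inter> A v2 v6 = {}" "A v1 v4 \<inter> A v2 v5 = {}" "A v1 v4 \<inter> A v2 v6 = {}"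
    using p1(3,4) unfolding s12 by blast+
  have nb1: "nbrs ?S v1 = {v2, v3, v5}"
    using n1 d'' by (auto simp: nbrs_def doubleton_eq_iff)
  have nb2: "nbrs ?S v2 = {v1, v4, v6}"
    using n2 d'' by (auto simp: nbrs_def doubleton_eq_iff)
  have nb4: "nbrs ?S v4 = (\<lambda>w. if w = v1 then v2 else w) ` nbrs S v4"
    using e d'' by (auto simp: nbrs_def doubleton_eq_iff image_iff insert_commute)
  have nb5: "nbrs ?S v5 = (\<lambda>w. if w = v2 then v1 else w) ` nbrs S v5"
    using e d'' by (auto simp: nbrs_def doubleton_eq_iff image_iff insert_commute)
  have nb: "nbrs ?S v = nbrs S v" if "v \<notin> {v1, v2, v4, v5}" for v
    using that by (auto simp: nbrs_def doubleton_eq_iff)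
  \<comment> \<open>Makes the renaming of neighbours injective, so that no two of them are
    merged.\<close>
  have v2_4: "v2 \<notin> nbrs S v4" "v1 \<notin> nbrs S v5"
    using n1 n2 d'' by (auto simp: nbrs_sym[of v2 S v4] nbrs_sym[of v1 S v5])
  have A4: "?A v4 (if w = v1 then v2 else w) = A v4 w" "?A (if w = v1 then v2 else w) v4 = A w v4"
    if "w \<in> nbrs S v4" for w
    using that v2_4 d'' by (auto simp: surgery_splits_def)
  have A5: "?A v5 (if w = v2 then v1 else w) = A v5 w" "?A (if w = v2 then v1 else w) v5 = A w v5"
    if "w \<in> nbrs S v5" for w
    using that v2_4 d'' by (auto simp: surgery_splits_def)
  have A: "?A v w = A v w" "?A w v = A w v" if "v \<notin> {v1, v2, v4, v5}" for v w
    using that by (auto simp: surgery_splits_def)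
  have A1: "?A v1 v2 = A v1 v4 \<union> A v2 v6" "?A v2 v1 = A v1 v3 \<union> A v2 v5"
    "?A v1 v3 = A v1 v3" "?A v1 v5 = A v2 v5" "?A v2 v4 = A v1 v4" "?A v2 v6 = A v2 v6"
    using d'' by (auto simp: surgery_splits_def)
  show ?thesis
  proof (rule split_systemI)
    show "finite N" using split_systemD(1)[OF S] .
  next
    fix u v assume "{u, v} \<in> ?S"
    then have "{u, v} = {v2, v4} \<or> {u, v} = {v1, v5} \<or>
        {u, v} \<in> S \<and> {u, v} \<noteq> {v1, v4} \<and> {u, v} \<noteq> {v2, v5}" by simp
    then have cs: "{u, v} = {v1, v2} \<or> {u, v} = {v2, v4} \<or> {u, v} = {v1, v5} \<or> {u, v} \<in> S \<and> {u, v} \<noteq> {v1, v2} \<and>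
        {u, v} \<noteq> {v1, v4} \<and> {u, v} \<noteq> {v2, v5} \<and> {u, v} \<noteq> {v2, v4} \<and> {u, v} \<noteq> {v1, v5}" by argo
    define Q where "Q u v \<longleftrightarrow> ?A u v \<noteq> {} \<and> ?A u v \<subseteq> N \<and> ?A v u = N - ?A u v" for u v
    have pair: "Q u v" if "{u, v} = {x, y}" "Q x y" "Q y x" for x y
      using that by (metis doubleton_eq_iff)
    from cs consider "{u, v} = {v1, v2}" | "{u, v} = {v2, v4}" | "{u, v} = {v1, v5}"
      | "{u, v} \<in> S" "{u, v} \<noteq> {v1, v2}" "{u, v} \<noteq> {v1, v4}" "{u, v} \<noteq> {v2, v5}"
        "{u, v} \<noteq> {v2, v4}" "{u, v} \<noteq> {v1, v5}" by argo
    then have "Q u v"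
    proof cases
      case 1
      have ne: "A v1 v4 \<noteq> {}" "A v1 v3 \<noteq> {}" using split_systemD(2)[OF S] e by auto
      have "Q v1 v2" "Q v2 v1"
        unfolding Q_def A1 part[symmetric] by (intro conjI; use ne disj disj' in blast)+
      then show ?thesis by (rule pair[OF 1])
    next
      case 2
      have "A v1 v4 \<noteq> {}" "A v1 v4 \<subseteq> N" "A v4 v1 = N - A v1 v4" "A v4 v1 \<noteq> {}"
        using split_systemD(2-4)[OF S e(3)] split_systemD(2)[OF S, of v4 v1] e(3)
        by (simp_all add: insert_commute[of v4])
      moreover have "?A v2 v4 = A v1 v4" "?A v4 v2 = A v4 v1" using d'' by (simp_all add: surgery_splits_def)
      ultimately have "Q v2 v4" "Q v4 v2" unfolding Q_def by blast+
      then show ?thesis by (rule pair[OF 2])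
    next
      case 3
      have "A v2 v5 \<noteq> {}" "A v2 v5 \<subseteq> N" "A v5 v2 = N - A v2 v5" "A v5 v2 \<noteq> {}"
        using split_systemD(2-4)[OF S e(4)] split_systemD(2)[OF S, of v5 v2] e(4)
        by (simp_all add: insert_commute[of v5])
      moreover have "?A v1 v5 = A v2 v5" "?A v5 v1 = A v5 v2" using d'' by (simp_all add: surgery_splits_def)
      ultimately have "Q v1 v5" "Q v5 v1" unfolding Q_def by blast+
      then show ?thesis by (rule pair[OF 3])
    next
      case 4
      have neq: "(u, v) \<noteq> (x, y) \<and> (u, v) \<noteq> (y, x) \<and> (v, u) \<noteq> (x, y) \<and> (v, u) \<noteq> (y, x)"
        if "{u, v} \<noteq> {x, y}" for x y using that by (auto simp: insert_commute)
      have "?A u v = A u v" "?A v u = A v u"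
        using neq[OF 4(2)] neq[OF 4(5)] neq[OF 4(6)] unfolding surgery_splits_def
        by (simp_all only: if_False simp_thms)
      then show ?thesis unfolding Q_def using split_systemD(2,3,4)[OF S 4(1)] by simp
    qed
    then show "?A u v \<noteq> {} \<and> ?A u v \<subseteq> N \<and> ?A v u = N - ?A u v" unfolding Q_def .
  next
    fix v assume v: "v \<in> N"
    then obtain u where u: "nbrs S v = {u}" "A u v = {v}" using split_systemD(5)[OF S] by blast
    consider "v = v4" | "v = v5" | "v \<notin> {v1, v2, v4, v5}" using v p1 p2 by auto
    then show "\<exists>u. nbrs ?S v = {u} \<and> ?A u v = {v}"
    proof cases
      case 1
      then show ?thesis using A4(2)[of u] u unfolding 1 nb4 by (intro exI[of _ "if u = v1 then v2 else u"]) (simp del: surgery_tree.simps)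
    next
      case 2
      then show ?thesis using A5(2)[of u] u unfolding 2 nb5 by (intro exI[of _ "if u = v2 then v1 else u"]) (simp del: surgery_tree.simps)
    next
      case 3
      then show ?thesis using nb A u by auto
    qed
  next
    fix v assume v: "v \<notin> N" "nbrs ?S v \<noteq> {}"
    consider "v = v1" | "v = v2" | "v = v4" | "v = v5" | "v \<notin> {v1, v2, v4, v5}" by auto
    then show "card (nbrs ?S v) = 3 \<and> (\<Union>a\<in>nbrs ?S v. ?A v a) = N \<and>
      (\<forall>a\<in>nbrs ?S v. \<forall>b\<in>nbrs ?S v. a \<noteq> b \<longrightarrow> ?A v a \<inter> ?A v b = {})"
    proof cases
      case 1
      have "A v1 v4 \<union> A v2 v6 \<union> (A v1 v3 \<union> A v2 v5) = N"
        "(A v1 v4 \<union> A v2 v6) \<inter> A v1 v3 = {}" "(A v1 v4 \<union> A v2 v6) \<inter> A v2 v5 = {}"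
        "A v1 v3 \<inter> A v2 v5 = {}"
        unfolding part[symmetric] using disj disj' by blast+
      then show ?thesis unfolding 1 nb1 using d'' by (simp add: A1 Int_commute)
    next
      case 2
      have "A v1 v3 \<union> A v2 v5 \<union> (A v1 v4 \<union> A v2 v6) = N"
        "(A v1 v3 \<union> A v2 v5) \<inter> A v1 v4 = {}" "(A v1 v3 \<union> A v2 v5) \<inter> A v2 v6 = {}"
        "A v1 v4 \<inter> A v2 v6 = {}"
        unfolding part[symmetric] using disj disj' by blast+
      then show ?thesis unfolding 2 nb2 using d'' by (simp add: A1 Int_commute)
    next
      case 3
      have ne: "{v4, v1} \<in> S" using e by (simp add: insert_commute)
      have inj: "inj_on (\<lambda>w. if w = v1 then v2 else w) (nbrs S v4)" using v2_4 by (auto simp: inj_on_def)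
      have "card (nbrs S v4) = 3" "(\<Union>a\<in>nbrs S v4. A v4 a) = N"
        using split_systemD(6,7)[OF S _ ne] v 3 by auto
      moreover have "A v4 a \<inter> A v4 b = {}" if "a \<in> nbrs S v4" "b \<in> nbrs S v4" "a \<noteq> b" for a b
        using split_systemD(8)[OF S] v 3 that by (auto simp: nbrs_def)
      ultimately show ?thesis unfolding 3 nb4 by (intro partition_relabel[OF inj, of _ "A v4"] A4(1))
    next
      case 4
      have ne: "{v5, v2} \<in> S" using e by (simp add: insert_commute)
      have inj: "inj_on (\<lambda>w. if w = v2 then v1 else w) (nbrs S v5)" using v2_4 by (auto simp: inj_on_def)
      have "card (nbrs S v5) = 3" "(\<Union>a\<in>nbrs S v5. A v5 a) = N"
        using split_systemD(6,7)[OF S _ ne] v 4 by auto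
      moreover have "A v5 a \<inter> A v5 b = {}" if "a \<in> nbrs S v5" "b \<in> nbrs S v5" "a \<noteq> b" for a b
        using split_systemD(8)[OF S] v 4 that by (auto simp: nbrs_def)
      ultimately show ?thesis unfolding 4 nb5 by (intro partition_relabel[OF inj, of _ "A v5"] A5(1))
    next
      case 5
      then obtain w where ne: "{v, w} \<in> S" using v nb by (auto simp: nbrs_def)
      have "A v a \<inter> A v b = {}" if "a \<in> nbrs S v" "b \<in> nbrs S v" "a \<noteq> b" for a b
        using split_systemD(8)[OF S v(1)] that by (simp add: nbrs_def)
      then show ?thesis unfolding nb[OF 5] A(1)[OF 5]
        using split_systemD(6,7)[OF S v(1) ne] by (intro conjI ballI impI)
    qed
  qed
qed

section \<open>Forces on a resolution scheme\<close>

text \<open>Conditions (1) and (2) without a distinguished index. The form in (2) with disjoint sets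
  fits trees: the three leaf sets at an interior vertex are disjoint and no two of them exhaust
  \<open>N\<close>, so the three lines there are pairwise different.\<close>

definition generic_normals :: "'a set \<Rightarrow> ('a \<Rightarrow> real^3) \<Rightarrow> bool" where
  "generic_normals N g \<longleftrightarrow> sum g N = 0 \<and>
    (\<forall>A. A \<subseteq> N \<longrightarrow> A \<noteq> {} \<longrightarrow> A \<noteq> N \<longrightarrow> sum g A \<noteq> 0) \<and>
    (\<forall>A B. A \<subseteq> N \<longrightarrow> B \<subseteq> N \<longrightarrow> A \<noteq> {} \<longrightarrow> B \<noteq> {} \<longrightarrow> A \<inter> B = {} \<longrightarrow> A \<union> B \<noteq> N \<longrightarrow>
      sum g A \<times> sum g B \<noteq> 0)"

lemma generic_normalsD:
  assumes "generic_normals N g"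
  shows "sum g N = 0"
    and "\<And>A. A \<subseteq> N \<Longrightarrow> A \<noteq> {} \<Longrightarrow> A \<noteq> N \<Longrightarrow> sum g A \<noteq> 0"
    and "\<And>A B. A \<subseteq> N \<Longrightarrow> B \<subseteq> N \<Longrightarrow> A \<noteq> {} \<Longrightarrow> B \<noteq> {} \<Longrightarrow> A \<inter> B = {} \<Longrightarrow> A \<union> B \<noteq> N \<Longrightarrow>
      sum g A \<times> sum g B \<noteq> 0"
  using assms unfolding generic_normals_def by simp_all

lemma generic_normals_complement:
  assumes "generic_normals N g" "finite N" "A \<subseteq> N"
  shows "sum g (N - A) = - sum g A"
  using generic_normalsD(1)[OF assms(1)] sum_diff[OF assms(2,3), of g] by simp

lemma generic_normals_cross:
  assumes "generic_normals N g" "a \<in> N" "b \<in> N" "a \<noteq> b" "3 \<le> card N"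
  shows "g a \<times> g b \<noteq> 0"
proof -
  have "card {a, b} \<noteq> card N" using assms by simp
  then have "{a} \<union> {b} \<noteq> N" by (metis insert_is_Un)
  then have "sum g {a} \<times> sum g {b} \<noteq> 0" using assms by (intro generic_normalsD(3)[OF assms(1)]) auto
  then show ?thesis by simp
qed

text \<open>Condition (2) compares index sets that share a member \<open>x\<close>. For disjoint
  \<open>A\<close> and \<open>B\<close> take \<open>x\<close> in \<open>A\<close> and compare
  \<open>A\<close> with \<open>N - B\<close>, whose sum is minus that of \<open>B\<close>; these
  sets differ because \<open>A\<close> and \<open>B\<close> do not exhaust \<open>N\<close>.\<close>

lemma generic_normals_if_nonparallel:
  assumes "nonparallel_forces N (\<lambda>w. form (g w))" "sum g N = 0" "finite N"
  shows "generic_normals N g"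
  unfolding generic_normals_def
proof (intro conjI allI impI)
  show "sum g N = 0" by fact
  have 1: "sum g A \<noteq> 0" if "A \<subseteq> N" "A \<noteq> {}" "A \<noteq> N" for A
  proof
    assume "sum g A = 0"
    then have "(\<Sum>w\<in>A. form (g w)) = 0" by (simp add: form_sum[symmetric])
    then show False using assms(1) that unfolding nonparallel_forces_def by blast
  qed
  then show "sum g A \<noteq> 0" if "A \<subseteq> N" "A \<noteq> {}" "A \<noteq> N" for A using that .
  fix A B assume AB: "A \<subseteq> N" "B \<subseteq> N" "A \<noteq> {}" "B \<noteq> {}" "A \<inter> B = {}" "A \<union> B \<noteq> N"
  then obtain x where x: "x \<in> A" by blast
  define C where "C = N - B - {x}"
  have fin: "finite A" "finite C" using finite_subset[OF AB(1) assms(3)] assms(3) by (simp_all add: C_def)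
  have psub: "A - {x} \<subset> N - {x}" "C \<subset> N - {x}" "A - {x} \<noteq> C"
    using AB x unfolding C_def by blast+
  have sA: "form (g x) + (\<Sum>w\<in>A - {x}. form (g w)) = form (sum g A)"
    using x fin by (simp add: form_add form_sum sum.remove)
  have "insert x C = N - B" "x \<notin> C" using AB x by (auto simp: C_def)
  then have sC: "form (g x) + (\<Sum>w\<in>C. form (g w)) = form (sum g (N - B))"
    using fin by (metis form_sum sum.insert)
  have nz: "sum g A \<noteq> 0" "sum g (N - B) \<noteq> 0" by (rule 1; use AB in blast)+
  have "\<forall>x\<in>N. \<forall>A B. A \<subset> N - {x} \<longrightarrow> B \<subset> N - {x} \<longrightarrow> A \<noteq> B \<longrightarrow>
      (\<forall>m m'. line_of_force (form (g x) + (\<Sum>w\<in>A. form (g w))) m \<longrightarrow>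
        line_of_force (form (g x) + (\<Sum>w\<in>B. form (g w))) m' \<longrightarrow> m \<noteq> m')"
    using assms(1) unfolding nonparallel_forces_def by (rule conjunct2)
  then have "\<forall>m m'. line_of_force (form (g x) + (\<Sum>w\<in>A - {x}. form (g w))) m \<longrightarrow>
        line_of_force (form (g x) + (\<Sum>w\<in>C. form (g w))) m' \<longrightarrow> m \<noteq> m'"
    using psub x AB(1) by blast
  then have "nline (sum g A) \<noteq> nline (sum g (N - B))"
    unfolding sA sC line_of_force_form using nz by simp
  moreover have "sum g (N - B) = - sum g B" using assms(2) sum_diff[OF assms(3) AB(2), of g] by simp
  ultimately show "sum g A \<times> sum g B \<noteq> 0" using nz by (simp add: nline_eq_iff nline_minus)
qed

text \<open>The normals of the five edges around \<open>v1v2\<close> are sums over the leaves beyond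
  them and therefore satisfy the two equilibrium equations of \<open>surgery_line_nline\<close>. The
  resulting normal \<open>n14 + n26\<close> is the sum over the leaves beyond the new central
  edge.\<close>

lemma surgery_force_lines:
  assumes S: "split_system S N A" and g: "generic_normals N g"
    and p: "p \<noteq> 0" "\<And>w. w \<in> N \<Longrightarrow> g w \<bullet> p = 0"
    and app: "surgery_applicable S (HPhi v1 v2 v3 v4 v5 v6 c3 c4)"
    and M: "\<And>u v. {u, v} \<in> S \<Longrightarrow> M {u, v} = Some (nline (sum g (A u v)))"
    and uv: "{u, v} \<in> surgery_tree (HPhi v1 v2 v3 v4 v5 v6 c3 c4) S"
  shows "surgery_lines (pt p) (HPhi v1 v2 v3 v4 v5 v6 c3 c4) M {u, v} =
    Some (nline (sum g (surgery_splits v1 v2 v3 v4 v5 v6 A u v)))"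
proof -
  let ?s = "HPhi v1 v2 v3 v4 v5 v6 c3 c4"
  let ?A = "surgery_splits v1 v2 v3 v4 v5 v6 A"
  let ?M = "surgery_lines (pt p) ?s M"
  have d: "distinct [v1, v2, v3, v4, v5, v6]" and n1: "nbrs S v1 = {v2, v3, v4}" and n2: "nbrs S v2 = {v1, v5, v6}"
    and op: "operation_III c3" "operation_IV c4"
    using app by auto
  have d': "v1 \<noteq> v2" "v1 \<noteq> v3" "v1 \<noteq> v4" "v1 \<noteq> v5" "v1 \<noteq> v6" "v2 \<noteq> v3" "v2 \<noteq> v4" "v2 \<noteq> v5" "v2 \<noteq> v6"
    "v3 \<noteq> v4" "v3 \<noteq> v5" "v3 \<noteq> v6" "v4 \<noteq> v5" "v4 \<noteq> v6" "v5 \<noteq> v6" using d by auto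
  have e: "{v1, v2} \<in> S" "{v1, v3} \<in> S" "{v1, v4} \<in> S" "{v2, v5} \<in> S" "{v2, v6} \<in> S"
    using n1 n2 unfolding nbrs_def by blast+
  note fin = split_systemD(1)[OF S]
  have S': "split_system (surgery_tree ?s S) N ?A" by (rule split_system_surgery[OF S app])
  have d12: "distinct [v2, v3, v4]" "distinct [v1, v5, v6]" using d by auto
  note p1 = split_system_three[OF S n1 d12(1)]
  note p2 = split_system_three[OF S n2 d12(2)]
  note sub = split_systemD(3)[OF S e(1)] split_systemD(3)[OF S e(2)] split_systemD(3)[OF S e(3)]
    split_systemD(3)[OF S e(4)] split_systemD(3)[OF S e(5)]
  note ne = split_systemD(2)[OF S e(1)] split_systemD(2)[OF S e(2)] split_systemD(2)[OF S e(3)]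
    split_systemD(2)[OF S e(4)] split_systemD(2)[OF S e(5)]
  have c: "A v2 v1 = N - A v1 v2" using split_systemD(4)[OF S e(1)] .
  have s12: "A v1 v2 = A v2 v5 \<union> A v2 v6" using p2(2-4) unfolding c using sub by blast
  have f: "finite (A v1 v2)" "finite (A v1 v3)" "finite (A v1 v4)" "finite (A v2 v5)" "finite (A v2 v6)"
    using sub fin finite_subset by blast+
  define n where "n u v = sum g (A u v)" for u v
  have perp: "sum g B \<bullet> p = 0" if "B \<subseteq> N" for B
    unfolding inner_sum_left using that p(2) by (intro sum.neutral) blast
  have eq2: "n v1 v2 = n v2 v5 + n v2 v6"
    unfolding n_def s12 using f p2(5) by (simp add: sum.union_disjoint)
  have "sum g N = n v1 v2 + n v1 v3 + n v1 v4"
    unfolding n_def p1(2)[symmetric] using f p1(3-5) by (simp add: sum.union_disjoint Int_Un_distrib2)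
  then have eq1: "n v1 v2 + n v1 v3 + n v1 v4 = 0" using generic_normalsD(1)[OF g] by simp
  have nz13: "n v1 v2 \<times> n v1 v3 \<noteq> 0"
    unfolding n_def
  proof (rule generic_normalsD(3)[OF g sub(1,2) ne(1,2) p1(3)])
    show "A v1 v2 \<union> A v1 v3 \<noteq> N" using ne(3) sub(3) p1(4,5) by blast
  qed
  have c': "n v2 v1 = - n v1 v2" unfolding n_def c by (rule generic_normals_complement[OF g fin sub(1)])
  have "n v2 v1 \<times> n v2 v5 \<noteq> 0"
    unfolding n_def
  proof (rule generic_normalsD(3)[OF g _ sub(4) _ ne(4) p2(3)])
    show "A v2 v1 \<subseteq> N" using c by blast
    show "A v2 v1 \<noteq> {}" using split_systemD(2)[OF S, of v2 v1] e(1) by (simp add: insert_commute)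
    show "A v2 v1 \<union> A v2 v5 \<noteq> N" using ne(5) sub(5) p2(4,5) by blast
  qed
  then have nz25: "n v1 v2 \<times> n v2 v5 \<noteq> 0" unfolding c' by simp
  \<comment> \<open>The edges \<open>v1v3\<close> and \<open>v2v5\<close> are not adjacent in the
    old tree, so weak genericity would not separate their lines; strong genericity does.\<close>
  have nz35: "n v1 v3 \<times> n v2 v5 \<noteq> 0"
    unfolding n_def
  proof (rule generic_normalsD(3)[OF g sub(2,4) ne(2,4)])
    show "A v1 v3 \<inter> A v2 v5 = {}" using p1(3) s12 by blast
    show "A v1 v3 \<union> A v2 v5 \<noteq> N" using ne(3) sub(3) p1(4,5) s12 by blast
  qed
  have line: "surgery_line c3 c4 (pt p) (M {v1, v2}) (M {v1, v3}) (M {v1, v4}) (M {v2, v5}) (M {v2, v6}) =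
      Some (nline (n v1 v4 + n v2 v6))"
    unfolding M[OF e(1)] M[OF e(2)] M[OF e(3)] M[OF e(4)] M[OF e(5)] n_def[symmetric]
    by (rule surgery_line_nline[OF op p(1) _ _ _ _ _ eq1 eq2 nz13 nz25 nz35])
      (unfold n_def, (rule perp, rule sub)+)
  have dj: "A v1 v4 \<inter> A v2 v6 = {}" using p1(4) s12 by blast
  define Q where "Q u v \<longleftrightarrow> ?M {u, v} = Some (nline (sum g (?A u v)))" for u v
  have flip: "Q v u" if "Q u v" "{u, v} \<in> surgery_tree ?s S" for u v
  proof -
    have "?A v u = N - ?A u v" using split_systemD(4)[OF S' that(2)] .
    then have "sum g (?A v u) = - sum g (?A u v)"
      using generic_normals_complement[OF g fin split_systemD(3)[OF S' that(2)]] by simp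
    then show ?thesis using that(1) by (simp only: Q_def nline_minus insert_commute)
  qed
  have pair: "Q u v" if "{u, v} = {x, y}" "Q x y" "{x, y} \<in> surgery_tree ?s S" for u v x y
    using that flip by (metis doubleton_eq_iff)
  have ne12: "{v1, v2} \<noteq> {v1, v5}" "{v1, v2} \<noteq> {v2, v4}" "{v1, v5} \<noteq> {v2, v4}"
    using d' by (auto simp: doubleton_eq_iff)
  have cs: "{u, v} = {v1, v2} \<or> {u, v} = {v2, v4} \<or> {u, v} = {v1, v5} \<or> {u, v} \<in> S \<and> {u, v} \<noteq> {v1, v2} \<and>
        {u, v} \<noteq> {v2, v4} \<and> {u, v} \<noteq> {v1, v5}"
    using uv[unfolded surgery_tree.simps Un_iff Diff_iff insert_iff empty_iff] by metis
  then consider "{u, v} = {v1, v2}" | "{u, v} = {v2, v4}" | "{u, v} = {v1, v5}"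
    | "{u, v} \<in> S" "{u, v} \<noteq> {v1, v2}" "{u, v} \<noteq> {v2, v4}" "{u, v} \<noteq> {v1, v5}" by argo
  then have "Q u v"
  proof cases
    case 1
    have "?M {v1, v2} = Some (nline (n v1 v4 + n v2 v6))" using ne12 line by simp
    moreover have "sum g (?A v1 v2) = n v1 v4 + n v2 v6"
      unfolding n_def using sum.union_disjoint[OF f(3,5) dj, of g] by (simp add: surgery_splits_def)
    ultimately have "Q v1 v2" by (simp only: Q_def)
    then show ?thesis by (rule pair[OF 1]) (use uv 1 in simp)
  next
    case 2
    have "?M {v2, v4} = M {v1, v4}" "?A v2 v4 = A v1 v4" using d' by (simp_all add: surgery_splits_def)
    then have "Q v2 v4" using M[OF e(3)] by (simp only: Q_def)
    then show ?thesis by (rule pair[OF 2]) simp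
  next
    case 3
    have "?M {v1, v5} = M {v2, v5}" "?A v1 v5 = A v2 v5" using d' ne12 by (simp_all add: surgery_splits_def)
    then have "Q v1 v5" using M[OF e(4)] by (simp only: Q_def)
    then show ?thesis by (rule pair[OF 3]) simp
  next
    case 4
    have neq: "(u, v) \<noteq> (x, y) \<and> (u, v) \<noteq> (y, x)" if "{u, v} \<noteq> {x, y}" for x y
      using that by (auto simp: insert_commute)
    have "?A u v = A u v"
      using neq[OF 4(2)] neq[OF 4(3)] neq[OF 4(4)] unfolding surgery_splits_def
      by (simp_all only: if_False simp_thms)
    moreover have "?M {u, v} = M {u, v}" using 4 by simp
    ultimately show ?thesis using M[OF 4(1)] by (simp only: Q_def)
  qed
  then show ?thesis by (simp only: Q_def)
qed

text \<open>Tree, splits and lines vary in the induction, but \<open>g\<close> stays fixed. As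
  \<open>generic_normals\<close> does not mention the tree, it remains available for every
  intermediate tree.\<close>

lemma surgeries_force_lines:
  assumes "split_system S N A" and g: "generic_normals N g"
    and p: "p \<noteq> 0" "\<And>w. w \<in> N \<Longrightarrow> g w \<bullet> p = 0"
    and "surgeries_applicable S ss"
    and "\<And>u v. {u, v} \<in> S \<Longrightarrow> M {u, v} = Some (nline (sum g (A u v)))"
  shows "\<exists>A'. split_system (fold surgery_tree ss S) N A' \<and>
    (\<forall>u v. {u, v} \<in> fold surgery_tree ss S \<longrightarrow>
      fold (surgery_lines (pt p)) ss M {u, v} = Some (nline (sum g (A' u v))))"
  using assms(1,5,6)
proof (induction ss arbitrary: S A M)
  case Nil
  then show ?case by auto
next
  case (Cons s ss)
  obtain v1 v2 v3 v4 v5 v6 c3 c4 where s: "s = HPhi v1 v2 v3 v4 v5 v6 c3 c4" by (cases s)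
  have app: "surgery_applicable S (HPhi v1 v2 v3 v4 v5 v6 c3 c4)" using Cons.prems(2) s by simp
  have "surgeries_applicable (surgery_tree s S) ss" using Cons.prems(2) by simp
  then show ?case
    unfolding fold.simps comp_def
    by (rule Cons.IH[OF split_system_surgery[OF Cons.prems(1) app, folded s]])
      (use surgery_force_lines[OF Cons.prems(1) g p app Cons.prems(3)] s in simp)
qed

text \<open>Once the two leaves share a vertex, the third edge there separates them from all other
  leaves; the sum over the latter is minus the sum of the two leaf normals. The result does not
  depend on the surgeries chosen.\<close>

lemma framing_line_eq:
  assumes A: "split_system (T i) N A" and g: "generic_normals N g"
    and p: "p \<noteq> 0" "P i = pt p" "\<And>w. w \<in> N \<Longrightarrow> g w \<bullet> p = 0"
    and L: "\<And>u v. {u, v} \<in> T i \<Longrightarrow> L (glued_edge E T lf i {u, v}) = nline (sum g (A u v))"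
    and jk: "lf i j \<in> N" "lf i k \<in> N" "lf i j \<noteq> lf i k"
    and sg: "surgeries_applicable (T i) (sg i j k)"
      "stem (fold surgery_tree (sg i j k) (T i)) (lf i j) = stem (fold surgery_tree (sg i j k) (T i)) (lf i k)"
  shows "framing_line E T lf P sg L j i k = Some (nline (g (lf i j) + g (lf i k)))"
proof -
  define S where "S = fold surgery_tree (sg i j k) (T i)"
  define M where "M = fold (surgery_lines (P i)) (sg i j k) (\<lambda>e. Some (L (glued_edge E T lf i e)))"
  obtain A' where A': "split_system S N A'"
    and M: "\<And>u v. {u, v} \<in> S \<Longrightarrow> M {u, v} = Some (nline (sum g (A' u v)))"
    using surgeries_force_lines[OF A g p(1,3) sg(1), of "\<lambda>e. Some (L (glued_edge E T lf i e))"] L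
    unfolding S_def M_def p(2) by auto
  define v where "v = stem S (lf i j)"
  have "nbrs S (lf i j) = {v}" "A' v (lf i j) = {lf i j}"
    using split_systemD(5)[OF A' jk(1)] by (auto simp: v_def stem_def)
  moreover have "nbrs S (lf i k) = {v}" "A' v (lf i k) = {lf i k}"
    using split_systemD(5)[OF A' jk(2)] sg(2) by (auto simp: v_def stem_def S_def)
  ultimately have nb: "lf i j \<in> nbrs S v" "lf i k \<in> nbrs S v" "A' v (lf i j) = {lf i j}" "A' v (lf i k) = {lf i k}"
    by (auto simp: nbrs_sym[of _ S v])
  have v: "v \<notin> N"
  proof
    assume "v \<in> N"
    then obtain u where "nbrs S v = {u}" using split_systemD(5)[OF A'] by blast
    then show False using nb jk by auto
  qed
  have e: "{v, lf i j} \<in> S" "{v, lf i k} \<in> S" using nb by (auto simp: nbrs_def)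
  obtain w where w: "nbrs S v = {lf i j, lf i k, w}" "distinct [lf i j, lf i k, w]"
    by (rule split_system_third[OF A' v e jk(3)])
  have el: "the_elem (nbrs S v - {lf i j, lf i k}) = w" using w by (auto simp: insert_Diff_if)
  have "w \<in> nbrs S v" using w by simp
  then have vw: "{v, w} \<in> S" by (simp add: nbrs_def)
  have "A' v w = N - {lf i j, lf i k}"
    using split_system_three[OF A' w] nb by blast
  then have "sum g (A' v w) = - (g (lf i j) + g (lf i k))"
    using generic_normals_complement[OF g split_systemD(1)[OF A'], of "{lf i j, lf i k}"] jk by simp
  then have "M {v, w} = Some (nline (g (lf i j) + g (lf i k)))" using M[OF vw] nline_minus by metis
  then show ?thesis
    unfolding framing_line_def Let_def S_def[symmetric] M_def[symmetric] v_def[symmetric] el .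
qed

section \<open>Paths, cycles and trees\<close>

lemma rtrancl_distinct_path:
  assumes "(u, v) \<in> {(x, y). {x, y} \<in> S}\<^sup>*"
  shows "\<exists>q. q \<noteq> [] \<and> hd q = u \<and> last q = v \<and> distinct q \<and> successively (\<lambda>x y. {x, y} \<in> S) q"
  using assms
proof (induction rule: converse_rtrancl_induct)
  case base
  show ?case by (intro exI[of _ "[v]"]) simp
next
  case (step u y)
  then obtain q where q: "q \<noteq> []" "hd q = y" "last q = v" "distinct q" "successively (\<lambda>x y. {x, y} \<in> S) q"
    by blast
  show ?case
  proof (cases "u \<in> set q")
    case True
    then obtain xs ys where "q = xs @ u # ys" by (meson split_list)
    \<comment> \<open>If the path already visits \<open>u\<close>, its part before that visit is
      dropped.\<close>
    then show ?thesis using q by (intro exI[of _ "u # ys"]) (auto simp: successively_append_iff)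
  next
    case False
    then show ?thesis using q step(1) by (intro exI[of _ "u # q"]) (auto simp: successively_Cons)
  qed
qed

definition cycle_edges :: "'a list \<Rightarrow> 'a set set" where
  "cycle_edges q = {{q ! r, q ! ((r + 1) mod length q)} | r. r < length q}"

lemma cycle_edges_cases:
  assumes "e \<in> cycle_edges q" "q \<noteq> []"
  shows "e = {last q, hd q} \<or> (\<exists>r. Suc r < length q \<and> e = {q ! r, q ! Suc r})"
proof -
  obtain r where r: "r < length q" "e = {q ! r, q ! ((r + 1) mod length q)}"
    using assms(1) by (auto simp: cycle_edges_def)
  show ?thesis
  proof (cases "Suc r < length q")
    case True
    then show ?thesis using r by (intro disjI2 exI[of _ r]) simp
  next
    case False
    then have "r = length q - 1" "Suc r = length q" using r by auto
    then show ?thesis using r assms(2) by (intro disjI1) (simp add: last_conv_nth hd_conv_nth)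
  qed
qed

lemma cycle_edges_Suc: "Suc r < length q \<Longrightarrow> {q ! r, q ! Suc r} \<in> cycle_edges q"
  unfolding cycle_edges_def by (intro CollectI exI[of _ r]) simp

lemma cycle_edges_close:
  assumes "q \<noteq> []"
  shows "{last q, hd q} \<in> cycle_edges q"
  unfolding cycle_edges_def
  by (intro CollectI exI[of _ "length q - 1"]) (use assms in \<open>simp add: last_conv_nth hd_conv_nth\<close>)

text \<open>A path that avoids the edge \<open>uv\<close> has an inner vertex, so closing it by that
  edge gives at least three vertices.\<close>

lemma cycle_from_path:
  assumes q: "q \<noteq> []" "hd q = u" "last q = v" "distinct q" "successively (\<lambda>x y. {x, y} \<in> S') q"
    and uv: "u \<noteq> v" "{u, v} \<notin> S'" "{u, v} \<in> S" "S' \<subseteq> S"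
  shows "labels q (cycle_edges q)" "simple_cycle S (cycle_edges q)"
proof -
  have "length q \<noteq> 1"
  proof
    assume "length q = 1"
    then obtain x where "q = [x]" by (auto simp: length_Suc_conv)
    then show False using q uv by simp
  qed
  moreover have "length q \<noteq> 2"
  proof
    assume "length q = 2"
    then obtain x y where "q = [x, y]" by (auto simp: length_Suc_conv numeral_2_eq_2)
    then show False using q uv by simp
  qed
  moreover have "length q \<noteq> 0" using q by simp
  ultimately have "3 \<le> length q" by linarith
  then show l: "labels q (cycle_edges q)" using q by (simp add: labels_def cycle_edges_def)
  have "cycle_edges q \<subseteq> S"
  proof
    fix e assume "e \<in> cycle_edges q"
    from cycle_edges_cases[OF this q(1)] show "e \<in> S"
    proof
      assume "e = {last q, hd q}"
      then show ?thesis using q uv by (simp add: insert_commute)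
    next
      assume "\<exists>r. Suc r < length q \<and> e = {q ! r, q ! Suc r}"
      then show ?thesis using q(5) uv(4) by (auto simp: successively_conv_nth)
    qed
  qed
  then show "simple_cycle S (cycle_edges q)" using l by (auto simp: simple_cycle_def)
qed

section \<open>Branches of a tree\<close>

definition branch :: "'t set set \<Rightarrow> 't \<Rightarrow> 't \<Rightarrow> 't set" where
  "branch S u v = {w. (v, w) \<in> {(x, y). {x, y} \<in> S - {{u, v}}}\<^sup>*}"

lemma branch_self: "v \<in> branch S u v"
  by (simp add: branch_def)

lemma branch_step: "w \<in> branch S u v \<Longrightarrow> {w, x} \<in> S \<Longrightarrow> {w, x} \<noteq> {u, v} \<Longrightarrow> x \<in> branch S u v"
  unfolding branch_def by (auto intro: rtrancl_into_rtrancl)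

lemma branch_not_back:
  assumes "\<nexists>C. simple_cycle S C" "{u, v} \<in> S" "u \<noteq> v"
  shows "u \<notin> branch S u v"
proof
  assume "u \<in> branch S u v"
  then have "(v, u) \<in> {(x, y). {x, y} \<in> S - {{u, v}}}\<^sup>*" by (simp add: branch_def)
  from rtrancl_distinct_path[OF this] obtain q where
    "q \<noteq> []" "hd q = v" "last q = u" "distinct q" "successively (\<lambda>x y. {x, y} \<in> S - {{u, v}}) q" by blast
  then have "simple_cycle S (cycle_edges q)"
    by (rule cycle_from_path(2)) (use assms in \<open>auto simp: insert_commute\<close>)
  then show False using assms by blast
qed

text \<open>A walk from \<open>b\<close> that avoids the edge \<open>vb\<close> never reaches
  \<open>v\<close>, as this would close a cycle; so it avoids the edge \<open>av\<close> too, and it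
  can be preceded by the step from \<open>v\<close> to \<open>b\<close>.\<close>

lemma branch_subset:
  assumes "\<nexists>C. simple_cycle S C" "{v, a} \<in> S" "{v, b} \<in> S" "a \<noteq> b" "v \<noteq> b"
  shows "branch S v b \<subseteq> branch S a v"
proof
  fix w assume "w \<in> branch S v b"
  then have "(b, w) \<in> {(x, y). {x, y} \<in> S - {{v, b}}}\<^sup>*" by (simp add: branch_def)
  then show "w \<in> branch S a v"
  proof (induction rule: rtrancl_induct)
    case base
    show ?case using branch_step[OF branch_self[of v S a], of b] assms by (auto simp: doubleton_eq_iff)
  next
    case (step y z)
    then have "y \<in> branch S v b" "z \<in> branch S v b" by (auto simp: branch_def intro: rtrancl_into_rtrancl)
    then have "y \<noteq> v" "z \<noteq> v" using branch_not_back[OF assms(1,3,5)] by auto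
    then show ?case using step branch_step[OF step.IH, of z] by (auto simp: doubleton_eq_iff)
  qed
qed

lemma branch_inter:
  assumes "\<nexists>C. simple_cycle S C" "{u, v} \<in> S" "u \<noteq> v"
  shows "branch S u v \<inter> branch S v u = {}"
proof (rule ccontr)
  assume "branch S u v \<inter> branch S v u \<noteq> {}"
  then obtain w where w: "(v, w) \<in> {(x, y). {x, y} \<in> S - {{u, v}}}\<^sup>*"
    "(u, w) \<in> {(x, y). {x, y} \<in> S - {{u, v}}}\<^sup>*" by (auto simp: branch_def insert_commute)
  have "sym ({(x, y). {x, y} \<in> S - {{u, v}}}\<^sup>*)"
    by (rule sym_rtrancl) (auto simp: sym_def insert_commute)
  then have "(w, u) \<in> {(x, y). {x, y} \<in> S - {{u, v}}}\<^sup>*" using w(2) by (simp add: symD)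
  with w(1) have "(v, u) \<in> {(x, y). {x, y} \<in> S - {{u, v}}}\<^sup>*" by (rule rtrancl_trans)
  then show False using branch_not_back[OF assms] by (simp add: branch_def)
qed

lemma branch_union:
  assumes "connected_graph S" "{u, v} \<in> S" "w \<in> \<Union>S"
  shows "w \<in> branch S u v \<union> branch S v u"
proof -
  have "(u, w) \<in> {(x, y). {x, y} \<in> S}\<^sup>*" using assms unfolding connected_graph_def by blast
  then show ?thesis
  proof (induction rule: rtrancl_induct)
    case base
    show ?case by (simp add: branch_self)
  next
    case (step y z)
    show ?case
    proof (cases "{y, z} = {u, v}")
      case True
      then show ?thesis using branch_self[of u S v] branch_self[of v S u] by (auto simp: doubleton_eq_iff)
    next
      case False
      then show ?thesis using step branch_step[of y S _ _ z] by (auto simp: insert_commute)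
    qed
  qed
qed

lemma branches_at_vertex:
  assumes "connected_graph S" "v \<in> \<Union>S" "w \<in> \<Union>S" "w \<noteq> v"
  shows "\<exists>a\<in>nbrs S v. w \<in> branch S v a"
proof -
  have "(v, w) \<in> {(x, y). {x, y} \<in> S}\<^sup>*" using assms unfolding connected_graph_def by blast
  then have "w = v \<or> (\<exists>a\<in>nbrs S v. w \<in> branch S v a)"
  proof (induction rule: rtrancl_induct)
    case base
    show ?case by simp
  next
    case (step y z)
    from step.IH show ?case
    proof
      assume "y = v"
      then show ?thesis using step.hyps branch_self[of z S v] by (auto simp: nbrs_def)
    next
      assume "\<exists>a\<in>nbrs S v. y \<in> branch S v a"
      then obtain a where a: "a \<in> nbrs S v" "y \<in> branch S v a" by blast
      show ?thesis
      proof (cases "{y, z} = {v, a}")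
        case True
        then show ?thesis using a branch_self[of a S v] by (auto simp: doubleton_eq_iff)
      next
        case False
        then show ?thesis using a step branch_step[of y S v a z] by auto
      qed
    qed
  qed
  then show ?thesis using assms(4) by blast
qed

lemma simple_graph_edge_neq: "simple_graph S \<Longrightarrow> {u, v} \<in> S \<Longrightarrow> u \<noteq> v"
  by (fastforce simp: simple_graph_def)

lemma full_binary_treeD:
  assumes "full_binary_tree S"
  shows "simple_graph S" "connected_graph S" "\<nexists>C. simple_cycle S C"
    "\<And>v. v \<in> \<Union>S \<Longrightarrow> vdegree S v = 1 \<or> vdegree S v = 3"
  using assms unfolding full_binary_tree_def by blast+

lemma finite_vertices: "simple_graph S \<Longrightarrow> finite (\<Union>S)"
  unfolding simple_graph_def by (metis card.infinite finite_Union zero_neq_numeral)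

lemma branch_vertices:
  assumes "{u, v} \<in> S"
  shows "branch S u v \<subseteq> \<Union>S"
proof
  fix w assume "w \<in> branch S u v"
  then have "(v, w) \<in> {(x, y). {x, y} \<in> S - {{u, v}}}\<^sup>*" by (simp add: branch_def)
  then show "w \<in> \<Union>S" by (induction rule: rtrancl_induct) (use assms in auto)
qed

text \<open>A vertex of degree 3 has a neighbour leading further away from the edge, and the branch
  behind it is strictly smaller; in a finite tree this descent ends at a vertex of degree 1.\<close>

lemma branch_has_leaf:
  assumes T: "full_binary_tree S" and "{u, v} \<in> S"
  shows "branch S u v \<inter> end_vertices S \<noteq> {}"
  using assms(2)
proof (induction "card (branch S u v)" arbitrary: u v rule: less_induct)
  case less
  note D = full_binary_treeD[OF T]
  have vS: "v \<in> \<Union>S" using less.prems by blast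
  show ?case
  proof (cases "vdegree S v = 1")
    case True
    then show ?thesis using branch_self[of v S u] vS by (auto simp: end_vertices_def)
  next
    case False
    then have "card (nbrs S v) = 3" using D(4)[OF vS] by (simp add: vdegree_def)
    moreover have "u \<in> nbrs S v" using less.prems by (simp add: nbrs_def insert_commute)
    ultimately obtain a where a: "a \<in> nbrs S v" "a \<noteq> u" by (auto simp: card_3_iff)
    have va: "{v, a} \<in> S" "v \<noteq> a" using a simple_graph_edge_neq[OF D(1)] by (auto simp: nbrs_def)
    have vu: "{v, u} \<in> S" using less.prems by (simp add: insert_commute)
    have sub: "branch S v a \<subseteq> branch S u v" by (rule branch_subset[OF D(3) vu va(1)]) (use a va in auto)
    moreover have "v \<notin> branch S v a" by (rule branch_not_back[OF D(3) va])
    moreover have "v \<in> branch S u v" by (rule branch_self)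
    ultimately have "branch S v a \<subset> branch S u v" by blast
    moreover have "finite (branch S u v)"
      using branch_vertices[OF less.prems] finite_vertices[OF D(1)] by (rule finite_subset)
    ultimately have "card (branch S v a) < card (branch S u v)" by (simp add: psubset_card_mono)
    then have "branch S v a \<inter> end_vertices S \<noteq> {}" using va(1) by (rule less.hyps)
    then show ?thesis using sub by blast
  qed
qed

lemma split_system_tree:
  assumes T: "full_binary_tree S"
  shows "split_system S (end_vertices S) (\<lambda>u v. branch S u v \<inter> end_vertices S)"
proof (rule split_systemI)
  note D = full_binary_treeD[OF T]
  have NS: "end_vertices S \<subseteq> \<Union>S" by (auto simp: end_vertices_def)
  then show "finite (end_vertices S)" using finite_vertices[OF D(1)] by (rule finite_subset)
  fix u v assume uv: "{u, v} \<in> S"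
  have "branch S u v \<inter> branch S v u = {}"
    by (rule branch_inter[OF D(3) uv simple_graph_edge_neq[OF D(1) uv]])
  moreover have "end_vertices S \<subseteq> branch S u v \<union> branch S v u"
    using branch_union[OF D(2) uv] NS by blast
  ultimately have "branch S v u \<inter> end_vertices S = end_vertices S - branch S u v \<inter> end_vertices S" by blast
  then show "branch S u v \<inter> end_vertices S \<noteq> {} \<and> branch S u v \<inter> end_vertices S \<subseteq> end_vertices S \<and>
      branch S v u \<inter> end_vertices S = end_vertices S - branch S u v \<inter> end_vertices S"
    using branch_has_leaf[OF T uv] by blast
next
  fix v assume v: "v \<in> end_vertices S"
  then have "card (nbrs S v) = 1" by (simp add: end_vertices_def vdegree_def)
  then obtain u where u: "nbrs S v = {u}" by (auto simp: card_1_singleton_iff)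
  \<comment> \<open>The only edge at \<open>v\<close> is the one removed in the definition of
    \<open>branch\<close>, so no walk leaves \<open>v\<close>.\<close>
  have "w = v" if "w \<in> branch S u v" for w
  proof -
    have "(v, w) \<in> {(x, y). {x, y} \<in> S - {{u, v}}}\<^sup>*" using that by (simp add: branch_def)
    then show ?thesis
    proof (induction rule: rtrancl_induct)
      case (step y z)
      then have "z \<in> nbrs S v" by (simp add: nbrs_def)
      then show ?case using step u by (simp add: insert_commute)
    qed simp
  qed
  then have "branch S u v = {v}" using branch_self[of v S u] by blast
  then show "\<exists>u. nbrs S v = {u} \<and> branch S u v \<inter> end_vertices S = {v}" using u v by auto
next
  note D = full_binary_treeD[OF T]
  fix v assume v: "v \<notin> end_vertices S" "nbrs S v \<noteq> {}"
  then have vS: "v \<in> \<Union>S" by (auto simp: nbrs_def)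
  have "card (nbrs S v) = 3" using D(4)[OF vS] v vS by (auto simp: end_vertices_def vdegree_def)
  moreover have "(\<Union>a\<in>nbrs S v. branch S v a \<inter> end_vertices S) = end_vertices S"
  proof
    show "end_vertices S \<subseteq> (\<Union>a\<in>nbrs S v. branch S v a \<inter> end_vertices S)"
    proof
      fix w assume w: "w \<in> end_vertices S"
      then have "w \<in> \<Union>S" "w \<noteq> v" using v by (auto simp: end_vertices_def)
      then show "w \<in> (\<Union>a\<in>nbrs S v. branch S v a \<inter> end_vertices S)"
        using branches_at_vertex[OF D(2) vS] w by blast
    qed
  qed blast
  moreover have "branch S v a \<inter> branch S v b = {}" if "a \<in> nbrs S v" "b \<in> nbrs S v" "a \<noteq> b" for a b
  proof -
    have e: "{v, a} \<in> S" "{v, b} \<in> S" using that by (auto simp: nbrs_def)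
    have ne: "v \<noteq> a" "v \<noteq> b" using e simple_graph_edge_neq[OF D(1)] by blast+
    have "branch S v b \<subseteq> branch S a v" by (rule branch_subset[OF D(3) e that(3) ne(2)])
    then show ?thesis using branch_inter[OF D(3) e(1) ne(1)] by blast
  qed
  ultimately show "card (nbrs S v) = 3 \<and>
      (\<Union>a\<in>nbrs S v. branch S v a \<inter> end_vertices S) = end_vertices S \<and>
      (\<forall>a\<in>nbrs S v. \<forall>b\<in>nbrs S v. a \<noteq> b \<longrightarrow>
        branch S v a \<inter> end_vertices S \<inter> (branch S v b \<inter> end_vertices S) = {})" by blast
qed

text \<open>Equilibrium at \<open>v\<close> replaces the force on \<open>uv\<close> by those on the
  two other edges at \<open>v\<close>, each with fewer leaves beyond it. An equilibrium force-load
  is thus determined by its leaf forces.\<close>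

lemma scheme_equilibrium_split:
  assumes A: "split_system S (end_vertices S) A" and H: "scheme_equilibrium S M H" and uv: "{u, v} \<in> S"
  shows "H u v = (\<Sum>w\<in>A u v. H (stem S w) w)"
  using uv
proof (induction "card (A u v)" arbitrary: u v rule: less_induct)
  case less
  let ?N = "end_vertices S"
  have vu: "{v, u} \<in> S" using less.prems by (simp add: insert_commute)
  show ?case
  proof (cases "v \<in> ?N")
    case True
    then obtain x where x: "nbrs S v = {x}" "A x v = {v}" using split_systemD(5)[OF A] by blast
    have "u \<in> nbrs S v" using vu by (simp add: nbrs_def)
    then have "x = u" using x by simp
    then show ?thesis using x by (simp add: stem_def)
  next
    case False
    have "card (nbrs S v) = 3" using split_systemD(6)[OF A False vu] .
    moreover have "u \<in> nbrs S v" using vu by (simp add: nbrs_def)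
    ultimately obtain a where a: "a \<in> nbrs S v" "a \<noteq> u" by (auto simp: card_3_iff)
    then have va: "{v, a} \<in> S" by (simp add: nbrs_def)
    obtain b where b: "nbrs S v = {u, a, b}" "distinct [u, a, b]"
      by (rule split_system_third[OF A False vu va a(2)[symmetric]])
    then have "b \<in> nbrs S v" by simp
    then have vb: "{v, b} \<in> S" by (simp add: nbrs_def)
    note t = split_system_three[OF A b]
    have fin: "finite (A v a)" "finite (A v b)"
      using split_systemD(1)[OF A] split_systemD(3)[OF A va] split_systemD(3)[OF A vb] finite_subset by auto
    have "A u v = ?N - A v u" by (rule split_systemD(4)[OF A vu])
    then have uv: "A u v = A v a \<union> A v b" using t by blast
    have "A v a \<noteq> {}" "A v b \<noteq> {}" using split_systemD(2)[OF A] va vb by auto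
    then have "A v a \<subset> A u v" "A v b \<subset> A u v" using t(5) uv by blast+
    moreover have "finite (A u v)" using fin uv by simp
    ultimately have lt: "card (A v a) < card (A u v)" "card (A v b) < card (A u v)"
      by (simp_all add: psubset_card_mono)
    have "v \<in> \<Union>S" using va by blast
    moreover have "vdegree S v = 3" using b by (simp add: vdegree_def)
    ultimately have "(\<Sum>w\<in>nbrs S v. H v w) = 0" using H unfolding scheme_equilibrium_def by blast
    then have "H v u + (H v a + H v b) = 0" using b by simp
    moreover have "H u v = - H v u" using H less.prems by (simp add: scheme_equilibrium_def)
    ultimately have "H u v = H v a + H v b" by (metis minus_unique)
    also have "\<dots> = (\<Sum>w\<in>A v a. H (stem S w) w) + (\<Sum>w\<in>A v b. H (stem S w) w)"
      using less.hyps[OF lt(1) va] less.hyps[OF lt(2) vb] by simp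
    also have "\<dots> = (\<Sum>w\<in>A u v. H (stem S w) w)" unfolding uv using fin t(5) by (simp add: sum.union_disjoint)
    finally show ?thesis .
  qed
qed

section \<open>Framed cycles\<close>

lemma decompose_nonparallel:
  fixes a b n :: "real^3"
  assumes "n \<bullet> (a \<times> b) = 0" "n \<times> a \<noteq> 0" "n \<times> b \<noteq> 0" "a \<times> b \<noteq> 0"
  obtains c d where "n = c *\<^sub>R a + d *\<^sub>R b" "c \<noteq> 0" "d \<noteq> 0"
proof -
  obtain c d where n: "n = c *\<^sub>R a + d *\<^sub>R b" by (rule decompose_orthogonal[OF assms(4,1)])
  have "c \<noteq> 0" using n assms(3) by (auto simp: cross_mult_left)
  moreover have "d \<noteq> 0" using n assms(2) by (auto simp: cross_mult_left)
  ultimately show thesis using n that by blast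
qed

text \<open>A framed cycle is represented by the list of normals \<open>(a, b)\<close> of the edge leaving a vertex and
  of the framing line at that vertex; \<open>z\<close> is a normal of the edge entering the first vertex.\<close>

fun framed_path :: "real^3 \<Rightarrow> ((real^3) \<times> (real^3)) list \<Rightarrow> framed_cycle" where
  "framed_path z [] = []"
| "framed_path z ((a, b) # xs) = (Some (pt (z \<times> a)), Some (nline b)) # framed_path a xs"

fun framings_generic :: "real^3 \<Rightarrow> ((real^3) \<times> (real^3)) list \<Rightarrow> bool" where
  "framings_generic z [] \<longleftrightarrow> True"
| "framings_generic z ((a, b) # xs) \<longleftrightarrow>
    b \<bullet> (z \<times> a) = 0 \<and> b \<times> z \<noteq> 0 \<and> b \<times> a \<noteq> 0 \<and> framings_generic a xs"

text \<open>Here the normals \<open>a\<close> count as forces with a definite magnitude, not only as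
  lines: the difference of the forces on consecutive edges has to be a force on the framing
  line.\<close>

fun balanced :: "real^3 \<Rightarrow> ((real^3) \<times> (real^3)) list \<Rightarrow> bool" where
  "balanced z [] \<longleftrightarrow> True"
| "balanced z ((a, b) # xs) \<longleftrightarrow> (a - z) \<times> b = 0 \<and> balanced a xs"

definition general_normals :: "(real^3) list \<Rightarrow> bool" where
  "general_normals as \<longleftrightarrow> distinct as \<and>
    (\<forall>a\<in>set as. \<forall>b\<in>set as. \<forall>c\<in>set as. distinct [a, b, c] \<longrightarrow> a \<bullet> (b \<times> c) \<noteq> 0)"

lemma general_normalsD:
  assumes "general_normals as" "{a, b, c} \<subseteq> set as" "distinct [a, b, c]"
  shows "a \<bullet> (b \<times> c) \<noteq> 0"
  using assms unfolding general_normals_def by auto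

lemma length_framed_path [simp]: "length (framed_path z xs) = length xs"
  by (induction z xs rule: framed_path.induct) auto

lemma cross_nonzero_if_triple:
  fixes a b c :: "real^3"
  assumes "a \<bullet> (b \<times> c) \<noteq> 0"
  shows "a \<times> b \<noteq> 0" "a \<times> c \<noteq> 0" "b \<times> c \<noteq> 0"
proof -
  have "(a \<times> b) \<bullet> c = a \<bullet> (b \<times> c)" using cross_triple[of a b c] by (simp add: inner_commute)
  then show "a \<times> b \<noteq> 0" using assms by auto
  have "(c \<times> a) \<bullet> b = a \<bullet> (b \<times> c)" using cross_triple[of c a b] cross_triple[of a b c] by (simp add: inner_commute)
  then show "a \<times> c \<noteq> 0" using assms cross_swap_eq_0[of a c] by auto
  show "b \<times> c \<noteq> 0" using assms by auto
qed

lemma cross_cross_common: "(x \<times> y) \<times> (y \<times> z) = (x \<bullet> (y \<times> z)) *\<^sub>R y" for x :: "real^3"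
proof -
  have "(x \<times> y) \<times> (y \<times> z) = ((x \<times> y) \<bullet> z) *\<^sub>R y - ((x \<times> y) \<bullet> y) *\<^sub>R z" by (rule Lagrange)
  also have "(x \<times> y) \<bullet> z = x \<bullet> (y \<times> z)" by (metis cross_triple inner_commute)
  finally show ?thesis by (simp add: dot_cross_self)
qed

lemma Join_framed:
  assumes "x \<bullet> (y \<times> z) \<noteq> 0"
  shows "Join (Some (pt (x \<times> y))) (Some (pt (y \<times> z))) = Some (nline y)"
proof -
  have "y \<noteq> 0" using assms by auto
  then show ?thesis using assms
    by (intro Join_eqI) (auto simp: cross_cross_common dot_cross_self)
qed

lemma hd_framed_path: "xs \<noteq> [] \<Longrightarrow> fst (hd (framed_path a xs)) = Some (pt (a \<times> fst (hd xs)))"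
  by (cases xs) auto

text \<open>The edge \<open>y\<close> entering the last vertex is \<open>a\<close> for a list of
  length one and an entry of the list otherwise. For the join with the first vertex it matters only
  that \<open>y\<close> differs from the last edge.\<close>

lemma last_framed_path:
  assumes "xs \<noteq> []" "distinct (a # map fst xs)"
  shows "\<exists>y\<in>set (a # map fst xs). y \<noteq> fst (last xs) \<and>
    fst (last (framed_path a xs)) = Some (pt (y \<times> fst (last xs)))"
  using assms
proof (induction a xs rule: framed_path.induct)
  case (2 z a b xs)
  show ?case
  proof (cases "xs = []")
    case True
    then show ?thesis using 2 by auto
  next
    case False
    have "framed_path a xs \<noteq> []" using False length_framed_path[of a xs] by (metis length_0_conv)
    then show ?thesis using 2 False by auto
  qed
qed simp

text \<open>The edge \<open>a0\<close> disappears, and the new first vertex is the intersection of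
  the edges \<open>z\<close> and \<open>a1\<close>. General position keeps the joins of vertices and
  the new vertex defined, and the two assumptions \<open>b\<close> do the same for the framing line;
  so "true" does not arise.\<close>

lemma omega1_framed_path:
  assumes gn: "general_normals (map fst ((a0, b0) # (a1, b1) # rest))" and ne: "rest \<noteq> []"
    and z: "z = fst (last rest)"
    and b: "b0 \<times> b1 \<noteq> 0" "(z \<times> a1) \<times> (b0 \<times> b1) \<noteq> 0"
  shows "omega1 (framed_path z ((a0, b0) # (a1, b1) # rest)) =
    framed_path z ((a1, (z \<times> a1) \<times> (b0 \<times> b1)) # rest)"
proof -
  have ds: "distinct (a0 # a1 # map fst rest)" using gn by (simp add: general_normals_def)
  have zr: "z \<in> set (map fst rest)" using ne z by simp
  have d0: "z \<bullet> (a0 \<times> a1) \<noteq> 0" by (rule general_normalsD[OF gn]) (use ds zr in auto)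
  have za: "z \<times> a1 \<noteq> 0" by (rule cross_nonzero_if_triple[OF d0])
  obtain y where y: "y \<in> set (a1 # map fst rest)" "y \<noteq> z"
    "fst (last (framed_path a1 rest)) = Some (pt (y \<times> z))"
    using last_framed_path[OF ne, of a1] ds z by auto
  have d1: "y \<bullet> (z \<times> a0) \<noteq> 0" by (rule general_normalsD[OF gn]) (use y zr ds in auto)
  define a2 where "a2 = fst (hd rest)"
  have "a2 \<in> set (map fst rest)" using ne by (simp add: a2_def)
  then have d2: "a0 \<bullet> (a1 \<times> a2) \<noteq> 0" by (intro general_normalsD[OF gn]) (use ds in auto)
  have "framed_path a1 rest \<noteq> []" using ne length_framed_path[of a1 rest] by (metis length_0_conv)
  then show ?thesis
    by (simp add: y(3) hd_framed_path[OF ne, folded a2_def] Join_framed[OF d1] Join_framed[OF d2]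
        Meet_nline za b Join_pt)
qed

lemma cross_combinations:
  fixes z a0 a1 :: "real^3"
  shows "(s *\<^sub>R z + t *\<^sub>R a0) \<times> (u *\<^sub>R a0 + v *\<^sub>R a1) =
    (s * u) *\<^sub>R (z \<times> a0) + (s * v) *\<^sub>R (z \<times> a1) + (t * v) *\<^sub>R (a0 \<times> a1)"
  by (simp add: cross_add_left cross_add_right cross_mult_left cross_mult_right algebra_simps)

text \<open>The scalar conditions are balance conditions for forces with normals \<open>z\<close>, \<open>a0\<close>, \<open>a1\<close> on consecutive
  edges: balance at the second vertex turns balance at the first vertex into balance at the merged one,
  because the force on the eliminated edge cancels. The last claim is the case of a triangle.\<close>

lemma merge_framings:
  fixes z a0 a1 b0 b1 :: "real^3"
  defines "b \<equiv> (z \<times> a1) \<times> (b0 \<times> b1)"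
  assumes D: "z \<bullet> (a0 \<times> a1) \<noteq> 0"
    and b0: "b0 \<bullet> (z \<times> a0) = 0" "b0 \<times> z \<noteq> 0" "b0 \<times> a0 \<noteq> 0"
    and b1: "b1 \<bullet> (a0 \<times> a1) = 0" "b1 \<times> a0 \<noteq> 0" "b1 \<times> a1 \<noteq> 0"
    and bal: "(a1 - a0) \<times> b1 = 0"
  shows "b \<bullet> (z \<times> a1) = 0" "b \<times> z \<noteq> 0" "b \<times> a1 \<noteq> 0" "b0 \<times> b1 \<noteq> 0"
    and "(a1 - z) \<times> b = 0 \<longleftrightarrow> (a0 - z) \<times> b0 = 0"
    and "\<And>a2 b2. a2 = z \<Longrightarrow> (a2 - a1) \<times> b2 = 0 \<Longrightarrow> b2 \<noteq> 0 \<Longrightarrow>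
      b2 \<bullet> (b0 \<times> b1) = 0 \<longleftrightarrow> (a0 - z) \<times> b0 = 0"
proof -
  have c: "z \<times> a0 \<noteq> 0" "z \<times> a1 \<noteq> 0" "a0 \<times> a1 \<noteq> 0"
    using cross_nonzero_if_triple[OF D] by auto
  obtain s t where st: "b0 = s *\<^sub>R z + t *\<^sub>R a0" "s \<noteq> 0" "t \<noteq> 0"
    by (rule decompose_nonparallel[OF b0 c(1)])
  have "a1 - a0 \<noteq> 0" using c by auto
  then obtain d where d: "b1 = d *\<^sub>R (a1 - a0)" using bal by (metis cross_eq_0_scaleR)
  have dn: "d \<noteq> 0" using d b1 by auto
  have b1': "b1 = (- d) *\<^sub>R a0 + d *\<^sub>R a1" using d by (simp add: algebra_simps)
  have x: "b0 \<times> b1 = (s * - d) *\<^sub>R (z \<times> a0) + (s * d) *\<^sub>R (z \<times> a1) + (t * d) *\<^sub>R (a0 \<times> a1)"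
    unfolding st b1' by (rule cross_combinations)
  have xz: "z \<bullet> (b0 \<times> b1) = t * d * (z \<bullet> (a0 \<times> a1))"
    by (simp add: x inner_add_right inner_diff_right dot_cross_self)
  have e1: "a1 \<bullet> (z \<times> a0) = z \<bullet> (a0 \<times> a1)" by (metis cross_triple inner_commute)
  have xa1: "a1 \<bullet> (b0 \<times> b1) = - s * d * (z \<bullet> (a0 \<times> a1))"
    by (simp add: x inner_add_right inner_diff_right dot_cross_self e1)
  show "b0 \<times> b1 \<noteq> 0" using xz D st dn by auto
  show "b \<bullet> (z \<times> a1) = 0" by (simp add: b_def dot_cross_self)
  have bx: "b \<times> v = (v \<bullet> (z \<times> a1)) *\<^sub>R (b0 \<times> b1) - (v \<bullet> (b0 \<times> b1)) *\<^sub>R (z \<times> a1)" for v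
  proof -
    have "b \<times> v = - (v \<times> b)" by (rule cross_skew)
    then show ?thesis by (simp only: b_def Lagrange[of v] minus_diff_eq)
  qed
  show "b \<times> z \<noteq> 0" "b \<times> a1 \<noteq> 0" using xz xa1 D st dn c by (auto simp: bx dot_cross_self)
  \<comment> \<open>Balance at the first vertex reads \<open>s + t = 0\<close> in the coordinates of
    \<open>b0\<close>; both remaining claims are reduced to this scalar equation.\<close>
  have "(a0 - z) \<times> b0 = (s + t) *\<^sub>R (a0 \<times> z)"
    using cross_skew[of z a0] 
    by (simp add: st Cross3.left_diff_distrib cross_add_right cross_mult_right algebra_simps)
  moreover have "a0 \<times> z \<noteq> 0" using c(1) by (simp add: cross_swap_eq_0[of a0])
  ultimately have R: "(a0 - z) \<times> b0 = 0 \<longleftrightarrow> s + t = 0" by simp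
  have "(a1 - z) \<times> b = - (b \<times> (a1 - z))" by (rule cross_skew)
  also have "\<dots> = ((a1 - z) \<bullet> (b0 \<times> b1)) *\<^sub>R (z \<times> a1)"
    by (simp add: bx inner_diff_left dot_cross_self)
  also have "(a1 - z) \<bullet> (b0 \<times> b1) = - d * (s + t) * (z \<bullet> (a0 \<times> a1))"
    by (simp add: inner_diff_left xz xa1 algebra_simps)
  finally show "(a1 - z) \<times> b = 0 \<longleftrightarrow> (a0 - z) \<times> b0 = 0" unfolding R using c D dn by auto
  fix a2 b2 assume b2: "a2 = z" "(a2 - a1) \<times> b2 = 0" "b2 \<noteq> 0"
  \<comment> \<open>In a triangle, balance at the third vertex makes \<open>b2\<close> a multiple of
    \<open>z - a1\<close>, so the determinant is again a multiple of \<open>s + t\<close>.\<close>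
  have "z - a1 \<noteq> 0" using c by auto
  then obtain f where f: "b2 = f *\<^sub>R (z - a1)" using b2 by (metis cross_eq_0_scaleR)
  then have "f \<noteq> 0" using b2 by auto
  moreover have "b2 \<bullet> (b0 \<times> b1) = f * (d * (s + t) * (z \<bullet> (a0 \<times> a1)))"
    by (simp add: f inner_diff_left xz xa1 algebra_simps)
  ultimately show "b2 \<bullet> (b0 \<times> b1) = 0 \<longleftrightarrow> (a0 - z) \<times> b0 = 0" unfolding R using D dn by auto
qed

lemma framed_cycle_condition_Cons:
  assumes "4 \<le> length c"
  shows "framed_cycle_condition c = framed_cycle_condition (omega1 c)"
proof -
  obtain x y rest where c: "c = x # y # rest" using assms by (cases c; cases "tl c") auto
  obtain q1 l1 q2 l2 where xy: "x = (q1, l1)" "y = (q2, l2)" by (cases x; cases y)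
  have l: "length (omega1 c) = length c - 1" by (simp add: c xy Let_def)
  have "length c - 3 = Suc (length c - 1 - 3)" using assms by simp
  then show ?thesis unfolding framed_cycle_condition_def l by (simp add: funpow_swap1)
qed

text \<open>All vertices but the first are balanced by assumption, and the condition detects whether
  the first one is. One projection merges the first two vertices into a new first vertex that is
  balanced exactly when the old one was, so the induction shortens the list without touching the
  other vertices.\<close>

lemma framed_cycle_condition_iff:
  assumes "3 \<le> length xs" "general_normals (map fst xs)"
    and "framings_generic (fst (last xs)) xs" "balanced (fst (hd xs)) (tl xs)"
  shows "framed_cycle_condition (framed_path (fst (last xs)) xs) \<longleftrightarrow>
    (fst (hd xs) - fst (last xs)) \<times> snd (hd xs) = 0"
  using assms
proof (induction xs rule: length_induct)
  case (1 xs)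
  note gn = 1(3)
  obtain a0 b0 a1 b1 rest where xs: "xs = (a0, b0) # (a1, b1) # rest" and ne: "rest \<noteq> []"
  proof -
    obtain x y r where "xs = x # y # r" "r \<noteq> []"
      using 1(2) by (cases xs; cases "tl xs"; cases "tl (tl xs)") auto
    then show thesis using that by (cases x; cases y) auto
  qed
  define z where "z = fst (last xs)"
  have z: "z = fst (last rest)" using ne by (simp add: z_def xs)
  have ds: "distinct (a0 # a1 # map fst rest)" using gn by (simp add: general_normals_def xs)
  have zr: "z \<in> set (map fst rest)" using ne z by simp
  have D: "z \<bullet> (a0 \<times> a1) \<noteq> 0" by (rule general_normalsD[OF gn]) (use ds zr in \<open>auto simp: xs\<close>)
  have b0: "b0 \<bullet> (z \<times> a0) = 0" "b0 \<times> z \<noteq> 0" "b0 \<times> a0 \<noteq> 0"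
    and b1: "b1 \<bullet> (a0 \<times> a1) = 0" "b1 \<times> a0 \<noteq> 0" "b1 \<times> a1 \<noteq> 0"
    and fr: "framings_generic a1 rest"
    using 1(4) unfolding z_def[symmetric] by (auto simp: xs)
  have bal: "(a1 - a0) \<times> b1 = 0" "balanced a1 rest" using 1(5) by (auto simp: xs)
  note m = merge_framings[OF D b0 b1 bal(1)]
  show ?case
  proof (cases "length xs = 3")
    case True
    then obtain a2 b2 where rest: "rest = [(a2, b2)]" by (auto simp: xs length_Suc_conv)
    then have a2: "a2 = z" using z by simp
    have b2: "b2 \<noteq> 0" "(a2 - a1) \<times> b2 = 0" using fr bal(2) rest by auto
    have nz: "b0 \<noteq> 0" "b1 \<noteq> 0" using b0 b1 by auto
    have "framed_cycle_condition (framed_path z xs) \<longleftrightarrow>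
        three_line_relation (Some (nline b0)) (Some (nline b1)) (Some (nline b2))"
      by (simp add: framed_cycle_condition_def xs rest)
    also have "\<dots> \<longleftrightarrow> b2 \<bullet> (b0 \<times> b1) = 0" by (rule three_line_relation_nline[OF nz b2(1) m(4)])
    also have "\<dots> \<longleftrightarrow> (a0 - z) \<times> b0 = 0" by (rule m(6)[OF a2 b2(2,1)])
    finally show ?thesis by (simp add: z_def xs)
  next
    case False
    define b where "b = (z \<times> a1) \<times> (b0 \<times> b1)"
    define ys where "ys = (a1, b) # rest"
    have l4: "4 \<le> length xs" using False 1(2) by simp
    have bz: "b \<noteq> 0" using m(2) by (auto simp: b_def)
    have "framed_cycle_condition (framed_path z xs) = framed_cycle_condition (omega1 (framed_path z xs))"
      using l4 by (intro framed_cycle_condition_Cons) simp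
    also have "omega1 (framed_path z xs) = framed_path z ys"
      unfolding xs ys_def b_def by (rule omega1_framed_path[OF gn[unfolded xs] ne z m(4) bz[unfolded b_def]])
    finally have c: "framed_cycle_condition (framed_path z xs) = framed_cycle_condition (framed_path z ys)" .
    have lz: "fst (last ys) = z" using ne z by (simp add: ys_def)
    have "framed_cycle_condition (framed_path (fst (last ys)) ys) \<longleftrightarrow>
      (fst (hd ys) - fst (last ys)) \<times> snd (hd ys) = 0"
    proof (rule 1(1)[rule_format])
      show "length ys < length xs" "3 \<le> length ys" using l4 by (auto simp: xs ys_def)
      show "general_normals (map fst ys)" using gn by (simp add: general_normals_def xs ys_def)
      show "framings_generic (fst (last ys)) ys"
        unfolding lz using m(1-3) fr by (simp add: ys_def b_def)
      show "balanced (fst (hd ys)) (tl ys)" using bal by (simp add: ys_def)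
    qed
    then have "framed_cycle_condition (framed_path z xs) \<longleftrightarrow> (a1 - z) \<times> b = 0"
      unfolding c lz by (simp add: ys_def)
    also have "\<dots> \<longleftrightarrow> (a0 - z) \<times> b0 = 0" unfolding b_def by (rule m(5))
    finally show ?thesis by (simp add: z_def xs)
  qed
qed

section \<open>Cycles of the framework\<close>

lemma common_point_unique:
  assumes "m \<noteq> m'" "lies_on x m" "lies_on x m'" "lies_on y m" "lies_on y m'"
  shows "x = y"
proof -
  obtain n where n: "n \<noteq> 0" "m = nline n" by (rule nline_cases)
  obtain n' where n': "n' \<noteq> 0" "m' = nline n'" by (rule nline_cases)
  have c: "n \<times> n' \<noteq> 0" using assms(1) n n' by (simp add: nline_eq_iff)
  have "z = pt (n \<times> n')" if "lies_on z m" "lies_on z m'" for z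
  proof -
    obtain v where v: "v \<noteq> 0" "z = pt v" by (rule pt_cases)
    then show ?thesis using that n n' c by (auto simp: lies_on_iff intro: pt_eqI)
  qed
  then show ?thesis using assms by metis
qed

text \<open>Equal lines would produce infinitely many intersection points. Otherwise pairs of lines
  map onto the intersection points, and as both sets have the same cardinality the map is injective;
  three concurrent lines would give two pairs the same point.\<close>

lemma lines_general_position_triple:
  assumes m: "lines_general_position I m" and I: "finite I"
    and abc: "a \<in> I" "b \<in> I" "c \<in> I" "distinct [a, b, c]" and x: "lies_on x (m a)" "lies_on x (m b)"
  shows "m a \<noteq> m b" "\<not> lies_on x (m c)"
proof -
  define X where "X = {x. \<exists>a\<in>I. \<exists>b\<in>I. a \<noteq> b \<and> lies_on x (m a) \<and> lies_on x (m b)}"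
  have X: "finite X" "card X = card I * (card I - 1) div 2"
    using m unfolding lines_general_position_def X_def[symmetric] Let_def by auto
  have ne: "m a \<noteq> m b" if "a \<in> I" "b \<in> I" "a \<noteq> b" for a b
  proof
    assume "m a = m b"
    then have "lies_on x (m a) \<Longrightarrow> lies_on x (m b)" for x by simp
    then have "{x. lies_on x (m a)} \<subseteq> X" using that unfolding X_def by blast
    then show False using X(1) infinite_points_on_line finite_subset by blast
  qed
  then show "m a \<noteq> m b" using abc by auto
  define F where "F = {B. B \<subseteq> I \<and> card B = 2}"
  have F: "finite F" "card F = card I * (card I - 1) div 2"
    using I by (auto simp: F_def n_subsets choose_two)
  define h where "h B = (SOME x. \<forall>a\<in>B. lies_on x (m a))" for B
  have h: "h {a, b} = x" if "a \<in> I" "b \<in> I" "a \<noteq> b" "lies_on x (m a)" "lies_on x (m b)" for a b x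
  proof -
    have "\<forall>c\<in>{a, b}. lies_on (h {a, b}) (m c)" unfolding h_def by (rule someI[of _ x]) (use that in auto)
    then show ?thesis using common_point_unique[OF ne[OF that(1-3)]] that by blast
  qed
  have "X \<subseteq> h ` F"
  proof
    fix x assume "x \<in> X"
    then obtain a b where ab: "a \<in> I" "b \<in> I" "a \<noteq> b" "lies_on x (m a)" "lies_on x (m b)"
      by (auto simp: X_def)
    then have "{a, b} \<in> F" by (auto simp: F_def)
    then show "x \<in> h ` F" using h[OF ab] by blast
  qed
  then have "card X \<le> card (h ` F)" using F by (simp add: card_mono)
  then have "card (h ` F) = card F" using X F card_image_le[OF F(1), of h] by linarith
  then have inj: "inj_on h F" by (rule eq_card_imp_inj_on[OF F(1)])
  show "\<not> lies_on x (m c)"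
  proof
    assume "lies_on x (m c)"
    then have "h {a, b} = h {a, c}" using h abc x by auto
    moreover have "{a, b} \<in> F" "{a, c} \<in> F" using abc by (auto simp: F_def)
    ultimately have "{a, b} = {a, c}" using inj by (simp add: inj_on_eq_iff)
    then show False using abc by (auto simp: doubleton_eq_iff)
  qed
qed

section \<open>Framed cycles by position in the list\<close>

definition prev_normal :: "real^3 \<Rightarrow> ((real^3) \<times> (real^3)) list \<Rightarrow> nat \<Rightarrow> real^3" where
  "prev_normal z xs r = (if r = 0 then z else fst (xs ! (r - 1)))"

lemma prev_normal_Cons: "prev_normal z (x # xs) (Suc r) = prev_normal (fst x) xs r"
  by (cases r) (auto simp: prev_normal_def)

lemma framed_path_nth:
  "r < length xs \<Longrightarrow> framed_path z xs ! r =
    (Some (pt (prev_normal z xs r \<times> fst (xs ! r))), Some (nline (snd (xs ! r))))"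
proof (induction z xs arbitrary: r rule: framed_path.induct)
  case (2 z a b xs)
  then show ?case by (cases r) (auto simp: prev_normal_Cons, simp add: prev_normal_def)
qed simp

lemma framings_generic_nth:
  "framings_generic z xs \<longleftrightarrow> (\<forall>r<length xs. snd (xs ! r) \<bullet> (prev_normal z xs r \<times> fst (xs ! r)) = 0 \<and>
    snd (xs ! r) \<times> prev_normal z xs r \<noteq> 0 \<and> snd (xs ! r) \<times> fst (xs ! r) \<noteq> 0)"
proof (induction z xs rule: framings_generic.induct)
  case (2 z a b xs)
  then show ?case by (simp add: All_less_Suc2 prev_normal_Cons) (simp add: prev_normal_def)
qed simp

lemma balanced_nth:
  "balanced z xs \<longleftrightarrow> (\<forall>r<length xs. (fst (xs ! r) - prev_normal z xs r) \<times> snd (xs ! r) = 0)"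
proof (induction z xs rule: balanced.induct)
  case (2 z a b xs)
  then show ?case by (simp add: All_less_Suc2 prev_normal_Cons) (simp add: prev_normal_def)
qed simp

lemma labels_cycle_edges: "labels q C \<longleftrightarrow> 3 \<le> length q \<and> distinct q \<and> C = cycle_edges q"
  by (simp add: labels_def cycle_edges_def)

lemma Union_cycle_edges:
  assumes "q \<noteq> []"
  shows "\<Union>(cycle_edges q) = set q"
proof
  show "\<Union>(cycle_edges q) \<subseteq> set q" using assms by (auto simp: cycle_edges_def)
  show "set q \<subseteq> \<Union>(cycle_edges q)"
  proof
    fix x assume "x \<in> set q"
    then obtain r where "r < length q" "x = q ! r" by (auto simp: in_set_conv_nth)
    then show "x \<in> \<Union>(cycle_edges q)"
      by (intro UnionI[of "{q ! r, q ! ((r + 1) mod length q)}"]) (auto simp: cycle_edges_def)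
  qed
qed

text \<open>For \<open>r \<noteq> s\<close> each index would be the cyclic successor of the other,
  which requires a cycle of length two.\<close>

lemma cycle_edge_inj:
  assumes q: "3 \<le> length q" "distinct q" and r: "r < length q" "s < length q"
    and e: "{q ! r, q ! ((r + 1) mod length q)} = {q ! s, q ! ((s + 1) mod length q)}"
  shows "r = s"
proof (rule ccontr)
  assume "r \<noteq> s"
  then have "q ! r \<noteq> q ! s" using q r by (simp add: nth_eq_iff_index_eq)
  then have "q ! r = q ! ((s + 1) mod length q)" "q ! ((r + 1) mod length q) = q ! s"
    using e by (auto simp: doubleton_eq_iff)
  moreover have "(s + 1) mod length q < length q" "(r + 1) mod length q < length q"
    by (rule mod_less_divisor; use r in linarith)+
  ultimately have "r = (s + 1) mod length q" "(r + 1) mod length q = s"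
    using q(2) r nth_eq_iff_index_eq by blast+
  then show False using q(1) r by (auto simp: mod_if split: if_splits)
qed

text \<open>The interface between trees and cycles. In its applications \<open>n i j\<close> is the
  normal of the force at the leaf \<open>ij\<close> in an equilibrium chosen at \<open>i\<close>. As
  the choices at different vertices are unrelated, \<open>n i j\<close> and \<open>n j i\<close> are
  parallel but in general not opposite.\<close>

locale framed_framework =
  fixes E :: "'v set set" and P :: "'v \<Rightarrow> rp2_point" and T :: "'v \<Rightarrow> 't set set"
    and lf :: "'v \<Rightarrow> 'v \<Rightarrow> 't" and sg :: "'v \<Rightarrow> 'v \<Rightarrow> 'v \<Rightarrow> 't surgery list"
    and L :: "('v \<times> 't) set \<Rightarrow> rp2_line" and n :: "'v \<Rightarrow> 'v \<Rightarrow> real^3"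
  assumes simple: "simple_graph E"
    and general: "framework_general_position E P"
    and nonzero: "{i, j} \<in> E \<Longrightarrow> n i j \<noteq> 0"
    and edge_line: "{i, j} \<in> E \<Longrightarrow> line_through {P i, P j} = nline (n i j)"
    and on_edge: "{i, j} \<in> E \<Longrightarrow> lies_on (P i) (nline (n i j))"
    and indep: "{i, j} \<in> E \<Longrightarrow> {i, k} \<in> E \<Longrightarrow> j \<noteq> k \<Longrightarrow> n i j \<times> n i k \<noteq> 0"
    and framing: "{i, j} \<in> E \<Longrightarrow> {i, k} \<in> E \<Longrightarrow> j \<noteq> k \<Longrightarrow>
      framing_line E T lf P sg L j i k = Some (nline (n i j + n i k))"
begin

text \<open>There is one scalar per vertex because \<open>c i\<close> rescales the local equilibrium
  at \<open>i\<close> as a whole; zero is excluded since it would destroy nonparallelism.\<close>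

definition consistent :: "('v \<Rightarrow> real) \<Rightarrow> 'v set set \<Rightarrow> bool" where
  "consistent c C \<longleftrightarrow> (\<forall>i. c i \<noteq> 0) \<and>
    (\<forall>i j. {i, j} \<in> C \<longrightarrow> c i *\<^sub>R n i j + c j *\<^sub>R n j i = 0)"

lemma consistent_subset: "consistent c C \<Longrightarrow> D \<subseteq> C \<Longrightarrow> consistent c D"
  unfolding consistent_def by blast

lemma opposite:
  assumes "{i, j} \<in> E"
  obtains t where "t \<noteq> 0" "n j i = t *\<^sub>R n i j"
proof -
  have "nline (n j i) = nline (n i j)"
    using edge_line[of i j] edge_line[of j i] assms by (simp add: insert_commute)
  moreover have "n j i \<noteq> 0" "n i j \<noteq> 0"
    using assms nonzero[of i j] nonzero[of j i] by (auto simp: insert_commute)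
  ultimately have "n i j \<times> n j i = 0" using nline_eq_iff by metis
  then obtain t where t: "n j i = t *\<^sub>R n i j" using \<open>n i j \<noteq> 0\<close> by (rule cross_eq_0_scaleR)
  then have "t \<noteq> 0" using \<open>n j i \<noteq> 0\<close> by auto
  then show thesis using t by (rule that)
qed

lemma edge_neq: "{i, j} \<in> E \<Longrightarrow> i \<noteq> j"
  using simple simple_graph_edge_neq by metis

lemma path_scalars:
  assumes "distinct q" "successively (\<lambda>x y. {x, y} \<in> E) q"
  shows "\<exists>c. (\<forall>i. c i \<noteq> 0) \<and> (\<forall>r. Suc r < length q \<longrightarrow>
    c (q ! r) *\<^sub>R n (q ! r) (q ! Suc r) + c (q ! Suc r) *\<^sub>R n (q ! Suc r) (q ! r) = 0)"
  using assms
proof (induction q)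
  case Nil
  show ?case by (intro exI[of _ "\<lambda>_. 1"]) simp
next
  case (Cons x q)
  then obtain c :: "'v \<Rightarrow> real" where c: "\<forall>i. c i \<noteq> 0" "\<And>r. Suc r < length q \<Longrightarrow>
    c (q ! r) *\<^sub>R n (q ! r) (q ! Suc r) + c (q ! Suc r) *\<^sub>R n (q ! Suc r) (q ! r) = 0"
    by (auto simp: successively_Cons)
  show ?case
  proof (cases "q = []")
    case True
    then show ?thesis by (intro exI[of _ "\<lambda>_. 1"]) simp
  next
    case False
    then have "{x, q ! 0} \<in> E" using Cons.prems by (simp add: successively_Cons hd_conv_nth)
    then obtain t where t: "t \<noteq> 0" "n (q ! 0) x = t *\<^sub>R n x (q ! 0)" by (rule opposite)
    \<comment> \<open>With \<open>n (q ! 0) x = t n x (q ! 0)\<close> this value solves the equation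
      of the new edge. As \<open>x\<close> does not occur in \<open>q\<close>, the older equations
      are unaffected.\<close>
    define c' where "c' = c(x := - t * c (q ! 0))"
    have c'q: "c' (q ! r) = c (q ! r)" if "r < length q" for r
      using that Cons.prems by (auto simp: c'_def)
    have "\<forall>i. c' i \<noteq> 0" using c t by (auto simp: c'_def)
    moreover have "c' ((x # q) ! r) *\<^sub>R n ((x # q) ! r) ((x # q) ! Suc r) +
        c' ((x # q) ! Suc r) *\<^sub>R n ((x # q) ! Suc r) ((x # q) ! r) = 0" if "Suc r < length (x # q)" for r
    proof (cases r)
      case 0
      have "c' x = - t * c (q ! 0)" by (simp add: c'_def)
      then show ?thesis using 0 c'q[of 0] False t by (simp add: mult.commute)
    next
      case (Suc s)
      then show ?thesis using that c(2)[of s] c'q[of s] c'q[of "Suc s"] by simp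
    qed
    ultimately show ?thesis by blast
  qed
qed

lemma consistent_cycleI:
  assumes "q \<noteq> []" and c: "\<forall>i. c i \<noteq> 0"
    and "\<And>r. Suc r < length q \<Longrightarrow>
      c (q ! r) *\<^sub>R n (q ! r) (q ! Suc r) + c (q ! Suc r) *\<^sub>R n (q ! Suc r) (q ! r) = 0"
    and "c (hd q) *\<^sub>R n (hd q) (last q) + c (last q) *\<^sub>R n (last q) (hd q) = 0"
  shows "consistent c (cycle_edges q)"
  unfolding consistent_def
proof (intro conjI allI impI)
  fix i j assume "{i, j} \<in> cycle_edges q"
  from cycle_edges_cases[OF this assms(1)]
  show "c i *\<^sub>R n i j + c j *\<^sub>R n j i = 0"
    using assms(3,4) by (auto simp: doubleton_eq_iff add.commute)
qed (use c in blast)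

text \<open>The edge normals are scaled by factors adapted to the path, so that every vertex but the
  first is balanced. Balance at the first vertex is then the equation of the one edge that the path
  omits.\<close>

lemma geometric_condition_iff_closing:
  assumes q: "labels q C" and C: "simple_cycle E C" "\<Union>C \<noteq> \<Union>E" and c: "\<forall>i. c i \<noteq> 0"
    and path: "\<And>r. Suc r < length q \<Longrightarrow>
      c (q ! r) *\<^sub>R n (q ! r) (q ! Suc r) + c (q ! Suc r) *\<^sub>R n (q ! Suc r) (q ! r) = 0"
  shows "geometric_condition E T lf P sg L q \<longleftrightarrow>
    c (hd q) *\<^sub>R n (hd q) (last q) + c (last q) *\<^sub>R n (last q) (hd q) = 0"
proof -
  define k where "k = length q"
  have k: "3 \<le> k" "distinct q" "C = cycle_edges q" using q by (auto simp: labels_cycle_edges k_def)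
  define nx where "nx r = (r + 1) mod k" for r
  define pv where "pv r = (r + k - 1) mod k" for r
  have lt: "nx r < k" "pv r < k" for r using k by (auto simp: nx_def pv_def)
  have pv: "pv r = (if r = 0 then k - 1 else r - 1)" if "r < k" for r
    using that k by (cases r) (simp_all add: pv_def)
  have nx: "nx r = (if Suc r = k then 0 else Suc r)" if "r < k" for r
    using that by (auto simp: nx_def mod_if)
  have nxpv: "nx (pv r) = r" if "r < k" for r
    using that k lt nx[of "pv r"] pv[of r] by auto
  have pn: "pv r \<noteq> nx r" if "r < k" for r using that k by (auto simp: pv nx)
  have CE: "C \<subseteq> E" using C by (simp add: simple_cycle_def)
  have eC: "{q ! r, q ! nx r} \<in> C" if "r < k" for r
    using that by (auto simp: k(3) cycle_edges_def nx_def k_def)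
  have en: "{q ! r, q ! nx r} \<in> E" if "r < k" for r using eC[OF that] CE by blast
  have ep: "{q ! r, q ! pv r} \<in> E" if "r < k" for r
    using en[OF lt(2), of r] nxpv[OF that] by (simp add: insert_commute)
  have qpn: "q ! nx r \<noteq> q ! pv r" if "r < k" for r
    using pn[OF that] k lt by (simp add: nth_eq_iff_index_eq k_def)
  define a where "a r = c (q ! r) *\<^sub>R n (q ! r) (q ! nx r)" for r
  define b where "b r = n (q ! r) (q ! pv r) + n (q ! r) (q ! nx r)" for r
  define xs where "xs = map (\<lambda>r. (a r, b r)) [0..<k]"
  have lxs: "length xs = k" by (simp add: xs_def)
  then have xsne: "xs \<noteq> []" using k by auto
  have xsr: "xs ! r = (a r, b r)" if "r < k" for r using that by (simp add: xs_def)
  have lastxs: "fst (last xs) = a (k - 1)" using xsne lxs xsr k by (simp add: last_conv_nth)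
  have hdxs: "hd xs = (a 0, b 0)" using xsne lxs xsr[of 0] k by (simp add: hd_conv_nth)
  have prev: "prev_normal (fst (last xs)) xs r = a (pv r)" if "r < k" for r
    using that by (auto simp: prev_normal_def lastxs pv xsr)
  have an: "a r \<noteq> 0" "nline (a r) = line_through (P ` {q ! r, q ! nx r})" if "r < k" for r
    using nonzero[OF en[OF that]] edge_line[OF en[OF that]] c by (auto simp: a_def nline_scaleR)
  have apv: "\<exists>t. t \<noteq> 0 \<and> a (pv r) = t *\<^sub>R n (q ! r) (q ! pv r)" if "r < k" for r
  proof -
    have e: "{q ! r, q ! pv r} \<in> E" using ep that by blast
    obtain t where "t \<noteq> 0" "n (q ! pv r) (q ! r) = t *\<^sub>R n (q ! r) (q ! pv r)"
      by (rule opposite[OF e])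
    then show ?thesis using c by (intro exI[of _ "c (q ! pv r) * t"]) (simp add: a_def nxpv[OF that])
  qed
  \<comment> \<open>The case \<open>r = 0\<close> has to be left out: for the edge from the last
    vertex to the first this identity is the closing condition itself.\<close>
  have apv_Suc: "a (pv r) = - (c (q ! r) *\<^sub>R n (q ! r) (q ! pv r))" if "r < k" "r \<noteq> 0" for r
  proof -
    obtain s where s: "r = Suc s" using \<open>r \<noteq> 0\<close> not0_implies_Suc by blast
    have "pv r = s" using that by (simp add: pv s)
    moreover have "nx s = r" using nxpv[OF that(1)] calculation by simp
    ultimately show ?thesis using path[of s] that(1) unfolding a_def k_def s
      by (metis add.commute minus_unique)
  qed
  have ind: "n (q ! r) (q ! pv r) \<times> n (q ! r) (q ! nx r) \<noteq> 0" if "r < k" for r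
    by (rule indep[OF ep[OF that] en[OF that]]) (use qpn[OF that] in simp)
  have apa: "a (pv r) \<times> a r \<noteq> 0" if "r < k" for r
    using apv[OF that] ind[OF that] c by (auto simp: a_def[of r] cross_mult_left cross_mult_right)
  have point: "P (q ! r) = pt (a (pv r) \<times> a r)" if "r < k" for r
  proof -
    obtain v where v: "v \<noteq> 0" "P (q ! r) = pt v" by (rule pt_cases)
    have "n (q ! r) (q ! pv r) \<bullet> v = 0" "n (q ! r) (q ! nx r) \<bullet> v = 0"
      using on_edge[OF ep[OF that]] on_edge[OF en[OF that]] nonzero[OF ep[OF that]] nonzero[OF en[OF that]] v
      by (auto simp: lies_on_iff)
    then have "a (pv r) \<bullet> v = 0" "a r \<bullet> v = 0" using apv[OF that] by (auto simp: a_def[of r])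
    then show ?thesis unfolding v(2) using v(1) apa[OF that] by (intro pt_eqI)
  qed
  have fr: "framing_line E T lf P sg L (q ! pv r) (q ! r) (q ! nx r) = Some (nline (b r))" if "r < k" for r
    unfolding b_def by (rule framing[OF ep[OF that] en[OF that]]) (use qpn[OF that] in simp)
  have "map (\<lambda>r. (Some (P (q ! r)), framing_line E T lf P sg L (q ! pv r) (q ! r) (q ! nx r))) [0..<k] =
      framed_path (fst (last xs)) xs"
    by (rule nth_equalityI) (simp_all add: lxs framed_path_nth xsr prev point fr)
  then have "geometric_condition E T lf P sg L q \<longleftrightarrow> framed_cycle_condition (framed_path (fst (last xs)) xs)"
    unfolding geometric_condition_def Let_def k_def[symmetric] pv_def nx_def by simp
  also have "\<dots> \<longleftrightarrow> (fst (hd xs) - fst (last xs)) \<times> snd (hd xs) = 0"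
  proof (rule framed_cycle_condition_iff)
    show "3 \<le> length xs" using k lxs by simp
    have finC: "finite C" using CE simple finite_subset by (auto simp: simple_graph_def)
    have "\<Union>C \<subseteq> \<Union>E" using CE by blast
    \<comment> \<open>A cycle that misses a vertex has at most \<open>card (\<Union>E) - 1\<close>
      vertices, the range in which general position is granted.\<close>
    then have "card (\<Union>C) < card (\<Union>E)"
      using C finite_vertices[OF simple] by (intro psubset_card_mono) auto
    then have gp: "lines_general_position C (\<lambda>e. line_through (P ` e))"
      using general C unfolding framework_general_position_def by auto
    have gp3: "a r \<bullet> (a s \<times> a t) \<noteq> 0" if "r < k" "s < k" "t < k" "distinct [r, s, t]" for r s t
    proof
      assume z: "a r \<bullet> (a s \<times> a t) = 0"
      let ?e = "\<lambda>r. {q ! r, q ! nx r}"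
      have de: "distinct [?e r, ?e s, ?e t]" "distinct [?e s, ?e t, ?e r]"
        using cycle_edge_inj[of q] k that unfolding nx_def k_def by auto
      have l: "nline (a s) \<noteq> nline (a t)"
      proof
        assume eq: "nline (a s) = nline (a t)"
        obtain x where "lies_on x (nline (a s))"
          using infinite_points_on_line[of "nline (a s)"] by (metis Collect_empty_eq finite.emptyI)
        then show False
          using lines_general_position_triple(1)[OF gp finC eC eC eC de(2), of x] that eq an by auto
      qed
      then have x: "a s \<times> a t \<noteq> 0" 
        using nline_eq_iff[OF an(1)[OF that(2)] an(1)[OF that(3)]] by simp
      then have "lies_on (pt (a s \<times> a t)) (nline (a s))" "lies_on (pt (a s \<times> a t)) (nline (a t))"
        "lies_on (pt (a s \<times> a t)) (nline (a r))"
        using z an(1)[OF that(1)] an(1)[OF that(2)] an(1)[OF that(3)]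
        by (simp_all add: lies_on_iff dot_cross_self)
      then show False
        using lines_general_position_triple(2)[OF gp finC eC eC eC de(2), of "pt (a s \<times> a t)"] that an by auto
    qed
    have a_inj: "a r \<noteq> a s" if "r < k" "s < k" "r \<noteq> s" for r s
    proof -
      \<comment> \<open>Distinctness of two normals is read off a triple product, so a third edge of
        the cycle has to be supplied.\<close>
      have "\<exists>t\<in>{0, 1, 2}. t \<noteq> r \<and> t \<noteq> s" by auto
      then obtain t where "t \<in> {0, 1, 2}" "t \<noteq> r" "t \<noteq> s" by blast
      moreover from this have "t < k" using k(1) by auto
      ultimately have t: "t < k" "t \<noteq> r" "t \<noteq> s" by auto
      show ?thesis using gp3[of t r s] t that by auto
    qed
    have as: "map fst xs = map a [0..<k]" by (simp add: xs_def comp_def)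
    show "general_normals (map fst xs)"
      unfolding general_normals_def
    proof (intro conjI ballI impI)
      have "inj_on a {0..<k}" using a_inj by (intro inj_onI) (metis atLeastLessThan_iff)
      then show "distinct (map fst xs)" by (simp add: as distinct_map)
      fix x y z assume "x \<in> set (map fst xs)" "y \<in> set (map fst xs)" "z \<in> set (map fst xs)" and d: "distinct [x, y, z]"
      then obtain r s t where "r < k" "x = a r" "s < k" "y = a s" "t < k" "z = a t" by (auto simp: as)
      then show "x \<bullet> (y \<times> z) \<noteq> 0" using gp3[of r s t] d by auto
    qed
    show "framings_generic (fst (last xs)) xs"
      unfolding framings_generic_nth lxs
    proof (intro allI impI)
      fix r assume r: "r < k"
      obtain t where t: "t \<noteq> 0" "a (pv r) = t *\<^sub>R n (q ! r) (q ! pv r)" using apv[OF r] by blast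
      have "c (q ! r) \<noteq> 0" using c by blast
      then have "b r \<bullet> (a (pv r) \<times> a r) = 0 \<and> b r \<times> a (pv r) \<noteq> 0 \<and> b r \<times> a r \<noteq> 0"
        using t ind[OF r] unfolding b_def a_def[of r]
        by (simp add: inner_add_left dot_cross_self cross_add_left cross_mult_left cross_mult_right
            cross_swap_eq_0[of "n (q ! r) (q ! nx r)"])
      then show "snd (xs ! r) \<bullet> (prev_normal (fst (last xs)) xs r \<times> fst (xs ! r)) = 0 \<and>
          snd (xs ! r) \<times> prev_normal (fst (last xs)) xs r \<noteq> 0 \<and> snd (xs ! r) \<times> fst (xs ! r) \<noteq> 0"
        by (simp add: prev[OF r] xsr[OF r])
    qed
    show "balanced (fst (hd xs)) (tl xs)"
      unfolding balanced_nth
    proof (intro allI impI)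
      fix r assume "r < length (tl xs)"
      then have r: "Suc r < k" by (simp add: lxs)
      have p: "prev_normal (fst (hd xs)) (tl xs) r = a r"
        using r by (auto simp: prev_normal_def hdxs nth_tl lxs xsr)
      have "a (pv (Suc r)) = a r" using r by (simp add: pv)
      \<comment> \<open>By the path equation \<open>- a r\<close> is the second force at vertex
        \<open>Suc r\<close>; hence the difference is the sum of both forces there, a multiple of
        the framing normal.\<close>
      then have "a (Suc r) - a r = c (q ! Suc r) *\<^sub>R b (Suc r)"
        using apv_Suc[OF r] by (simp add: a_def b_def algebra_simps)
      then show "(fst (tl xs ! r) - prev_normal (fst (hd xs)) (tl xs) r) \<times> snd (tl xs ! r) = 0"
        using r by (simp add: p nth_tl lxs xsr cross_mult_left)
    qed
  qed
  also have "\<dots> \<longleftrightarrow> c (hd q) *\<^sub>R n (hd q) (last q) + c (last q) *\<^sub>R n (last q) (hd q) = 0"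
  proof -
    have k0: "0 < k" using k by simp
    have qne: "q \<noteq> []" using k0 by (auto simp: k_def)
    have hl: "q ! 0 = hd q" "q ! (k - 1) = last q" "pv 0 = k - 1" "nx (k - 1) = 0"
      using qne k0 pv[OF k0] nx[of "k - 1"] by (auto simp: hd_conv_nth last_conv_nth k_def)
    obtain t where t: "t \<noteq> 0" "a (k - 1) = t *\<^sub>R n (hd q) (last q)" using apv[OF k0] hl by auto
    have ak: "a (k - 1) = c (last q) *\<^sub>R n (last q) (hd q)" by (simp only: a_def hl)
    define u where "u = n (hd q) (q ! nx 0)"
    define v where "v = n (hd q) (last q)"
    have uv: "v \<times> u \<noteq> 0" using ind[OF k0] unfolding u_def v_def hl .
    then have "v \<noteq> 0" by auto
    \<comment> \<open>At the first vertex \<open>c (hd q) u\<close> leaves and \<open>t v\<close>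
      enters. As \<open>u\<close> and \<open>v\<close> are independent, the difference is parallel
      to \<open>u + v\<close> only for \<open>t = - c (hd q)\<close>, which is the closing
      condition.\<close>
    have "(a 0 - a (k - 1)) \<times> b 0 = (c (hd q) *\<^sub>R u - t *\<^sub>R v) \<times> (v + u)"
      by (simp only: a_def[of 0] t b_def hl u_def v_def)
    also have "\<dots> = - ((c (hd q) + t) *\<^sub>R (v \<times> u))"
      using cross_skew[of u v]
      by (simp add: Cross3.left_diff_distrib cross_add_right cross_mult_left algebra_simps)
    finally have "(a 0 - a (k - 1)) \<times> b 0 = 0 \<longleftrightarrow> c (hd q) + t = 0" using uv by simp
    also have "\<dots> \<longleftrightarrow> (c (hd q) + t) *\<^sub>R v = 0" using \<open>v \<noteq> 0\<close> by simp
    also have "(c (hd q) + t) *\<^sub>R v = c (hd q) *\<^sub>R n (hd q) (last q) + c (last q) *\<^sub>R n (last q) (hd q)"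
      using t ak by (simp add: v_def scaleR_left_distrib)
    finally show ?thesis by (simp add: hdxs lastxs)
  qed
  finally show ?thesis .
qed

text \<open>The right-hand side knows \<open>C\<close> as a subgraph only, so the starting vertex
  and the direction of the labelling do not influence the condition.\<close>

lemma geometric_condition_iff_consistent:
  assumes q: "labels q C" and C: "simple_cycle E C" "\<Union>C \<noteq> \<Union>E"
  shows "geometric_condition E T lf P sg L q \<longleftrightarrow> (\<exists>c. consistent c C)"
proof -
  have k: "3 \<le> length q" "distinct q" "C = cycle_edges q" using q by (auto simp: labels_cycle_edges)
  have qne: "q \<noteq> []" using k by auto
  have e: "{q ! r, q ! Suc r} \<in> C" if "Suc r < length q" for r
    using that by (simp add: k(3) cycle_edges_Suc)
  show ?thesis
  proof
    assume g: "geometric_condition E T lf P sg L q"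
    have "successively (\<lambda>x y. {x, y} \<in> E) q"
      using e C by (auto simp: successively_conv_nth simple_cycle_def)
    with k(2) obtain c :: "'v \<Rightarrow> real" where c: "\<forall>i. c i \<noteq> 0" "\<And>r. Suc r < length q \<Longrightarrow>
        c (q ! r) *\<^sub>R n (q ! r) (q ! Suc r) + c (q ! Suc r) *\<^sub>R n (q ! Suc r) (q ! r) = 0"
      using path_scalars by blast
    have "consistent c C" unfolding k(3)
      by (rule consistent_cycleI[OF qne c]) (use g geometric_condition_iff_closing[OF q C c] in auto)
    then show "\<exists>c. consistent c C" by blast
  next
    assume "\<exists>c. consistent c C"
    then obtain c where c: "\<forall>i. c i \<noteq> 0" "\<And>i j. {i, j} \<in> C \<Longrightarrow> c i *\<^sub>R n i j + c j *\<^sub>R n j i = 0"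
      unfolding consistent_def by blast
    have "{hd q, last q} \<in> C" using cycle_edges_close[OF qne] k(3) by (simp add: insert_commute)
    then show "geometric_condition E T lf P sg L q"
      using geometric_condition_iff_closing[OF q C c(1) c(2)[OF e]] c(2) by blast
  qed
qed

section \<open>Gluing the local scalars\<close>

text \<open>An edge equation fixes the ratio of the factors at its two ends, so solutions on a
  connected subgraph are unique up to a common factor; this is what makes local solutions
  comparable.\<close>

lemma consistent_ratio:
  assumes "{i, j} \<in> E" "c i *\<^sub>R n i j + c j *\<^sub>R n j i = 0" "d i *\<^sub>R n i j + d j *\<^sub>R n j i = 0"
  shows "c i * d j = d i * c j"
proof -
  have nz: "n j i \<noteq> 0" using nonzero[of j i] assms(1) by (simp add: insert_commute)
  have "d i *\<^sub>R (c i *\<^sub>R n i j + c j *\<^sub>R n j i) - c i *\<^sub>R (d i *\<^sub>R n i j + d j *\<^sub>R n j i) = 0"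
    using assms by simp
  then have "(d i * c j - c i * d j) *\<^sub>R n j i = 0" by (simp add: algebra_simps)
  then show ?thesis using nz by simp
qed

lemma consistent_scale:
  assumes "consistent c C" "t \<noteq> 0"
  shows "consistent (\<lambda>i. t * c i) C"
  unfolding consistent_def
proof (intro conjI allI impI)
  show "t * c i \<noteq> 0" for i using assms by (simp add: consistent_def)
  fix i j assume "{i, j} \<in> C"
  then have "t *\<^sub>R (c i *\<^sub>R n i j + c j *\<^sub>R n j i) = 0" using assms by (simp add: consistent_def)
  then show "(t * c i) *\<^sub>R n i j + (t * c j) *\<^sub>R n j i = 0" by (simp add: scaleR_right_distrib)
qed

lemma consistent_path_ratio:
  assumes c: "\<And>i j. {i, j} \<in> E' \<Longrightarrow> c i *\<^sub>R n i j + c j *\<^sub>R n j i = 0" "\<forall>i. c i \<noteq> 0"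
    and d: "consistent d C" and E: "E' \<subseteq> E"
    and q: "successively (\<lambda>x y. {x, y} \<in> E') q"
    and qC: "\<And>r. Suc r < length q \<Longrightarrow> {q ! r, q ! Suc r} \<in> C"
  shows "r < length q \<Longrightarrow> c (q ! 0) * d (q ! r) = d (q ! 0) * c (q ! r)"
proof (induction r)
  case 0
  show ?case by simp
next
  case (Suc r)
  have e: "{q ! r, q ! Suc r} \<in> E'" using q Suc.prems by (simp add: successively_conv_nth)
  have d': "d (q ! r) *\<^sub>R n (q ! r) (q ! Suc r) + d (q ! Suc r) *\<^sub>R n (q ! Suc r) (q ! r) = 0"
    using d qC[OF Suc.prems] by (simp add: consistent_def)
  have r1: "c (q ! r) * d (q ! Suc r) = d (q ! r) * c (q ! Suc r)"
    by (rule consistent_ratio[OF _ c(1)[OF e] d']) (use e E in blast)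
  have "c (q ! 0) * d (q ! r) = d (q ! 0) * c (q ! r)" using Suc by simp
  then have "c (q ! r) * (c (q ! 0) * d (q ! Suc r)) = c (q ! r) * (d (q ! 0) * c (q ! Suc r))"
    using r1 by (metis mult.assoc mult.commute)
  then show ?case using c(2) by simp
qed

text \<open>If \<open>E'\<close> already joins the ends of the new edge, a path and this edge form a
  cycle whose factors are proportional to \<open>c\<close> along the path, so \<open>c\<close>
  satisfies the new equation as it stands. Otherwise the factors on the component of one end may be
  rescaled freely.\<close>

lemma consistent_insert:
  assumes cyc: "\<And>C. simple_cycle E C \<Longrightarrow> \<exists>c. consistent c C"
    and E': "insert e E' \<subseteq> E" "e \<notin> E'" and c: "consistent c E'"
  shows "\<exists>c. consistent c (insert e E')"
proof -
  have "card e = 2" using E' simple by (auto simp: simple_graph_def)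
  then obtain u v where uv: "e = {u, v}" "u \<noteq> v" by (auto simp: card_2_iff)
  have eE: "{u, v} \<in> E" using E' uv by simp
  have c0: "\<forall>i. c i \<noteq> 0" and cE: "\<And>i j. {i, j} \<in> E' \<Longrightarrow> c i *\<^sub>R n i j + c j *\<^sub>R n j i = 0"
    using c unfolding consistent_def by blast+
  define R where "R = {w. (u, w) \<in> {(x, y). {x, y} \<in> E'}\<^sup>*}"
  show ?thesis
  proof (cases "v \<in> R")
    case True
    then have "(u, v) \<in> {(x, y). {x, y} \<in> E'}\<^sup>*" by (simp add: R_def)
    from rtrancl_distinct_path[OF this] obtain q where
      q: "q \<noteq> []" "hd q = u" "last q = v" "distinct q" "successively (\<lambda>x y. {x, y} \<in> E') q" by blast
    have nE: "{u, v} \<notin> E'" "E' \<subseteq> E" using E' uv by auto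
    have "simple_cycle E (cycle_edges q)" by (rule cycle_from_path(2)[OF q uv(2) nE(1) eE nE(2)])
    then obtain d where d: "consistent d (cycle_edges q)" using cyc by blast
    have "c (q ! 0) * d (q ! (length q - 1)) = d (q ! 0) * c (q ! (length q - 1))"
      by (rule consistent_path_ratio[OF cE c0 d nE(2) q(5) cycle_edges_Suc]) (use q in auto)
    then have r: "c u * d v = d u * c v" using q by (simp add: hd_conv_nth last_conv_nth)
    have "d u *\<^sub>R n u v + d v *\<^sub>R n v u = 0"
      using d cycle_edges_close[OF q(1)] q by (simp add: consistent_def insert_commute)
    then have "c u *\<^sub>R (d u *\<^sub>R n u v + d v *\<^sub>R n v u) = 0" by simp
    then have "d u *\<^sub>R (c u *\<^sub>R n u v + c v *\<^sub>R n v u) = 0"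
      using r by (simp add: scaleR_right_distrib mult.commute)
    moreover have "d u \<noteq> 0" using d by (simp add: consistent_def)
    ultimately have "c u *\<^sub>R n u v + c v *\<^sub>R n v u = 0" by simp
    then have "consistent c (insert e E')"
      using c0 cE unfolding consistent_def uv by (auto simp: doubleton_eq_iff add.commute)
    then show ?thesis by blast
  next
    case False
    obtain t where t: "t \<noteq> 0" "n v u = t *\<^sub>R n u v" by (rule opposite[OF eE])
    \<comment> \<open>This factor makes the forces on the new edge cancel: the factor at
      \<open>u\<close> is multiplied by \<open>s\<close>, while \<open>v\<close>, outside the
      component \<open>R\<close>, keeps its own.\<close>
    define s where "s = - (c v * t / c u)"
    have s: "s \<noteq> 0" "s * c u = - (c v * t)" using c0 t by (auto simp: s_def)
    define d where "d w = (if w \<in> R then s * c w else c w)" for w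
    have uR: "u \<in> R" by (simp add: R_def)
    have close: "y \<in> R" if "x \<in> R" "{x, y} \<in> E'" for x y
      using that by (auto simp: R_def intro: rtrancl_into_rtrancl)
    have new: "d u *\<^sub>R n u v + d v *\<^sub>R n v u = 0" using uR False s t by (simp add: d_def)
    have old: "d x *\<^sub>R n x y + d y *\<^sub>R n y x = 0" if xy: "{x, y} \<in> E'" for x y
    proof -
      have "x \<in> R \<longleftrightarrow> y \<in> R" using close[of x y] close[of y x] xy by (auto simp: insert_commute)
      moreover have "(s * c x) *\<^sub>R n x y + (s * c y) *\<^sub>R n y x = s *\<^sub>R (c x *\<^sub>R n x y + c y *\<^sub>R n y x)"
        by (simp add: scaleR_right_distrib)
      ultimately show ?thesis using cE[OF xy] by (auto simp: d_def)
    qed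
    have "\<forall>i. d i \<noteq> 0" using c0 s by (simp add: d_def)
    then have "consistent d (insert e E')"
      using new old unfolding consistent_def uv by (auto simp: doubleton_eq_iff add.commute)
    then show ?thesis by blast
  qed
qed

lemma consistent_all:
  assumes "\<And>C. simple_cycle E C \<Longrightarrow> \<exists>c. consistent c C"
  shows "\<exists>c. consistent c E"
proof -
  have "E' \<subseteq> E \<Longrightarrow> \<exists>c. consistent c E'" if "finite E'" for E'
    using that
  proof (induction E' rule: finite_induct)
    case empty
    show ?case by (intro exI[of _ "\<lambda>_. 1"]) (simp add: consistent_def)
  next
    case (insert e E')
    then show ?case using consistent_insert[OF assms, of e E'] by auto
  qed
  moreover have "finite E" using simple by (simp add: simple_graph_def)
  ultimately show ?thesis by blast
qed

text \<open>A chord splits a Hamiltonian cycle into two cycles that each omit a vertex.\<close>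

lemma hamiltonian_chord:
  assumes q: "labels q C" and C: "C \<subseteq> E" "\<Union>C = \<Union>E" and deg: "\<forall>v\<in>\<Union>E. 3 \<le> vdegree E v"
  obtains j where "2 \<le> j" "Suc j < length q" "{q ! 0, q ! j} \<in> E"
proof -
  have k: "3 \<le> length q" "distinct q" "C = cycle_edges q" using q by (auto simp: labels_cycle_edges)
  have qne: "q \<noteq> []" using k by auto
  have V: "set q = \<Union>E" using Union_cycle_edges[OF qne] k C by simp
  let ?N = "nbrs E (q ! 0)"
  have "q ! 0 \<in> \<Union>E" using V k by (metis less_le_trans nth_mem zero_less_numeral)
  then have "3 \<le> card ?N" using deg unfolding vdegree_def by blast
  moreover have "card {q ! 1, last q} \<le> 2" by (simp add: card_insert_if)
  ultimately have "\<not> ?N \<subseteq> {q ! 1, last q}" using card_mono[of "{q ! 1, last q}" ?N] by auto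
  then obtain w where w: "{q ! 0, w} \<in> E" "w \<noteq> q ! 1" "w \<noteq> last q" by (auto simp: nbrs_def)
  then have "w \<in> set q" unfolding V by blast
  then obtain j where j: "j < length q" "w = q ! j" by (auto simp: in_set_conv_nth)
  have "q ! 0 \<noteq> w" using w(1) by (rule edge_neq)
  then have "j \<noteq> 0" using j by metis
  moreover have "j \<noteq> 1" using w j by auto
  moreover have "j \<noteq> length q - 1" using w j qne by (auto simp: last_conv_nth)
  ultimately show thesis using j w by (intro that[of j]) auto
qed

text \<open>Both smaller cycles contain the chord. Normalized to agree at one end of the chord,
  their factors agree at the other end by its edge equation, so they can be pasted together and the
  chord discarded.\<close>

lemma consistent_hamiltonian:
  assumes cyc: "\<And>C. simple_cycle E C \<Longrightarrow> \<Union>C \<noteq> \<Union>E \<Longrightarrow> \<exists>c. consistent c C"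
    and deg: "\<forall>v\<in>\<Union>E. 3 \<le> vdegree E v" and C: "simple_cycle E C"
  shows "\<exists>c. consistent c C"
proof (cases "\<Union>C = \<Union>E")
  case False
  then show ?thesis using cyc C by blast
next
  case True
  obtain q where q: "labels q C" and CE: "C \<subseteq> E" using C by (auto simp: simple_cycle_def)
  obtain j where j: "2 \<le> j" "Suc j < length q" "{q ! 0, q ! j} \<in> E"
    by (rule hamiltonian_chord[OF q CE True deg])
  have k: "3 \<le> length q" "distinct q" "C = cycle_edges q" using q by (auto simp: labels_cycle_edges)
  have qne: "q \<noteq> []" using k by auto
  have V: "set q = \<Union>E" using Union_cycle_edges[OF qne] k True by simp
  have eE: "{q ! r, q ! Suc r} \<in> E" if "Suc r < length q" for r
    using cycle_edges_Suc[OF that] k CE by blast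
  have closeE: "{last q, hd q} \<in> E" using cycle_edges_close[OF qne] k CE by blast
  \<comment> \<open>Both cycles close up through the chord from \<open>q ! 0\<close> to
    \<open>q ! j\<close>. The first omits \<open>last q\<close> because
    \<open>Suc j < length q\<close>, the second omits \<open>q ! 1\<close> because
    \<open>2 \<le> j\<close>.\<close>
  define q1 where "q1 = take (Suc j) q"
  define q2 where "q2 = q ! 0 # drop j q"
  have q0: "q ! 0 = hd q" using qne by (simp add: hd_conv_nth)
  have l1: "length q1 = Suc j" "q1 \<noteq> []" "hd q1 = q ! 0" "last q1 = q ! j" "\<And>r. r \<le> j \<Longrightarrow> q1 ! r = q ! r"
    using j qne by (auto simp: q1_def q0 last_conv_nth)
  have l2: "length q2 = Suc (length q - j)" "q2 \<noteq> []" "hd q2 = q ! 0" "last q2 = last q"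
    "\<And>r. 0 < r \<Longrightarrow> r < length q2 \<Longrightarrow> q2 ! r = q ! (j + r - 1)"
    using j by (auto simp: q2_def nth_Cons')
  have d1: "distinct q1" using k by (simp add: q1_def)
  have "q ! 0 \<notin> set (drop j q)"
  proof
    assume "q ! 0 \<in> set (drop j q)"
    then obtain r where "r < length q - j" "q ! 0 = q ! (j + r)" by (auto simp: in_set_conv_nth)
    then have "0 = j + r" using k(2) nth_eq_iff_index_eq[of q 0 "j + r"] qne by simp
    then show False using j by simp
  qed
  then have d2: "distinct q2" using k by (simp add: q2_def)
  have e1: "cycle_edges q1 \<subseteq> E"
  proof
    fix e assume "e \<in> cycle_edges q1"
    from cycle_edges_cases[OF this l1(2)] show "e \<in> E"
      using eE j l1 by (auto simp: insert_commute)
  qed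
  have e2: "cycle_edges q2 \<subseteq> E"
  proof
    fix e assume "e \<in> cycle_edges q2"
    from cycle_edges_cases[OF this l2(2)] show "e \<in> E"
    proof
      assume "e = {last q2, hd q2}"
      then show ?thesis using closeE l2 q0 by simp
    next
      assume "\<exists>r. Suc r < length q2 \<and> e = {q2 ! r, q2 ! Suc r}"
      then obtain r where r: "Suc r < length q2" "e = {q2 ! r, q2 ! Suc r}" by blast
      show ?thesis
      proof (cases r)
        case 0
        then show ?thesis using r j l2(5)[of 1] by (simp add: q2_def)
      next
        case (Suc s)
        then show ?thesis using r l2(1) l2(5)[of r] l2(5)[of "Suc r"] eE[of "j + s"] by auto
      qed
    qed
  qed
  have lb: "labels q1 (cycle_edges q1)" "labels q2 (cycle_edges q2)"
    using l1 l2 d1 d2 j by (auto simp: labels_cycle_edges)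
  have s: "simple_cycle E (cycle_edges q1)" "simple_cycle E (cycle_edges q2)"
    using lb e1 e2 by (auto simp: simple_cycle_def)
  have "last q \<notin> set q1"
  proof
    assume "last q \<in> set q1"
    then obtain r where "r \<le> j" "last q = q ! r" using l1 by (auto simp: in_set_conv_nth less_Suc_eq_le)
    then have "length q - 1 = r" using k(2) qne j nth_eq_iff_index_eq[of q "length q - 1" r]
      by (auto simp: last_conv_nth)
    then show False using j \<open>r \<le> j\<close> by simp
  qed
  then have "\<Union>(cycle_edges q1) \<noteq> \<Union>E" unfolding Union_cycle_edges[OF l1(2)] V[symmetric]
    using qne by (metis last_in_set)
  then obtain c1 where c1: "consistent c1 (cycle_edges q1)" using cyc s by blast
  have "q ! 1 \<notin> set q2"
  proof
    assume "q ! 1 \<in> set q2"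
    then obtain r where r: "r < length q2" "q ! 1 = q2 ! r" by (auto simp: in_set_conv_nth)
    then have "\<exists>s. s < length q \<and> q ! 1 = q ! s \<and> (s = 0 \<or> j \<le> s)"
      using l2(1) l2(5)[of r] j
      by (intro exI[of _ "if r = 0 then 0 else j + r - 1"]) (auto simp: q2_def)
    then obtain s where s: "s < length q" "q ! 1 = q ! s" "s = 0 \<or> j \<le> s" by blast
    then have "1 = s" using k(1,2) nth_eq_iff_index_eq[of q 1 s] by simp
    then show False using s(3) j(1) by simp
  qed
  then have "\<Union>(cycle_edges q2) \<noteq> \<Union>E" unfolding Union_cycle_edges[OF l2(2)] V[symmetric]
    using k by (metis nth_mem less_le_trans one_less_numeral_iff semiring_norm(77))
  then obtain c2' where c2': "consistent c2' (cycle_edges q2)" using cyc s by blast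
  \<comment> \<open>Normalization to the value of \<open>c1\<close> at \<open>q ! 0\<close>.\<close>
  define c2 where "c2 i = c1 (q ! 0) / c2' (q ! 0) * c2' i" for i
  have nz: "c1 i \<noteq> 0" "c2' i \<noteq> 0" for i using c1 c2' by (auto simp: consistent_def)
  have c2: "consistent c2 (cycle_edges q2)"
    unfolding c2_def by (rule consistent_scale[OF c2']) (use nz in simp)
  have eq0: "c2 (q ! 0) = c1 (q ! 0)" using nz by (simp add: c2_def)
  have "{q ! 0, q ! j} \<in> cycle_edges q1" using cycle_edges_close[OF l1(2)] l1 by (simp add: insert_commute)
  moreover have "{q ! 0, q ! j} \<in> cycle_edges q2"
    using cycle_edges_Suc[of 0 q2] l2(1) l2(5)[of 1] j by (simp add: q2_def)
  ultimately have "c1 (q ! 0) * c2 (q ! j) = c2 (q ! 0) * c1 (q ! j)"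
    using c1 c2 by (intro consistent_ratio[OF j(3)]) (auto simp: consistent_def)
  then have eqj: "c2 (q ! j) = c1 (q ! j)" using eq0 nz by simp
  define c where "c i = (if i \<in> set q1 then c1 i else c2 i)" for i
  have cq1: "c (q ! r) = c1 (q ! r)" if "r \<le> j" for r
  proof -
    have "q ! r \<in> set q1" using l1 that by (metis le_imp_less_Suc nth_mem)
    then show ?thesis by (simp add: c_def)
  qed
  have cq2: "c (q ! r) = c2 (q ! r)" if "j \<le> r" "r < length q" for r
  proof (cases "r = j")
    case True
    then show ?thesis using cq1[of j] eqj by simp
  next
    case False
    have "q ! r \<notin> set q1"
    proof
      assume "q ! r \<in> set q1"
      then obtain s where "s \<le> j" "q ! r = q ! s" using l1 by (auto simp: in_set_conv_nth less_Suc_eq_le)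
      then show False using that False k(2) j nth_eq_iff_index_eq[of q r s] by auto
    qed
    then show ?thesis by (simp add: c_def)
  qed
  have "consistent c (cycle_edges q)"
  proof (rule consistent_cycleI[OF qne])
    show "\<forall>i. c i \<noteq> 0" using c1 c2 by (simp add: c_def consistent_def)
  next
    fix r assume r: "Suc r < length q"
    show "c (q ! r) *\<^sub>R n (q ! r) (q ! Suc r) + c (q ! Suc r) *\<^sub>R n (q ! Suc r) (q ! r) = 0"
    proof (cases "r < j")
      case True
      then have "{q ! r, q ! Suc r} \<in> cycle_edges q1"
        using cycle_edges_Suc[of r q1] l1(1) l1(5)[of r] l1(5)[of "Suc r"] by simp
      then show ?thesis using c1 True cq1[of r] cq1[of "Suc r"] by (simp add: consistent_def)
    next
      case False
      then have "{q ! r, q ! Suc r} \<in> cycle_edges q2"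
        using cycle_edges_Suc[of "Suc r - j" q2] l2(1) l2(5)[of "Suc r - j"] l2(5)[of "Suc (Suc r - j)"] r
        by (simp add: Suc_diff_le)
      then show ?thesis using c2 False r cq2[of r] cq2[of "Suc r"] by (simp add: consistent_def)
    qed
  next
    have "{hd q, last q} \<in> cycle_edges q2" using cycle_edges_close[OF l2(2)] l2 q0 by (simp add: insert_commute)
    moreover have "c (hd q) = c2 (hd q)" using cq1[of 0] eq0 q0 by simp
    moreover have "c (last q) = c2 (last q)" using cq2[of "length q - 1"] j qne by (simp add: last_conv_nth)
    ultimately show "c (hd q) *\<^sub>R n (hd q) (last q) + c (last q) *\<^sub>R n (last q) (hd q) = 0"
      using c2 by (simp add: consistent_def)
  qed
  then show ?thesis using k(3) by blast
qed

lemma geometric_conditions_iff_consistent: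
  assumes deg: "\<forall>v\<in>\<Union>E. 3 \<le> vdegree E v"
    and lab: "\<forall>C. simple_cycle E C \<and> \<Union>C \<noteq> \<Union>E \<longrightarrow> labels (lab C) C"
  shows "(\<forall>C. simple_cycle E C \<and> \<Union>C \<noteq> \<Union>E \<longrightarrow> geometric_condition E T lf P sg L (lab C)) \<longleftrightarrow>
    (\<exists>c. consistent c E)"
proof
  assume g: "\<forall>C. simple_cycle E C \<and> \<Union>C \<noteq> \<Union>E \<longrightarrow> geometric_condition E T lf P sg L (lab C)"
  have "\<exists>c. consistent c C" if "simple_cycle E C" "\<Union>C \<noteq> \<Union>E" for C
    using geometric_condition_iff_consistent[of "lab C" C] lab g that by blast
  then have "\<exists>c. consistent c C" if "simple_cycle E C" for C
    using that by (rule consistent_hamiltonian[OF _ deg])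
  then show "\<exists>c. consistent c E" by (rule consistent_all)
next
  assume "\<exists>c. consistent c E"
  then obtain c where c: "consistent c E" by blast
  show "\<forall>C. simple_cycle E C \<and> \<Union>C \<noteq> \<Union>E \<longrightarrow> geometric_condition E T lf P sg L (lab C)"
  proof (intro allI impI)
    fix C assume C: "simple_cycle E C \<and> \<Union>C \<noteq> \<Union>E"
    then have "consistent c C" using consistent_subset[OF c] by (simp add: simple_cycle_def)
    then show "geometric_condition E T lf P sg L (lab C)"
      using geometric_condition_iff_consistent[of "lab C" C] lab C by blast
  qed
qed

end

section \<open>Nonparallel forces and strong genericity\<close>

lemma nonparallel_forces_cong:
  assumes "\<And>x. x \<in> N \<Longrightarrow> f x = g x"
  shows "nonparallel_forces N f \<longleftrightarrow> nonparallel_forces N g"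
proof -
  have s: "sum f A = sum g A" if "A \<subseteq> N" for A using assms that by (intro sum.cong) auto
  have "sum f A = sum g A" if "A \<subset> N - {x}" for A x using that by (intro s) blast
  then show ?thesis using s assms unfolding nonparallel_forces_def by (simp cong: conj_cong)
qed

lemma nonparallel_forces_reindex:
  assumes inj: "inj_on h N" and "nonparallel_forces (h ` N) f"
  shows "nonparallel_forces N (\<lambda>x. f (h x))"
  unfolding nonparallel_forces_def
proof (intro conjI allI impI ballI)
  have s: "(\<Sum>x\<in>A. f (h x)) = sum f (h ` A)" if "A \<subseteq> N" for A
    using sum.reindex[OF inj_on_subset[OF inj that], of f] by simp
  {
    fix A assume A: "A \<subseteq> N" "(\<Sum>x\<in>A. f (h x)) = 0"
    then have "h ` A = {} \<or> h ` A = h ` N"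
      using assms(2) s[OF A(1)] unfolding nonparallel_forces_def by (metis image_mono)
    then show "A = {} \<or> A = N" using inj_on_image_eq_iff[OF inj A(1) subset_refl] by auto
  }
  fix x A B m m'
  assume x: "x \<in> N" and AB: "A \<subset> N - {x}" "B \<subset> N - {x}" "A \<noteq> B"
    and l: "line_of_force (f (h x) + (\<Sum>y\<in>A. f (h y))) m" "line_of_force (f (h x) + (\<Sum>y\<in>B. f (h y))) m'"
  have sub: "A \<subseteq> N" "B \<subseteq> N" using AB by auto
  have im: "h ` N - {h x} = h ` (N - {x})" using inj x by (simp add: inj_on_image_set_diff[OF inj])
  have psub: "h ` C \<subset> h ` N - {h x}" if "C \<subset> N - {x}" for C
  proof -
    have "h ` C \<noteq> h ` (N - {x})" using that inj_on_image_eq_iff[OF inj, of C "N - {x}"] by blast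
    then show ?thesis unfolding im using that by blast
  qed
  have ne: "h ` A \<noteq> h ` B" using AB sub inj_on_image_eq_iff[OF inj] by blast
  have D: "\<forall>x\<in>h ` N. \<forall>A B. A \<subset> h ` N - {x} \<longrightarrow> B \<subset> h ` N - {x} \<longrightarrow> A \<noteq> B \<longrightarrow>
      (\<forall>m m'. line_of_force (f x + sum f A) m \<longrightarrow> line_of_force (f x + sum f B) m' \<longrightarrow> m \<noteq> m')"
    using assms(2) unfolding nonparallel_forces_def by (rule conjunct2)
  show "m \<noteq> m'"
    by (rule D[rule_format, OF imageI[OF x] psub[OF AB(1)] psub[OF AB(2)] ne l[unfolded s[OF sub(1)] s[OF sub(2)]]])
qed

lemma nonparallel_forces_bij:
  assumes "bij_betw h N N'"
  shows "nonparallel_forces N' f \<longleftrightarrow> nonparallel_forces N (\<lambda>x. f (h x))"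
proof
  assume "nonparallel_forces N' f"
  then show "nonparallel_forces N (\<lambda>x. f (h x))"
    using nonparallel_forces_reindex[of h N f] assms by (simp add: bij_betw_def)
next
  assume a: "nonparallel_forces N (\<lambda>x. f (h x))"
  define k where "k = inv_into N h"
  have k: "bij_betw k N' N" using assms bij_betw_inv_into by (simp add: k_def)
  then have "nonparallel_forces N' (\<lambda>x. f (h (k x)))"
    using nonparallel_forces_reindex[of k N' "\<lambda>x. f (h x)"] a by (simp add: bij_betw_def)
  moreover have "h (k x) = x" if "x \<in> N'" for x
    using that assms by (simp add: k_def bij_betw_inv_into_right)
  ultimately show "nonparallel_forces N' f" using nonparallel_forces_cong[of N' f "\<lambda>x. f (h (k x))"] by simp
qed

lemma nonparallel_forces_scale:
  assumes c: "c \<noteq> 0" and n: "nonparallel_forces N (\<lambda>x. form (g x))"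
  shows "nonparallel_forces N (\<lambda>x. form (c *\<^sub>R g x))"
proof -
  have s: "(\<Sum>x\<in>A. form (c *\<^sub>R g x)) = form (c *\<^sub>R sum g A)" for A
    by (simp add: form_sum[symmetric] scaleR_sum_right)
  have t: "(\<Sum>x\<in>A. form (g x)) = form (sum g A)" for A by (simp add: form_sum)
  have "form (c *\<^sub>R g x) + form (c *\<^sub>R sum g A) = form (c *\<^sub>R (g x + sum g A))" for x A
    by (simp add: form_add[symmetric] scaleR_right_distrib)
  moreover have "form (g x) + form (sum g A) = form (g x + sum g A)" for x A
    by (simp add: form_add)
  ultimately show ?thesis
    using n c unfolding nonparallel_forces_def s t by (simp add: line_of_force_form nline_scaleR)
qed

definition leaves_beyond :: "'t set set \<Rightarrow> 't \<Rightarrow> 't \<Rightarrow> 't set" where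
  "leaves_beyond S u v = branch S u v \<inter> end_vertices S"

lemma split_system_leaves_beyond:
  "full_binary_tree S \<Longrightarrow> split_system S (end_vertices S) (leaves_beyond S)"
  unfolding leaves_beyond_def by (rule split_system_tree)

lemma leaves_beyond_proper:
  assumes "full_binary_tree S" "{u, v} \<in> S"
  shows "leaves_beyond S u v \<subseteq> end_vertices S" "leaves_beyond S u v \<noteq> {}" "leaves_beyond S u v \<noteq> end_vertices S"
proof -
  note A = split_system_leaves_beyond[OF assms(1)]
  show "leaves_beyond S u v \<subseteq> end_vertices S" "leaves_beyond S u v \<noteq> {}"
    using split_systemD(2,3)[OF A assms(2)] by auto
  have "leaves_beyond S v u \<noteq> {}" using split_systemD(2)[OF A, of v u] assms(2) by (simp add: insert_commute)
  then show "leaves_beyond S u v \<noteq> end_vertices S" using split_systemD(4)[OF A assms(2)] by auto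
qed

text \<open>Strong genericity expressed by the leaf normals alone. Forces on interior edges are sums
  of leaf forces, so no force-load on the tree has to be mentioned.\<close>

definition carries_normals :: "'t set set \<Rightarrow> ('t set \<Rightarrow> rp2_line) \<Rightarrow> ('t \<Rightarrow> real^3) \<Rightarrow> bool" where
  "carries_normals S M g \<longleftrightarrow> sum g (end_vertices S) = 0 \<and>
    nonparallel_forces (end_vertices S) (\<lambda>w. form (g w)) \<and>
    (\<forall>u v. {u, v} \<in> S \<longrightarrow> M {u, v} = nline (sum g (leaves_beyond S u v)))"

lemma finite_end_vertices: "full_binary_tree S \<Longrightarrow> finite (end_vertices S)"
  using split_systemD(1)[OF split_system_leaves_beyond] .

lemma carries_normals_generic:
  assumes "full_binary_tree S" "carries_normals S M g"
  shows "generic_normals (end_vertices S) g"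
  using assms generic_normals_if_nonparallel finite_end_vertices unfolding carries_normals_def by blast

lemma edge_of_full_binary_tree:
  assumes "full_binary_tree S"
  obtains u v where "{u, v} \<in> S"
proof -
  obtain e where "e \<in> S" using assms by (auto simp: full_binary_tree_def)
  moreover then have "card e = 2" using full_binary_treeD(1)[OF assms] by (auto simp: simple_graph_def)
  ultimately show thesis using that by (auto simp: card_2_iff)
qed

lemma stem_edge:
  assumes "full_binary_tree S" "w \<in> end_vertices S"
  shows "nbrs S w = {stem S w}" "{stem S w, w} \<in> S" "leaves_beyond S (stem S w) w = {w}"
proof -
  obtain u where u: "nbrs S w = {u}" "leaves_beyond S u w = {w}"
    using split_systemD(5)[OF split_system_leaves_beyond[OF assms(1)] assms(2)] by blast
  then show n: "nbrs S w = {stem S w}" and "leaves_beyond S (stem S w) w = {w}" by (auto simp: stem_def)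
  have "stem S w \<in> nbrs S w" using n by simp
  then show "{stem S w, w} \<in> S" by (simp add: nbrs_def insert_commute)
qed

lemma strongly_generic_normals:
  assumes "strongly_generic p S M"
  shows "\<exists>g. carries_normals S M g"
proof -
  have T: "full_binary_tree S" using assms by (simp add: strongly_generic_def weakly_generic_def resolution_scheme_def)
  obtain H where H: "scheme_equilibrium S M H"
    and np: "nonparallel_forces (end_vertices S) (\<lambda>w. H (stem S w) w)"
    using assms by (auto simp: strongly_generic_def)
  have fo: "force_on (M {u, v}) (H u v)" "H u v = - H v u" if "{u, v} \<in> S" for u v
    using H that unfolding scheme_equilibrium_def by blast+
  note A = split_system_leaves_beyond[OF T]
  define g where "g w = (SOME n. H (stem S w) w = form n)" for w
  have g: "H (stem S w) w = form (g w)" if "w \<in> end_vertices S" for w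
  proof -
    have "force_on (M {stem S w, w}) (H (stem S w) w)" using fo(1) stem_edge(2)[OF T] that by blast
    then obtain n where "H (stem S w) w = form n" by (rule force_on_cases)
    then show ?thesis unfolding g_def by (rule someI)
  qed
  have Hg: "H u v = form (sum g (leaves_beyond S u v))" if "{u, v} \<in> S" for u v
  proof -
    have "H u v = (\<Sum>w\<in>leaves_beyond S u v. H (stem S w) w)" by (rule scheme_equilibrium_split[OF A H that])
    also have "\<dots> = (\<Sum>w\<in>leaves_beyond S u v. form (g w))"
      using g leaves_beyond_proper(1)[OF T that] by (intro sum.cong) auto
    finally show ?thesis by (simp add: form_sum)
  qed
  \<comment> \<open>The leaf forces add up to zero because of any single edge: its two leaf sets are
    complementary and the forces on its two orientations are opposite.\<close>
  obtain u v where uv: "{u, v} \<in> S" by (rule edge_of_full_binary_tree[OF T])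
  then have vu: "{v, u} \<in> S" by (simp add: insert_commute)
  have "leaves_beyond S v u = end_vertices S - leaves_beyond S u v" by (rule split_systemD(4)[OF A uv])
  then have "sum g (end_vertices S) = sum g (leaves_beyond S u v) + sum g (leaves_beyond S v u)"
    using sum.subset_diff[OF leaves_beyond_proper(1)[OF T uv] finite_end_vertices[OF T], of g]
    by (simp add: add.commute)
  also have "form \<dots> = 0" using fo(2)[OF uv] Hg[OF uv] Hg[OF vu] by (simp add: form_add)
  finally have s0: "sum g (end_vertices S) = 0" by (rule form_eq_0_iff[THEN iffD1])
  have np': "nonparallel_forces (end_vertices S) (\<lambda>w. form (g w))"
    using np nonparallel_forces_cong[of "end_vertices S" "\<lambda>w. H (stem S w) w"] g by simp
  have gn: "generic_normals (end_vertices S) g"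
    by (rule generic_normals_if_nonparallel[OF np' s0 finite_end_vertices[OF T]])
  have "M {u, v} = nline (sum g (leaves_beyond S u v))" if "{u, v} \<in> S" for u v
    using fo(1)[OF that] generic_normalsD(2)[OF gn leaves_beyond_proper[OF T that]]
    by (simp add: Hg[OF that] force_on_form)
  then show ?thesis using s0 np' unfolding carries_normals_def by blast
qed

text \<open>The force-load is obtained by giving each oriented edge the sum of the normals of the
  leaves beyond it. Adjacent edges carry different lines because their leaf sets, seen from the
  common vertex, are disjoint and leave out those beyond the third edge.\<close>

lemma strongly_generic_if_normals:
  assumes T: "full_binary_tree S" and M: "carries_normals S M g"
    and x: "x \<noteq> 0" "\<And>w. w \<in> end_vertices S \<Longrightarrow> g w \<bullet> x = 0"
  shows "strongly_generic (pt x) S M"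
proof -
  note A = split_system_leaves_beyond[OF T]
  note gn = carries_normals_generic[OF T M]
  let ?n = "\<lambda>u v. sum g (leaves_beyond S u v)"
  have Ml: "M {u, v} = nline (?n u v)" if "{u, v} \<in> S" for u v
    using M that unfolding carries_normals_def by blast
  have nz: "?n u v \<noteq> 0" if "{u, v} \<in> S" for u v
    using generic_normalsD(2)[OF gn leaves_beyond_proper[OF T that]] .
  have on: "lies_on (pt x) (M {u, v})" if "{u, v} \<in> S" for u v
  proof -
    have "?n u v \<bullet> x = 0"
      unfolding inner_sum_left using leaves_beyond_proper(1)[OF T that] x(2) by (intro sum.neutral) blast
    then show ?thesis using x(1) nz[OF that] by (simp add: Ml[OF that] lies_on_iff)
  qed
  have edge: "\<exists>u v. e = {u, v}" if "e \<in> S" for e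
  proof -
    have "card e = 2" using that full_binary_treeD(1)[OF T] by (simp add: simple_graph_def)
    then show ?thesis by (auto simp: card_2_iff)
  qed
  have rs: "resolution_scheme (pt x) S M"
    unfolding resolution_scheme_def using T on edge by metis
  have wg: "weakly_generic (pt x) S M"
    unfolding weakly_generic_def
  proof (intro conjI ballI impI, rule rs)
    fix e e' assume e: "e \<in> S" "e' \<in> S" "e \<noteq> e' \<and> e \<inter> e' \<noteq> {}"
    then obtain v where v: "v \<in> e" "v \<in> e'" by blast
    obtain a where a: "e = {v, a}" using edge[OF e(1)] v by auto
    obtain b where b: "e' = {v, b}" using edge[OF e(2)] v by auto
    have ab: "{v, a} \<in> S" "{v, b} \<in> S" "a \<noteq> b" using e a b by auto
    have "v \<notin> end_vertices S"
    proof
      assume "v \<in> end_vertices S"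
      then have "nbrs S v = {stem S v}" by (rule stem_edge[OF T])
      moreover have "a \<in> nbrs S v" "b \<in> nbrs S v" using ab by (simp_all add: nbrs_def)
      ultimately show False using ab(3) by simp
    qed
    then obtain c where c: "nbrs S v = {a, b, c}" "distinct [a, b, c]"
      by (rule split_system_third[OF A _ ab])
    then have "c \<in> nbrs S v" by simp
    then have vc: "{v, c} \<in> S" by (simp add: nbrs_def)
    note t = split_system_three[OF A c]
    have "?n v a \<times> ?n v b \<noteq> 0"
    proof (rule generic_normalsD(3)[OF gn])
      show "leaves_beyond S v a \<inter> leaves_beyond S v b = {}" using t by blast
      show "leaves_beyond S v a \<union> leaves_beyond S v b \<noteq> end_vertices S"
        using t leaves_beyond_proper(1,2)[OF T vc] by blast
    qed (use leaves_beyond_proper(1,2)[OF T ab(1)] leaves_beyond_proper(1,2)[OF T ab(2)] in auto)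
    then show "M e \<noteq> M e'" using nz ab by (simp add: a b Ml nline_eq_iff)
  qed
  define H where "H u v = form (?n u v)" for u v
  have flip: "?n u v = - ?n v u" if "{u, v} \<in> S" for u v
  proof -
    have vu: "{v, u} \<in> S" using that by (simp add: insert_commute)
    show ?thesis
      using generic_normals_complement[OF gn finite_end_vertices[OF T] leaves_beyond_proper(1)[OF T vu]]
      by (simp add: split_systemD(4)[OF A vu])
  qed
  have "scheme_equilibrium S M H"
    unfolding scheme_equilibrium_def
  proof (intro conjI allI impI ballI)
    fix u v assume uv: "{u, v} \<in> S"
    show "force_on (M {u, v}) (H u v)" using Ml[OF uv] by (simp add: H_def force_on_form)
    show "H u v = - H v u" using flip[OF uv] by (simp add: H_def form_minus)
  next
    fix u assume u: "u \<in> \<Union>S" "vdegree S u = 3"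
    then have uN: "u \<notin> end_vertices S" by (simp add: end_vertices_def)
    have "card (nbrs S u) = 3" using u by (simp add: vdegree_def)
    then obtain a b where ab: "a \<in> nbrs S u" "b \<in> nbrs S u" "a \<noteq> b" by (auto simp: card_3_iff)
    then have e: "{u, a} \<in> S" "{u, b} \<in> S" by (auto simp: nbrs_def)
    obtain c where c: "nbrs S u = {a, b, c}" "distinct [a, b, c]"
      by (rule split_system_third[OF A uN e ab(3)])
    then have "c \<in> nbrs S u" by simp
    then have uc: "{u, c} \<in> S" by (simp add: nbrs_def)
    note t = split_system_three[OF A c]
    have f: "finite (leaves_beyond S u z)" for z
      using finite_end_vertices[OF T] by (simp add: leaves_beyond_def)
    have "sum g (end_vertices S) = ?n u a + ?n u b + ?n u c"
      unfolding t(2)[symmetric] using f t(3-5) by (simp add: sum.union_disjoint Int_Un_distrib2)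
    then have "?n u a + ?n u b + ?n u c = 0" using generic_normalsD(1)[OF gn] by simp
    then have "H u a + H u b + H u c = 0" by (simp add: H_def form_add[symmetric])
    then show "(\<Sum>v\<in>nbrs S u. H u v) = 0" using c by (simp add: add.assoc)
  qed
  moreover have "\<exists>u v. {u, v} \<in> S \<and> H u v \<noteq> 0"
  proof -
    obtain u v where uv: "{u, v} \<in> S" by (rule edge_of_full_binary_tree[OF T])
    then show ?thesis using nz[OF uv] by (intro exI[of _ u] exI[of _ v]) (simp add: H_def)
  qed
  moreover have "nonparallel_forces (end_vertices S) (\<lambda>w. H (stem S w) w)"
  proof -
    have "H (stem S w) w = form (g w)" if "w \<in> end_vertices S" for w
      using stem_edge(3)[OF T that] by (simp add: H_def)
    then show ?thesis using M nonparallel_forces_cong[of "end_vertices S" "\<lambda>w. H (stem S w) w"]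
      unfolding carries_normals_def by simp
  qed
  ultimately show ?thesis using wg unfolding strongly_generic_def by blast
qed

section \<open>Gluing of leaves\<close>

text \<open>An edge with two end vertices would be the whole tree, with two leaves only. So a leaf
  has exactly one end vertex here, and \<open>glued_edge\<close> finds its framework edge
  unambiguously.\<close>

lemma stem_not_end_vertex:
  assumes T: "full_binary_tree S" and "w \<in> end_vertices S" "3 \<le> card (end_vertices S)"
  shows "stem S w \<notin> end_vertices S"
proof
  let ?u = "stem S w"
  assume u: "?u \<in> end_vertices S"
  have "w \<in> nbrs S ?u" using stem_edge(2)[OF T assms(2)] by (simp add: nbrs_def)
  then have "stem S ?u = w" using stem_edge(1)[OF T u] by simp
  then have "leaves_beyond S w ?u = {?u}" using stem_edge(3)[OF T u] by simp
  moreover have "leaves_beyond S w ?u = end_vertices S - {w}"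
    using split_systemD(4)[OF split_system_leaves_beyond[OF T] stem_edge(2)[OF T assms(2)]]
      stem_edge(3)[OF T assms(2)] by simp
  ultimately have "end_vertices S \<subseteq> {?u, w}" by blast
  then have "card (end_vertices S) \<le> card {?u, w}" by (intro card_mono) auto
  also have "\<dots> \<le> 2" by (simp add: card_insert_if)
  finally show False using assms(3) by simp
qed

locale resolved_framework =
  fixes E :: "'v set set" and P :: "'v \<Rightarrow> rp2_point" and T :: "'v \<Rightarrow> 't set set"
    and lf :: "'v \<Rightarrow> 'v \<Rightarrow> 't" and sg :: "'v \<Rightarrow> 'v \<Rightarrow> 'v \<Rightarrow> 't surgery list"
  assumes simple: "simple_graph E"
    and min_degree: "\<forall>v\<in>\<Union>E. 3 \<le> vdegree E v"
    and distinct_points: "inj_on P (\<Union>E)"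
    and general: "framework_general_position E P"
    and trees: "resolution_trees E T lf"
    and surgeries: "framing_surgeries E T lf sg"
begin

lemma tree: "i \<in> \<Union>E \<Longrightarrow> full_binary_tree (T i)"
  and leaf_bij: "i \<in> \<Union>E \<Longrightarrow> bij_betw (lf i) (nbrs E i) (end_vertices (T i))"
  using trees by (auto simp: resolution_trees_def)

lemma edge_vertices: "{i, j} \<in> E \<Longrightarrow> i \<in> \<Union>E \<and> j \<in> \<Union>E \<and> i \<noteq> j"
  using simple_graph_edge_neq[OF simple] by blast

lemma leaf_end: "{i, j} \<in> E \<Longrightarrow> lf i j \<in> end_vertices (T i)"
  using bij_betwE[OF leaf_bij] edge_vertices by (auto simp: nbrs_def)

lemma leaf_eq_iff:
  assumes "{i, j} \<in> E" "{i, k} \<in> E"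
  shows "lf i j = lf i k \<longleftrightarrow> j = k"
proof -
  have "i \<in> \<Union>E" "j \<in> nbrs E i" "k \<in> nbrs E i" using assms by (auto simp: nbrs_def)
  then show ?thesis using inj_on_eq_iff[OF bij_betw_imp_inj_on[OF leaf_bij]] by blast
qed

lemma leaf_count:
  assumes "i \<in> \<Union>E"
  shows "3 \<le> card (end_vertices (T i))"
  using bij_betw_same_card[OF leaf_bij[OF assms]] bspec[OF min_degree assms] by (simp add: vdegree_def)

lemma leaf_proper:
  assumes "{i, j} \<in> E"
  shows "{lf i j} \<noteq> end_vertices (T i)"
proof
  assume "{lf i j} = end_vertices (T i)"
  then have "card (end_vertices (T i)) = card {lf i j}" by simp
  moreover have "i \<in> \<Union>E" using assms by blast
  ultimately show False using leaf_count[of i] by simp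
qed

lemma end_vertex_leaf:
  assumes "i \<in> \<Union>E" "w \<in> end_vertices (T i)"
  obtains j where "{i, j} \<in> E" "w = lf i j"
  using bij_betw_imp_surj_on[OF leaf_bij[OF assms(1)]] assms(2) that by (auto simp: nbrs_def)

lemma glued_edge_leaf:
  assumes e: "{i, j} \<in> E"
  shows "glued_edge E T lf i {stem (T i) (lf i j), lf i j} = leaf_edge T lf i j"
proof -
  have i: "i \<in> \<Union>E" using edge_vertices[OF e] by blast
  have "stem (T i) (lf i j) \<notin> end_vertices (T i)"
    by (rule stem_not_end_vertex[OF tree[OF i] leaf_end[OF e] leaf_count[OF i]])
  then have "k = j" if "k \<in> nbrs E i" "lf i k \<in> {stem (T i) (lf i j), lf i j}" for k
    using that leaf_end[of i k] leaf_eq_iff[OF e, of k] by (auto simp: nbrs_def)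
  moreover have "j \<in> nbrs E i" using e by (simp add: nbrs_def)
  ultimately have "(THE k. k \<in> nbrs E i \<and> lf i k \<in> {stem (T i) (lf i j), lf i j}) = j"
    by (intro the_equality) auto
  then show ?thesis using \<open>j \<in> nbrs E i\<close> unfolding glued_edge_def by auto
qed

lemma glued_edge_interior:
  assumes "i \<in> \<Union>E" "e \<in> interior_edges (T i)"
  shows "glued_edge E T lf i e = Pair i ` e"
proof -
  have "lf i j \<notin> e" if "j \<in> nbrs E i" for j
    using assms leaf_end[of i j] that by (auto simp: interior_edges_def end_vertices_def nbrs_def)
  then show ?thesis by (auto simp: glued_edge_def)
qed

lemma tree_edge_cases:
  assumes "i \<in> \<Union>E" "{u, v} \<in> T i"
  obtains "{u, v} \<in> interior_edges (T i)"
  | j where "{i, j} \<in> E" "{u, v} = {stem (T i) (lf i j), lf i j}"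
proof (cases "{u, v} \<in> interior_edges (T i)")
  case False
  then obtain w where w: "w \<in> {u, v}" "vdegree (T i) w = 1"
    using assms(2) unfolding interior_edges_def by blast
  then have "w \<in> end_vertices (T i)" using assms(2) unfolding end_vertices_def by blast
  note w = w(1) this
  define z where "z = (if w = u then v else u)"
  have z: "{u, v} = {z, w}" using w by (auto simp: z_def)
  then have "z \<in> nbrs (T i) w" using assms(2) by (simp add: nbrs_def insert_commute)
  then have zs: "z = stem (T i) w" using stem_edge(1)[OF tree[OF assms(1)] w(2)] by simp
  obtain j where "{i, j} \<in> E" "w = lf i j" by (rule end_vertex_leaf[OF assms(1) w(2)])
  then show thesis using that(2)[of j] z zs by simp
qed (use that in blast)

lemma on_line_through:
  assumes "{i, j} \<in> E"
  shows "lies_on (P i) (line_through {P i, P j})"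
proof -
  have "P i \<noteq> P j" using edge_vertices[OF assms] distinct_points by (auto simp: inj_on_eq_iff)
  moreover obtain x where x: "x \<noteq> 0" "P i = pt x" by (rule pt_cases)
  moreover obtain y where y: "y \<noteq> 0" "P j = pt y" by (rule pt_cases)
  ultimately have "x \<times> y \<noteq> 0" by (simp add: pt_eq_iff)
  then show ?thesis using x y by (simp add: line_through_pt lies_on_iff dot_cross_self)
qed

lemma framed_framework_normals:
  assumes q: "quantization E T lf P L"
    and g: "\<And>i. i \<in> \<Union>E \<Longrightarrow> carries_normals (T i) (\<lambda>e. L (glued_edge E T lf i e)) (g i)"
  shows "framed_framework E P T lf sg L (\<lambda>i j. g i (lf i j))"
proof
  have gn: "generic_normals (end_vertices (T i)) (g i)" if "i \<in> \<Union>E" for i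
    by (rule carries_normals_generic[OF tree[OF that] g[OF that]])
  show indep: "g i (lf i j) \<times> g i (lf i k) \<noteq> 0" if "{i, j} \<in> E" "{i, k} \<in> E" "j \<noteq> k" for i j k
  proof -
    have i: "i \<in> \<Union>E" using that by blast
    show ?thesis
      by (rule generic_normals_cross[OF gn[OF i] leaf_end[OF that(1)] leaf_end[OF that(2)] _ leaf_count[OF i]])
        (use leaf_eq_iff[OF that(1,2)] that(3) in simp)
  qed
  show nz: "g i (lf i j) \<noteq> 0" if "{i, j} \<in> E" for i j
  proof -
    have i: "i \<in> \<Union>E" using that by blast
    show ?thesis using generic_normalsD(2)[OF gn[OF i], of "{lf i j}"] leaf_end[OF that] leaf_proper[OF that] by simp
  qed
  show el: "line_through {P i, P j} = nline (g i (lf i j))" if "{i, j} \<in> E" for i j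
  proof -
    have i: "i \<in> \<Union>E" using that by blast
    note st = stem_edge(2,3)[OF tree[OF i] leaf_end[OF that]]
    have "L (leaf_edge T lf i j) = nline (g i (lf i j))"
      using g[OF i] st unfolding carries_normals_def glued_edge_leaf[OF that, symmetric] by simp
    then show ?thesis using q that by (simp add: quantization_def)
  qed
  show oe: "lies_on (P i) (nline (g i (lf i j)))" if "{i, j} \<in> E" for i j
    using on_line_through[OF that] el[OF that] by simp
  show "framing_line E T lf P sg L j i k = Some (nline (g i (lf i j) + g i (lf i k)))"
    if e: "{i, j} \<in> E" "{i, k} \<in> E" "j \<noteq> k" for i j k
  proof -
    have i: "i \<in> \<Union>E" using e by blast
    obtain x where x: "x \<noteq> 0" "P i = pt x" by (rule pt_cases)
    \<comment> \<open>The line of a leaf is an edge line of the framework and hence passes through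
      \<open>P i\<close>.\<close>
    have perp: "g i w \<bullet> x = 0" if w: "w \<in> end_vertices (T i)" for w
    proof -
      obtain l where l: "{i, l} \<in> E" "w = lf i l" by (rule end_vertex_leaf[OF i w])
      then show ?thesis using oe[OF l(1)] nz[OF l(1)] x by (simp add: lies_on_iff)
    qed
    have "L (glued_edge E T lf i {u, v}) = nline (sum (g i) (leaves_beyond (T i) u v))" if "{u, v} \<in> T i" for u v
      using g[OF i] that by (simp add: carries_normals_def)
    moreover have "surgeries_applicable (T i) (sg i j k)"
      "stem (fold surgery_tree (sg i j k) (T i)) (lf i j) = stem (fold surgery_tree (sg i j k) (T i)) (lf i k)"
      using surgeries e by (auto simp: framing_surgeries_def Let_def)
    moreover have "lf i j \<noteq> lf i k" using leaf_eq_iff[OF e(1,2)] e(3) by simp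
    ultimately show ?thesis
      using leaf_end[OF e(1)] leaf_end[OF e(2)]
      by (intro framing_line_eq[where T = T and P = P and i = i, OF split_system_leaves_beyond[OF tree[OF i]] gn[OF i] x] perp) auto
  qed
qed (rule simple general)+

lemma sum_over_vertices:
  fixes F :: "'v \<Rightarrow> form2"
  assumes "i \<in> \<Union>E" "\<And>j. {i, j} \<notin> E \<Longrightarrow> F j = 0"
  shows "(\<Sum>j\<in>\<Union>E - {i}. F j) = sum F (nbrs E i)"
proof (rule sum.mono_neutral_right)
  show "finite (\<Union>E - {i})" using finite_vertices[OF simple] by simp
  show "nbrs E i \<subseteq> \<Union>E - {i}" using edge_vertices by (auto simp: nbrs_def)
  show "\<forall>j\<in>\<Union>E - {i} - nbrs E i. F j = 0" using assms(2) by (auto simp: nbrs_def)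
qed

lemma sum_over_leaves: "i \<in> \<Union>E \<Longrightarrow> (\<Sum>j\<in>nbrs E i. h (lf i j)) = sum h (end_vertices (T i))"
  by (rule sum.reindex_bij_betw[OF leaf_bij])

section \<open>From cycle conditions to a tensegrity\<close>

lemma tensegrity_if_conditions:
  assumes gq: "generic_quantization E T lf P L"
    and lab: "\<forall>C. simple_cycle E C \<and> \<Union>C \<noteq> \<Union>E \<longrightarrow> labels (lab C) C"
    and cond: "\<forall>C. simple_cycle E C \<and> \<Union>C \<noteq> \<Union>E \<longrightarrow> geometric_condition E T lf P sg L (lab C)"
  shows "\<exists>F. tensegrity E P F \<and> non_parallelizable E F"
proof -
  have "\<forall>i\<in>\<Union>E. \<exists>g. carries_normals (T i) (\<lambda>e. L (glued_edge E T lf i e)) g"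
    using gq strongly_generic_normals unfolding generic_quantization_def by blast
  then obtain g where g: "\<And>i. i \<in> \<Union>E \<Longrightarrow> carries_normals (T i) (\<lambda>e. L (glued_edge E T lf i e)) (g i)"
    by metis
  define n where "n i j = g i (lf i j)" for i j
  have "quantization E T lf P L" using gq by (simp add: generic_quantization_def)
  then interpret framed_framework E P T lf sg L n
    unfolding n_def[abs_def] by (rule framed_framework_normals) (rule g)
  have "\<exists>c. consistent c E"
    by (rule iffD1[OF geometric_conditions_iff_consistent[OF min_degree lab] cond])
  then obtain c where c: "consistent c E" by blast
  have c0: "c i \<noteq> 0" for i using c by (simp add: consistent_def)
  define F where "F i j = (if {i, j} \<in> E then form (c i *\<^sub>R n i j) else 0)" for i j
  have "force_load E P F"
    unfolding force_load_def
  proof (intro conjI allI impI)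
    fix i j assume e: "{i, j} \<in> E"
    show "force_on (line_through {P i, P j}) (F i j)"
      using e c0 by (simp add: F_def force_on_form edge_line nline_scaleR)
    have "c i *\<^sub>R n i j + c j *\<^sub>R n j i = 0" using c e by (simp add: consistent_def)
    moreover have "{j, i} \<in> E" using e by (simp add: insert_commute)
    ultimately show "F i j + F j i = 0" using e by (simp add: F_def form_add[symmetric])
  qed (simp add: F_def)
  moreover have "(\<Sum>j\<in>\<Union>E - {i}. F i j) = 0" if i: "i \<in> \<Union>E" for i
  proof -
    have "(\<Sum>j\<in>\<Union>E - {i}. F i j) = sum (F i) (nbrs E i)" by (rule sum_over_vertices[OF i]) (simp add: F_def)
    also have "\<dots> = (\<Sum>j\<in>nbrs E i. form (c i *\<^sub>R g i (lf i j)))"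
      by (rule sum.cong) (auto simp: F_def n_def nbrs_def)
    also have "\<dots> = (\<Sum>w\<in>end_vertices (T i). form (c i *\<^sub>R g i w))" by (rule sum_over_leaves[OF i])
    also have "\<dots> = form (c i *\<^sub>R sum (g i) (end_vertices (T i)))"
      by (simp add: form_sum scaleR_sum_right)
    also have "\<dots> = 0" using g[OF i] by (simp add: carries_normals_def)
    finally show ?thesis .
  qed
  ultimately have "tensegrity E P F" by (simp add: tensegrity_def)
  moreover have "non_parallelizable E F"
    unfolding non_parallelizable_def
  proof
    fix i assume i: "i \<in> \<Union>E"
    have "nonparallel_forces (end_vertices (T i)) (\<lambda>w. form (c i *\<^sub>R g i w))"
      using g[OF i] by (intro nonparallel_forces_scale[OF c0]) (simp add: carries_normals_def)
    then have "nonparallel_forces (nbrs E i) (\<lambda>j. form (c i *\<^sub>R g i (lf i j)))"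
      by (simp add: nonparallel_forces_bij[OF leaf_bij[OF i]])
    then show "nonparallel_forces (nbrs E i) (F i)"
      by (subst nonparallel_forces_cong[of _ _ "\<lambda>j. form (c i *\<^sub>R g i (lf i j))"])
        (auto simp: F_def n_def nbrs_def)
  qed
  ultimately show ?thesis by blast
qed

section \<open>From a tensegrity to a generic quantization\<close>

lemma conditions_if_tensegrity:
  assumes F: "tensegrity E P F" "non_parallelizable E F"
    and lab: "\<forall>C. simple_cycle E C \<and> \<Union>C \<noteq> \<Union>E \<longrightarrow> labels (lab C) C"
  shows "\<exists>L. generic_quantization E T lf P L \<and>
    (\<forall>C. simple_cycle E C \<and> \<Union>C \<noteq> \<Union>E \<longrightarrow> geometric_condition E T lf P sg L (lab C))"
proof -
  have F1: "force_on (line_through {P i, P j}) (F i j)" "F i j + F j i = 0" if "{i, j} \<in> E" for i j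
    using F(1) that unfolding tensegrity_def force_load_def by blast+
  have F0: "F i j = 0" if "{i, j} \<notin> E" for i j
    using F(1) that unfolding tensegrity_def force_load_def by blast
  define n where "n i j = (SOME v. F i j = form v)" for i j
  have n: "F i j = form (n i j)" if "{i, j} \<in> E" for i j
  proof -
    have "force_on (line_through {P i, P j}) (F i j)" using F1(1) that by blast
    then obtain v where "F i j = form v" by (rule force_on_cases)
    then show ?thesis unfolding n_def by (rule someI)
  qed
  define g where "g i w = n i (inv_into (nbrs E i) (lf i) w)" for i w
  have g: "g i (lf i j) = n i j" if "{i, j} \<in> E" for i j
  proof -
    have "i \<in> \<Union>E" "j \<in> nbrs E i" using that by (auto simp: nbrs_def)
    then show ?thesis unfolding g_def by (simp add: bij_betw_inv_into_left[OF leaf_bij])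
  qed
  have s0: "sum (g i) (end_vertices (T i)) = 0" if i: "i \<in> \<Union>E" for i
  proof -
    have "form (sum (g i) (end_vertices (T i))) = (\<Sum>j\<in>nbrs E i. form (g i (lf i j)))"
      unfolding sum_over_leaves[OF i, symmetric] by (rule form_sum)
    also have "\<dots> = sum (F i) (nbrs E i)" by (rule sum.cong) (auto simp: g n nbrs_def)
    also have "\<dots> = (\<Sum>j\<in>\<Union>E - {i}. F i j)" by (rule sum_over_vertices[OF i F0, symmetric])
    also have "\<dots> = 0" using F(1) i unfolding tensegrity_def by blast
    finally show ?thesis by simp
  qed
  have np: "nonparallel_forces (end_vertices (T i)) (\<lambda>w. form (g i w))" if i: "i \<in> \<Union>E" for i
  proof -
    have "nonparallel_forces (nbrs E i) (F i)" using F(2) i unfolding non_parallelizable_def by blast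
    then have "nonparallel_forces (nbrs E i) (\<lambda>j. form (g i (lf i j)))"
      by (subst nonparallel_forces_cong[of _ _ "F i"]) (auto simp: g n nbrs_def)
    then show ?thesis by (simp add: nonparallel_forces_bij[OF leaf_bij[OF i]])
  qed
  have gn: "generic_normals (end_vertices (T i)) (g i)" if i: "i \<in> \<Union>E" for i
    by (rule generic_normals_if_nonparallel[OF np[OF i] s0[OF i] finite_end_vertices[OF tree[OF i]]])
  have nz: "n i j \<noteq> 0" and el: "line_through {P i, P j} = nline (n i j)" if e: "{i, j} \<in> E" for i j
  proof -
    have i: "i \<in> \<Union>E" using e by blast
    show "n i j \<noteq> 0"
      using generic_normalsD(2)[OF gn[OF i], of "{lf i j}"] leaf_end[OF e] leaf_proper[OF e] g[OF e] by simp
    then show "line_through {P i, P j} = nline (n i j)" using F1(1)[OF e] by (simp add: n[OF e] force_on_form)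
  qed
  define N where "N i u v = sum (g i) (leaves_beyond (T i) u v)" for i u v
  have flip: "nline (N i v u) = nline (N i u v)" if i: "i \<in> \<Union>E" and uv: "{u, v} \<in> T i" for i u v
    unfolding N_def split_systemD(4)[OF split_system_leaves_beyond[OF tree[OF i]] uv]
    by (simp add: generic_normals_complement[OF gn[OF i] finite_end_vertices[OF tree[OF i]]
        leaves_beyond_proper(1)[OF tree[OF i] uv]] nline_minus)
  \<comment> \<open>Reversing an edge changes \<open>N\<close> by a sign, which \<open>nline\<close>
    ignores; so an arbitrary ordering of the two ends may be chosen.\<close>
  define M where "M i e = (let (u, v) = (SOME (u, v). e = {u, v}) in nline (N i u v))" for i e
  have M: "M i {u, v} = nline (N i u v)" if i: "i \<in> \<Union>E" and uv: "{u, v} \<in> T i" for i u v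
  proof -
    obtain u' v' where s: "(SOME (u', v'). {u, v} = {u', v'}) = (u', v')" by fastforce
    have "case (SOME (u', v'). {u, v} = {u', v'}) of (u', v') \<Rightarrow> {u, v} = {u', v'}"
      by (rule someI[of _ "(u, v)"]) simp
    then have "{u, v} = {u', v'}" unfolding s prod.case .
    then have "u' = u \<and> v' = v \<or> u' = v \<and> v' = u" by (auto simp: doubleton_eq_iff)
    then show ?thesis unfolding M_def s using flip[OF i uv] by auto
  qed
  \<comment> \<open>The tags tell the edges apart: an interior edge carries one tag, a glued leaf
    two different ones, and these name the framework edge.\<close>
  define L where "L X = (if \<exists>i j. {i, j} \<in> E \<and> X = leaf_edge T lf i j then line_through (P ` fst ` X)
    else M (the_elem (fst ` X)) (snd ` X))" for X
  have Ll: "L (leaf_edge T lf i j) = line_through {P i, P j}" if "{i, j} \<in> E" for i j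
    using that by (auto simp: L_def leaf_edge_def)
  have Li: "L (Pair i ` {u, v}) = M i {u, v}" for i u v
  proof -
    have "Pair i ` {u, v} \<noteq> leaf_edge T lf j k" if "{j, k} \<in> E" for j k
    proof
      assume "Pair i ` {u, v} = leaf_edge T lf j k"
      then have "fst ` Pair i ` {u, v} = fst ` leaf_edge T lf j k" by simp
      then have "{i} = {j, k}" by (simp add: leaf_edge_def image_image)
      then show False using edge_vertices[OF that] by auto
    qed
    moreover have "fst ` Pair i ` {u, v} = {i}" "snd ` Pair i ` {u, v} = {u, v}" by (auto simp: image_image)
    ultimately show ?thesis unfolding L_def by (simp only: the_elem_eq) (metis (no_types))
  qed
  have LN: "L (glued_edge E T lf i {u, v}) = nline (N i u v)" if i: "i \<in> \<Union>E" and uv: "{u, v} \<in> T i" for i u v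
    using i uv
  proof (cases rule: tree_edge_cases)
    case 1
    then show ?thesis using glued_edge_interior[OF i 1] Li M[OF i uv] by simp
  next
    case (2 j)
    let ?w = "lf i j"
    have "N i (stem (T i) ?w) ?w = n i j"
      using stem_edge(3)[OF tree[OF i] leaf_end[OF 2(1)]] g[OF 2(1)] by (simp add: N_def)
    then have "L (glued_edge E T lf i {u, v}) = nline (N i (stem (T i) ?w) ?w)"
      using glued_edge_leaf[OF 2(1)] Ll[OF 2(1)] el[OF 2(1)] 2(2) by simp
    moreover have "nline (N i (stem (T i) ?w) ?w) = nline (N i u v)"
      using flip[OF i uv] 2(2) by (auto simp: doubleton_eq_iff)
    ultimately show ?thesis by simp
  qed
  have cn: "carries_normals (T i) (\<lambda>e. L (glued_edge E T lf i e)) (g i)" if i: "i \<in> \<Union>E" for i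
    using s0[OF i] np[OF i] LN[OF i] unfolding carries_normals_def N_def by blast
  have sgen: "strongly_generic (P i) (T i) (\<lambda>e. L (glued_edge E T lf i e))" if i: "i \<in> \<Union>E" for i
  proof -
    obtain x where x: "x \<noteq> 0" "P i = pt x" by (rule pt_cases)
    have "g i w \<bullet> x = 0" if w: "w \<in> end_vertices (T i)" for w
    proof -
      obtain j where j: "{i, j} \<in> E" "w = lf i j" by (rule end_vertex_leaf[OF i w])
      have "lies_on (P i) (nline (n i j))" using on_line_through[OF j(1)] el[OF j(1)] by simp
      then show ?thesis using nz[OF j(1)] x g[OF j(1)] j(2) by (simp add: lies_on_iff)
    qed
    then show ?thesis unfolding x(2) by (rule strongly_generic_if_normals[OF tree[OF i] cn[OF i] x(1)])
  qed
  have q: "quantization E T lf P L"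
    unfolding quantization_def
  proof (intro conjI allI impI ballI)
    fix i e assume i: "i \<in> \<Union>E" and e: "e \<in> interior_edges (T i)"
    have "e \<in> T i" using e by (simp add: interior_edges_def)
    then have "lies_on (P i) (L (glued_edge E T lf i e))"
      using sgen[OF i] unfolding strongly_generic_def weakly_generic_def resolution_scheme_def by blast
    then show "lies_on (P i) (L (Pair i ` e))" using glued_edge_interior[OF i e] by simp
  qed (rule Ll)
  then have gq: "generic_quantization E T lf P L" using sgen by (simp add: generic_quantization_def)
  interpret framed_framework E P T lf sg L "\<lambda>i j. g i (lf i j)"
    by (rule framed_framework_normals[OF q cn])
  have "n i j + n j i = 0" if e: "{i, j} \<in> E" for i j
  proof -
    have "{j, i} \<in> E" using e by (simp add: insert_commute)
    then have "form (n i j + n j i) = 0" using F1(2)[OF e] n[OF e] n[of j i] by (simp add: form_add)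
    then show ?thesis by simp
  qed
  then have "consistent (\<lambda>_. 1) E"
    unfolding consistent_def using g by (auto simp: insert_commute)
  then have "\<exists>c. consistent c E" by blast
  from iffD2[OF geometric_conditions_iff_consistent[OF min_degree lab] this] gq show ?thesis by blast
qed

end

theorem theorem2p18:
  fixes E :: "'v set set"
    and P :: "'v \<Rightarrow> rp2_point"
    and T :: "'v \<Rightarrow> 't set set"
    and lf :: "'v \<Rightarrow> 'v \<Rightarrow> 't"
    and en :: "'v \<Rightarrow> nat \<Rightarrow> 't set"
    and sg :: "'v \<Rightarrow> 'v \<Rightarrow> 'v \<Rightarrow> 't surgery list"
    and lab :: "'v set set \<Rightarrow> 'v list"
  assumes graph: "simple_graph E" "connected_graph E"
    and min_degree: "\<forall>v \<in> \<Union>E. 3 \<le> vdegree E v"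
    and framework: "inj_on P (\<Union>E)" "framework_general_position E P"
    and resolution: "resolution_trees E T lf" "interior_enumeration E T en"
    and framing: "framing_surgeries E T lf sg"
    and labelling: "\<forall>C. simple_cycle E C \<and> \<Union>C \<noteq> \<Union>E \<longrightarrow> labels (lab C) C"
  shows "(\<exists>F. tensegrity E P F \<and> non_parallelizable E F) \<longleftrightarrow>
    (\<exists>l \<in> config_space E P. \<exists>L.
       associated_quantization E T lf P en l L \<and> generic_quantization E T lf P L \<and>
       (\<forall>C. simple_cycle E C \<and> \<Union>C \<noteq> \<Union>E \<longrightarrow> geometric_condition E T lf P sg L (lab C)))"
proof -
  interpret resolved_framework E P T lf sg
    by unfold_locales (fact graph(1) min_degree framework resolution(1) framing)+
  show ?thesis
  proof
    assume "\<exists>F. tensegrity E P F \<and> non_parallelizable E F"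
    then obtain F where F: "tensegrity E P F" "non_parallelizable E F" by blast
    obtain L where L: "generic_quantization E T lf P L"
      "\<forall>C. simple_cycle E C \<and> \<Union>C \<noteq> \<Union>E \<longrightarrow> geometric_condition E T lf P sg L (lab C)"
      using conditions_if_tensegrity[OF F labelling] by blast
    have q: "quantization E T lf P L" using L(1) by (simp add: generic_quantization_def)
    define l where "l i j = L (Pair i ` en i j)" for i j
    have "en i j \<in> interior_edges (T i)" if "i \<in> \<Union>E" "j \<in> {1..vdegree E i - 3}" for i j
      using resolution(2) that unfolding interior_enumeration_def by (metis bij_betwE)
    then have "l \<in> config_space E P"
      using q unfolding config_space_def quantization_def l_def by blast
    moreover have "associated_quantization E T lf P en l L"
      using q by (simp add: associated_quantization_def l_def)
    ultimately show "\<exists>l \<in> config_space E P. \<exists>L.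
       associated_quantization E T lf P en l L \<and> generic_quantization E T lf P L \<and>
       (\<forall>C. simple_cycle E C \<and> \<Union>C \<noteq> \<Union>E \<longrightarrow> geometric_condition E T lf P sg L (lab C))"
      using L by blast
  qed (use tensegrity_if_conditions[OF _ labelling] in blast)
qed

end
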